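(* Let $C$ be a cocommutative rack bialgebra over a field $k$, let $\check C=\ker\epsilon$, and let $U(C)$ be its universal enveloping algebra with canonical map $q\colon C\to U(C)$. Then the linear map $$f\colon U(C)\otimes\check C\to U(C),\qquad s\otimes c\mapsto s\,q(c),$$ is a bialgebra object in Loday-Pirashvili's category of linear maps $\mathcal{LM}$, with respect to the bialgebra structure on $U(C)$ and the actions and coactions on $U(C)\otimes\check C$ specified in the context. That is, $U(C)\otimes\check C$ is a tetramodule over the bialgebra $U(C)$, and $f$ is a $U(C)$-bilinear coderivation.
   Context: All vector spaces, coalgebras, etc. are over a field $k$; Sweedler notation $\triangle(z)=z_{(1)}\otimes z_{(2)}$ is used. A rack bialgebra is a coassociative counital coalgebra $(C,\triangle,\epsilon)$ with a distinguished group-like element $1\in C$ ($\triangle(1)=1\otimes 1$, $\epsilon(1)=1$) together with a morphism of coalgebras $\lhd\colon C\otimes C\to C$ such that for all $x,y,z\in C$: $(x\lhd y)\lhd z=(x\lhd z_{(1)})\lhd(y\lhd z_{(2)})$, $x\lhd 1=x$, $1\lhd x=\epsilon(x)1$, $\epsilon(x\lhd y)=\epsilon(x)\epsilon(y)$. It is cocommutative if its underlying coalgebra is. For a rack bialgebra $C$, put $\check C=\ker\epsilon$, so $C=k1\oplus\check C$. Let $T=\bigoplus_{n\ge 0}\check C^{\otimes n}$ be the tensor algebra of $\check C$, with product denoted by a dot, and let $i\colon C\to T$ be the inclusion that is the identity on $\check C$ and sends $1\in C$ to $1\in k=\check C^{\otimes 0}$. $T$ is a bialgebra whose coproduct $\triangle_T$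 is the unique algebra map with $\triangle_T(i(x))=i(x_{(1)})\otimes i(x_{(2)})$ for $x\in\check C$, and whose counit is the algebra map vanishing on $\check C$. $C$ is a right $T$-module via the unique right action $\cdot$ with $y\cdot i(x)=y\lhd x$ for $x\in\check C$, $y\in C$. Let $J\subset T$ be the two-sided ideal generated by all $i(y_{(1)}).i(x\lhd y_{(2)})-i(x).i(y)$, $x,y\in C$. The universal enveloping algebra is $U(C):=T/J$, and $q\colon C\to U(C)$ is the composition of $i$ with the quotient map. When $C$ is cocommutative, the coproduct and counit of $T$ descend to $U(C)$, making it a bialgebra, and the action of $T$ on $C$ descends to a right action $\cdot$ of $U(C)$ on $C$ which preserves $\check C$. A bialgebra object in $\mathcal{LM}$ (the category of linear maps between vector spaces with the infinitesimal tensor product) consists of a bialgebra $H$, an $H$-tetramodule $M$, and an $H$-bilinear coderivation $f\colon M\to H$. Here an $H$-tetramodule is an $H$-bimodule and $H$-bicomodule $M$, with coactions $m\mapsto m_{(-1)}\otimes m_{(0)}\in H\otimes M$ and $m\mapsto m_{(0)}\otimes m_{(1)}\in M\otimes H$, such that both coactions are $H$-bimodule maps ($H$ acting on $H\otimes M$ and $M\otimes H$ on both sides through its coproduct). A linear map $f\colon M\to H$ is a coderivation if $\triangle(f(m))=m_{(-1)}\otimes f(m_{(0)})+f(m_{(0)})\otimes m_{(1)}$ for all $m\in M$. Structure on $M=U(C)\otimes\check C$, with $H=U(C)$: the space $\check C$ carries the right action $\cdot$ of $H$ and the right $H$-coaction $v\mapsto v_{(0)}\otimes v_{(1)}:=(v_{(1)}-\epsilon(v_{(1)})1)\otimes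 q(v_{(2)})$, where on the right-hand side $v_{(1)}\otimes v_{(2)}=\triangle(v)$ is the coproduct of $C$. The bimodule structure of $M$ is $g(h\otimes v)g'=ghg'_{(1)}\otimes v\cdot g'_{(2)}$, and the left and right coactions are given jointly by $$(h\otimes v)_{(-1)}\otimes(h\otimes v)_{(0)}\otimes(h\otimes v)_{(1)}=h_{(1)}\otimes(h_{(2)}\otimes v_{(0)})\otimes h_{(3)}v_{(1)}.$$ *)

theory Defs
  imports "HOL.Vector_Spaces" "HOL-Library.Poly_Mapping"
begin

section \<open>Vector spaces, free vector spaces and quotients\<close>

text \<open>
  A vector space over the field \<open>'k\<close> is a subspace (the carrier) of a type on which
  a scalar multiplication is given.
\<close>

record ('k, 'v) space =
  vcarrier :: "'v set"
  vscale :: "'k \<Rightarrow> 'v \<Rightarrow> 'v"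

definition is_space :: "('k::field, 'v::ab_group_add, 'z) space_scheme \<Rightarrow> bool" where
  "is_space V \<longleftrightarrow> vector_space (vscale V) \<and> module.subspace (vscale V) (vcarrier V)"

definition ground :: "('k::field, 'k) space" where
  "ground = \<lparr>vcarrier = UNIV, vscale = (*)\<rparr>"

definition linear_map ::
  "('k::field, 'v::ab_group_add, 'y) space_scheme \<Rightarrow> ('k, 'w::ab_group_add, 'z) space_scheme
    \<Rightarrow> ('v \<Rightarrow> 'w) \<Rightarrow> bool" where
  "linear_map V W f \<longleftrightarrow>
     (\<forall>x\<in>vcarrier V. f x \<in> vcarrier W) \<and>
     (\<forall>x\<in>vcarrier V. \<forall>y\<in>vcarrier V. f (x + y) = f x + f y) \<and>
     (\<forall>a. \<forall>x\<in>vcarrier V. f (vscale V a x) = vscale W a (f x))"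

definition bilinear_map ::
  "('k::field, 'v::ab_group_add, 'x) space_scheme \<Rightarrow> ('k, 'w::ab_group_add, 'y) space_scheme
    \<Rightarrow> ('k, 'u::ab_group_add, 'z) space_scheme \<Rightarrow> ('v \<Rightarrow> 'w \<Rightarrow> 'u) \<Rightarrow> bool" where
  "bilinear_map V W Z f \<longleftrightarrow>
     (\<forall>v\<in>vcarrier V. linear_map W Z (f v)) \<and>
     (\<forall>w\<in>vcarrier W. linear_map V Z (\<lambda>v. f v w))"

definition free_scale :: "'k::field \<Rightarrow> ('x \<Rightarrow>\<^sub>0 'k) \<Rightarrow> ('x \<Rightarrow>\<^sub>0 'k)" where
  "free_scale a p = Poly_Mapping.map ((*) a) p"

definition gen :: "'x \<Rightarrow> ('x \<Rightarrow>\<^sub>0 'k::field)" where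
  "gen x = Poly_Mapping.single x 1"

definition free_space :: "'x set \<Rightarrow> ('k::field, 'x \<Rightarrow>\<^sub>0 'k) space" where
  "free_space X = \<lparr>vcarrier = {p. Poly_Mapping.keys p \<subseteq> X}, vscale = free_scale\<rparr>"

definition lin_ext ::
  "('k::field, 'v::ab_group_add, 'z) space_scheme \<Rightarrow> ('x \<Rightarrow> 'v) \<Rightarrow> ('x \<Rightarrow>\<^sub>0 'k) \<Rightarrow> 'v" where
  "lin_ext Z g p = (\<Sum>x\<in>Poly_Mapping.keys p. vscale Z (Poly_Mapping.lookup p x) (g x))"

text \<open>
  The quotient \<open>V/N\<close> is realised inside the type of \<open>V\<close>, as the image of a linear
  projection with kernel \<open>N\<close>; that projection is then the quotient map (see
  \<open>quotient_map\<close> below: it is linear and \<open>x\<close>, \<open>y\<close> have the same image iff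
  \<open>x - y \<in> N\<close>). Since it is idempotent, every element of the quotient is a representative
  of itself, and it lies in the carrier of \<open>V\<close> whenever \<open>N\<close> does. Hence a map on \<open>V\<close> that
  vanishes on \<open>N\<close> descends to \<open>V/N\<close> by plain restriction.
\<close>

definition quotient_map :: "('k::field \<Rightarrow> 'v::ab_group_add \<Rightarrow> 'v) \<Rightarrow> 'v set \<Rightarrow> 'v \<Rightarrow> 'v" where
  "quotient_map s N = (SOME p. Vector_Spaces.linear s s p \<and> (\<forall>x. p (p x) = p x) \<and>
     (\<forall>x. p x = 0 \<longleftrightarrow> x \<in> N))"

definition quotient_space ::
  "('k::field, 'v::ab_group_add, 'z) space_scheme \<Rightarrow> 'v set \<Rightarrow> ('k, 'v) space" where
  "quotient_space V N =
     \<lparr>vcarrier = quotient_map (vscale V) N ` vcarrier V, vscale = vscale V\<rparr>"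

lemma lookup_free_scale [simp]:
  "Poly_Mapping.lookup (free_scale a p) x = a * Poly_Mapping.lookup p x"
  by (auto simp: free_scale_def Poly_Mapping.map.rep_eq when_def)

lemma vector_space_free_scale: "vector_space (free_scale :: 'k::field \<Rightarrow> ('x \<Rightarrow>\<^sub>0 'k) \<Rightarrow> _)"
  by unfold_locales
    (auto intro!: poly_mapping_eqI simp: Poly_Mapping.lookup_add algebra_simps)

lemma module_free_scale: "module (free_scale :: 'k::field \<Rightarrow> ('x \<Rightarrow>\<^sub>0 'k) \<Rightarrow> _)"
  using vector_space_free_scale by (simp add: module_iff_vector_space)

lemma quotient_map_exists:
  assumes "vector_space s" and "module.subspace s N"
  shows "\<exists>p. Vector_Spaces.linear s s p \<and> (\<forall>x. p (p x) = p x) \<and> (\<forall>x. p x = 0 \<longleftrightarrow> x \<in> N)"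
proof -
  interpret vector_space s by fact
  interpret vp: vector_space_pair s s ..
  obtain B where B: "B \<subseteq> N" "independent B" "N \<subseteq> span B"
    using maximal_independent_subset[of N] by blast
  have N: "N = span B"
    using B span_minimal[OF B(1)] assms(2) by blast
  define E where "E = extend_basis B"
  have E: "independent E" "B \<subseteq> E" "span E = UNIV"
    using B(2) extend_basis_superset independent_extend_basis span_extend_basis
    unfolding E_def by auto
  define p where "p = vp.construct E (\<lambda>b. if b \<in> B then 0 else b)"
  have lin: "Vector_Spaces.linear s s p"
    unfolding p_def by (rule vp.linear_construct[OF E(1)])
  interpret p: Vector_Spaces.linear s s p by fact
  have pb: "p b = (if b \<in> B then 0 else b)" if "b \<in> E" for b
    unfolding p_def using vp.construct_basis[OF E(1) that] by simp
  have p0: "p x = 0" if "x \<in> span B" for x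
    by (rule p.eq_0_on_span[OF _ that]) (use pb E(2) in auto)
  have p1: "p x = x" if "x \<in> span (E - B)" for x
    by (rule vp.linear_eq_on_span[OF lin linear_ident _ that]) (use pb in auto)
  have key: "\<exists>n c. x = n + c \<and> n \<in> N \<and> p n = 0 \<and> p c = c \<and> p x = c" for x
  proof -
    have "x \<in> span (B \<union> (E - B))"
      using E by (simp add: Un_absorb1)
    then obtain n c where "x = n + c" "n \<in> span B" "c \<in> span (E - B)"
      unfolding span_Un by blast
    then show ?thesis
      using p0 p1 N by (intro exI[of _ n] exI[of _ c]) (auto simp: p.add)
  qed
  have "p (p x) = p x" for x using key[of x] by auto
  moreover have "p x = 0 \<longleftrightarrow> x \<in> N" for x using key[of x] p0 N by auto
  ultimately show ?thesis using lin by blast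
qed

lemma quotient_map:
  assumes "vector_space s" and "module.subspace s N"
  shows linear_quotient_map: "Vector_Spaces.linear s s (quotient_map s N)"
    and quotient_map_idem: "quotient_map s N (quotient_map s N x) = quotient_map s N x"
    and quotient_map_eq_0_iff: "quotient_map s N x = 0 \<longleftrightarrow> x \<in> N"
  using someI_ex[OF quotient_map_exists[OF assms]] unfolding quotient_map_def by blast+

lemma quotient_map_eq_iff:
  assumes "vector_space s" and "module.subspace s N"
  shows "quotient_map s N x = quotient_map s N y \<longleftrightarrow> x - y \<in> N"
proof -
  interpret Vector_Spaces.linear s s "quotient_map s N" by (rule linear_quotient_map[OF assms])
  show ?thesis using quotient_map_eq_0_iff[OF assms, of "x - y"] by (simp add: diff)
qed

lemma linear_lin_ext:
  assumes "vector_space (vscale Z)"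
  shows "Vector_Spaces.linear free_scale (vscale Z) (lin_ext Z g)"
proof -
  interpret Z: vector_space "vscale Z" by fact
  interpret F: vector_space free_scale by (rule vector_space_free_scale)
  have ext: "lin_ext Z g p = (\<Sum>x\<in>A. vscale Z (Poly_Mapping.lookup p x) (g x))"
    if "finite A" "Poly_Mapping.keys p \<subseteq> A" for A p
    unfolding lin_ext_def using that
    by (intro sum.mono_neutral_left) (auto simp: in_keys_iff)
  have add: "lin_ext Z g (p + q) = lin_ext Z g p + lin_ext Z g q" for p q
  proof -
    let ?A = "Poly_Mapping.keys p \<union> Poly_Mapping.keys q"
    show ?thesis
      using Poly_Mapping.keys_add[of p q]
      by (simp add: ext[of ?A] Poly_Mapping.lookup_add Z.scale_left_distrib sum.distrib)
  qed
  have "lin_ext Z g (free_scale a p) = vscale Z a (lin_ext Z g p)" for a p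
  proof -
    have "Poly_Mapping.keys (free_scale a p) \<subseteq> Poly_Mapping.keys p"
      by (auto simp: in_keys_iff)
    then show ?thesis
      by (simp add: ext[of "Poly_Mapping.keys p"] Z.scale_sum_right)
  qed
  with add show ?thesis by unfold_locales auto
qed

lemma lin_ext_gen:
  assumes "vector_space (vscale Z)"
  shows "lin_ext Z g (gen x) = g x"
proof -
  interpret Z: vector_space "vscale Z" by fact
  show ?thesis by (simp add: lin_ext_def gen_def)
qed


section \<open>Tensor products\<close>

definition tensor_rel ::
  "('k::field, 'v::ab_group_add, 'y) space_scheme \<Rightarrow> ('k, 'w::ab_group_add, 'z) space_scheme
    \<Rightarrow> (('v \<times> 'w) \<Rightarrow>\<^sub>0 'k) set" where
  "tensor_rel V W = module.span free_scale
     ({gen (v + v', w) - gen (v, w) - gen (v', w) | v v' w.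
         v \<in> vcarrier V \<and> v' \<in> vcarrier V \<and> w \<in> vcarrier W} \<union>
      {gen (v, w + w') - gen (v, w) - gen (v, w') | v w w'.
         v \<in> vcarrier V \<and> w \<in> vcarrier W \<and> w' \<in> vcarrier W} \<union>
      {gen (vscale V a v, w) - free_scale a (gen (v, w)) | a v w.
         v \<in> vcarrier V \<and> w \<in> vcarrier W} \<union>
      {gen (v, vscale W a w) - free_scale a (gen (v, w)) | a v w.
         v \<in> vcarrier V \<and> w \<in> vcarrier W})"

definition tensor ::
  "('k::field, 'v::ab_group_add, 'y) space_scheme \<Rightarrow> ('k, 'w::ab_group_add, 'z) space_scheme
    \<Rightarrow> ('k, ('v \<times> 'w) \<Rightarrow>\<^sub>0 'k) space"  (infixr "\<otimes>\<^sub>k" 70) where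
  "V \<otimes>\<^sub>k W = quotient_space (free_space (vcarrier V \<times> vcarrier W)) (tensor_rel V W)"

definition tens ::
  "('k::field, 'v::ab_group_add, 'y) space_scheme \<Rightarrow> ('k, 'w::ab_group_add, 'z) space_scheme
    \<Rightarrow> 'v \<Rightarrow> 'w \<Rightarrow> (('v \<times> 'w) \<Rightarrow>\<^sub>0 'k)" where
  "tens V W v w = quotient_map free_scale (tensor_rel V W) (gen (v, w))"

text \<open>
  For \<open>f\<close> bilinear, \<open>tensor_lift Z f\<close> is the linear map \<open>V \<otimes> W \<rightarrow> Z\<close> with
  \<open>v \<otimes> w \<mapsto> f v w\<close>; so \<open>tensor_lift Z f t\<close> is Sweedler's \<open>f t\<^sub>(\<^sub>1\<^sub>) t\<^sub>(\<^sub>2\<^sub>)\<close>.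
\<close>

definition tensor_lift ::
  "('k::field, 'u::ab_group_add, 'z) space_scheme \<Rightarrow> ('v \<Rightarrow> 'w \<Rightarrow> 'u) \<Rightarrow> (('v \<times> 'w) \<Rightarrow>\<^sub>0 'k) \<Rightarrow> 'u"
  where
  "tensor_lift Z f = lin_ext Z (\<lambda>(v, w). f v w)"

definition tensor_map ::
  "('k::field, 'a::ab_group_add, 'y) space_scheme \<Rightarrow> ('k, 'b::ab_group_add, 'z) space_scheme
    \<Rightarrow> ('v \<Rightarrow> 'a) \<Rightarrow> ('w \<Rightarrow> 'b) \<Rightarrow> (('v \<times> 'w) \<Rightarrow>\<^sub>0 'k) \<Rightarrow> (('a \<times> 'b) \<Rightarrow>\<^sub>0 'k)" where
  "tensor_map A B f g = tensor_lift (A \<otimes>\<^sub>k B) (\<lambda>v w. tens A B (f v) (g w))"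

text \<open>\<open>tensor_op A B f g (v \<otimes> w) (v' \<otimes> w') = f v v' \<otimes> g w w'\<close> in \<open>A \<otimes> B\<close>.\<close>

definition tensor_op ::
  "('k::field, 'a::ab_group_add, 'y) space_scheme \<Rightarrow> ('k, 'b::ab_group_add, 'z) space_scheme
    \<Rightarrow> ('v \<Rightarrow> 'v' \<Rightarrow> 'a) \<Rightarrow> ('w \<Rightarrow> 'w' \<Rightarrow> 'b)
    \<Rightarrow> (('v \<times> 'w) \<Rightarrow>\<^sub>0 'k) \<Rightarrow> (('v' \<times> 'w') \<Rightarrow>\<^sub>0 'k) \<Rightarrow> (('a \<times> 'b) \<Rightarrow>\<^sub>0 'k)" where
  "tensor_op A B f g s t =
     tensor_lift (A \<otimes>\<^sub>k B)
       (\<lambda>v w. tensor_lift (A \<otimes>\<^sub>k B) (\<lambda>v' w'. tens A B (f v v') (g w w')) t) s"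

definition tensor_swap ::
  "('k::field, 'v::ab_group_add, 'y) space_scheme \<Rightarrow> ('k, 'w::ab_group_add, 'z) space_scheme
    \<Rightarrow> (('v \<times> 'w) \<Rightarrow>\<^sub>0 'k) \<Rightarrow> (('w \<times> 'v) \<Rightarrow>\<^sub>0 'k)" where
  "tensor_swap V W = tensor_lift (W \<otimes>\<^sub>k V) (\<lambda>v w. tens W V w v)"

definition tensor_assoc ::
  "('k::field, 'u::ab_group_add, 'x) space_scheme \<Rightarrow> ('k, 'v::ab_group_add, 'y) space_scheme
    \<Rightarrow> ('k, 'w::ab_group_add, 'z) space_scheme
    \<Rightarrow> (((('u \<times> 'v) \<Rightarrow>\<^sub>0 'k) \<times> 'w) \<Rightarrow>\<^sub>0 'k) \<Rightarrow> (('u \<times> (('v \<times> 'w) \<Rightarrow>\<^sub>0 'k)) \<Rightarrow>\<^sub>0 'k)" where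
  "tensor_assoc U V W =
     tensor_lift (U \<otimes>\<^sub>k (V \<otimes>\<^sub>k W))
       (\<lambda>s w. tensor_lift (U \<otimes>\<^sub>k (V \<otimes>\<^sub>k W)) (\<lambda>u v. tens U (V \<otimes>\<^sub>k W) u (tens V W v w)) s)"

lemma vscale_tensor [simp]: "vscale (V \<otimes>\<^sub>k W) = free_scale"
  by (simp add: tensor_def quotient_space_def free_space_def)

lemma subspace_tensor_rel: "module.subspace free_scale (tensor_rel V W)"
  unfolding tensor_rel_def by (rule module.subspace_span[OF module_free_scale])

lemma tens_in_tensor:
  "v \<in> vcarrier V \<Longrightarrow> w \<in> vcarrier W \<Longrightarrow> tens V W v w \<in> vcarrier (V \<otimes>\<^sub>k W)"
  by (auto simp: tens_def tensor_def quotient_space_def free_space_def gen_def)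

lemma tens_bilinear:
  assumes "v \<in> vcarrier V" "w \<in> vcarrier W"
  shows "v' \<in> vcarrier V \<Longrightarrow> tens V W (v + v') w = tens V W v w + tens V W v' w"
    and "w' \<in> vcarrier W \<Longrightarrow> tens V W v (w + w') = tens V W v w + tens V W v w'"
    and "tens V W (vscale V a v) w = free_scale a (tens V W v w)"
    and "tens V W v (vscale W a w) = free_scale a (tens V W v w)"
proof -
  note vs = vector_space_free_scale and sub = subspace_tensor_rel[of V W]
  interpret F: vector_space free_scale by (rule vs)
  interpret q: Vector_Spaces.linear free_scale free_scale "quotient_map free_scale (tensor_rel V W)"
    by (rule linear_quotient_map[OF vs sub])
  note eq = quotient_map_eq_iff[OF vs sub]
  show "tens V W (v + v') w = tens V W v w + tens V W v' w" if "v' \<in> vcarrier V"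
    unfolding tens_def q.add[symmetric] eq unfolding tensor_rel_def
    by (rule F.span_base) (use assms that in \<open>auto simp: diff_diff_eq\<close>)
  show "tens V W v (w + w') = tens V W v w + tens V W v w'" if "w' \<in> vcarrier W"
    unfolding tens_def q.add[symmetric] eq unfolding tensor_rel_def
    by (rule F.span_base) (use assms that in \<open>auto simp: diff_diff_eq\<close>)
  show "tens V W (vscale V a v) w = free_scale a (tens V W v w)"
    unfolding tens_def q.scale[symmetric] eq unfolding tensor_rel_def
    by (rule F.span_base) (use assms in auto)
  show "tens V W v (vscale W a w) = free_scale a (tens V W v w)"
    unfolding tens_def q.scale[symmetric] eq unfolding tensor_rel_def
    by (rule F.span_base) (use assms in auto)
qed

lemma tensor_lift_tens:
  assumes "bilinear_map V W Z f" "vector_space (vscale Z)"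
    and "v \<in> vcarrier V" "w \<in> vcarrier W" "is_space V" "is_space W"
  shows "tensor_lift Z f (tens V W v w) = f v w"
proof -
  note vs = vector_space_free_scale and sub = subspace_tensor_rel[of V W]
  interpret F: vector_space free_scale by (rule vs)
  interpret V: vector_space "vscale V" using assms by (simp add: is_space_def)
  interpret W: vector_space "vscale W" using assms by (simp add: is_space_def)
  have clV: "x + y \<in> vcarrier V" "vscale V a x \<in> vcarrier V"
    if "x \<in> vcarrier V" "y \<in> vcarrier V" for x y a
    using assms that by (auto simp: is_space_def V.subspace_def)
  have clW: "x + y \<in> vcarrier W" "vscale W a x \<in> vcarrier W"
    if "x \<in> vcarrier W" "y \<in> vcarrier W" for x y a
    using assms that by (auto simp: is_space_def W.subspace_def)
  let ?g = "\<lambda>(v, w). f v w"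
  interpret l: Vector_Spaces.linear free_scale "vscale Z" "lin_ext Z ?g"
    by (rule linear_lin_ext[OF assms(2)])
  note gen = lin_ext_gen[OF assms(2), of ?g]
  have "lin_ext Z ?g r = 0" if "r \<in> tensor_rel V W" for r
    using that unfolding tensor_rel_def
  proof (rule l.eq_0_on_span[rotated], goal_cases)
    case (1 x)
    then show ?case
      using assms(1) clV clW
      by (auto simp: l.diff l.scale gen bilinear_map_def linear_map_def)
  qed
  moreover have "gen (v, w) - tens V W v w \<in> tensor_rel V W"
    unfolding tens_def quotient_map_eq_iff[OF vs sub, symmetric]
    by (simp add: quotient_map_idem[OF vs sub])
  ultimately have "lin_ext Z ?g (gen (v, w) - tens V W v w) = 0"
    by blast
  then show ?thesis by (simp add: tensor_lift_def l.diff gen)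
qed


section \<open>Coalgebras, bialgebras and rack bialgebras\<close>

record (overloaded) ('k::field, 'v) coalgebra = "('k, 'v) space" +
  cop :: "'v \<Rightarrow> (('v \<times> 'v) \<Rightarrow>\<^sub>0 'k)"
  counit :: "'v \<Rightarrow> 'k"

definition is_coalgebra :: "('k::field, 'v::ab_group_add, 'z) coalgebra_scheme \<Rightarrow> bool" where
  "is_coalgebra C \<longleftrightarrow>
     is_space C \<and>
     linear_map C (C \<otimes>\<^sub>k C) (cop C) \<and>
     linear_map C ground (counit C) \<and>
     (\<forall>x\<in>vcarrier C.
        tensor_assoc C C C (tensor_map (C \<otimes>\<^sub>k C) C (cop C) id (cop C x)) =
          tensor_map C (C \<otimes>\<^sub>k C) id (cop C) (cop C x) \<and>
        tensor_lift C (\<lambda>a b. vscale C (counit C a) b) (cop C x) = x \<and>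
        tensor_lift C (\<lambda>a b. vscale C (counit C b) a) (cop C x) = x)"

definition cocommutative :: "('k::field, 'v::ab_group_add, 'z) coalgebra_scheme \<Rightarrow> bool" where
  "cocommutative C \<longleftrightarrow> (\<forall>x\<in>vcarrier C. tensor_swap C C (cop C x) = cop C x)"

record (overloaded) ('k::field, 'v) bialgebra = "('k, 'v) coalgebra" +
  bmult :: "'v \<Rightarrow> 'v \<Rightarrow> 'v"
  bone :: 'v

definition is_bialgebra :: "('k::field, 'v::ab_group_add, 'z) bialgebra_scheme \<Rightarrow> bool" where
  "is_bialgebra H \<longleftrightarrow>
     is_coalgebra H \<and>
     bilinear_map H H H (bmult H) \<and>
     bone H \<in> vcarrier H \<and>
     (\<forall>a\<in>vcarrier H. \<forall>b\<in>vcarrier H. \<forall>c\<in>vcarrier H.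
        bmult H (bmult H a b) c = bmult H a (bmult H b c)) \<and>
     (\<forall>a\<in>vcarrier H. bmult H (bone H) a = a \<and> bmult H a (bone H) = a) \<and>
     (\<forall>a\<in>vcarrier H. \<forall>b\<in>vcarrier H.
        cop H (bmult H a b) = tensor_op H H (bmult H) (bmult H) (cop H a) (cop H b) \<and>
        counit H (bmult H a b) = counit H a * counit H b) \<and>
     cop H (bone H) = tens H H (bone H) (bone H) \<and>
     counit H (bone H) = 1"

text \<open>
  The rack product \<open>C \<otimes> C \<rightarrow> C\<close> is given as a bilinear map. It is a morphism of coalgebras
  when it is compatible with the coproduct
  \<open>x \<otimes> y \<mapsto> (x\<^sub>(\<^sub>1\<^sub>) \<otimes> y\<^sub>(\<^sub>1\<^sub>)) \<otimes> (x\<^sub>(\<^sub>2\<^sub>) \<otimes> y\<^sub>(\<^sub>2\<^sub>))\<close> and the counit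
  \<open>x \<otimes> y \<mapsto> \<epsilon>(x)\<epsilon>(y)\<close> of \<open>C \<otimes> C\<close>.
\<close>

record (overloaded) ('k::field, 'c) rack_bialgebra = "('k, 'c) coalgebra" +
  rone :: 'c
  rack :: "'c \<Rightarrow> 'c \<Rightarrow> 'c"

definition is_rack_bialgebra ::
  "('k::field, 'c::ab_group_add, 'z) rack_bialgebra_scheme \<Rightarrow> bool" where
  "is_rack_bialgebra C \<longleftrightarrow>
     is_coalgebra C \<and>
     rone C \<in> vcarrier C \<and>
     cop C (rone C) = tens C C (rone C) (rone C) \<and>
     counit C (rone C) = 1 \<and>
     bilinear_map C C C (rack C) \<and>
     (\<forall>x\<in>vcarrier C. \<forall>y\<in>vcarrier C.
        cop C (rack C x y) = tensor_op C C (rack C) (rack C) (cop C x) (cop C y) \<and>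
        counit C (rack C x y) = counit C x * counit C y) \<and>
     (\<forall>x\<in>vcarrier C. \<forall>y\<in>vcarrier C. \<forall>z\<in>vcarrier C.
        rack C (rack C x y) z =
          tensor_lift C (\<lambda>z1 z2. rack C (rack C x z1) (rack C y z2)) (cop C z)) \<and>
     (\<forall>x\<in>vcarrier C.
        rack C x (rone C) = x \<and> rack C (rone C) x = vscale C (counit C x) (rone C))"

definition ker_counit :: "('k::field, 'v::ab_group_add, 'z) coalgebra_scheme \<Rightarrow> ('k, 'v) space"
  where
  "ker_counit C = \<lparr>vcarrier = {x \<in> vcarrier C. counit C x = 0}, vscale = vscale C\<rparr>"


section \<open>Tensor algebra\<close>

text \<open>
  \<open>T(V) = \<Oplus>\<^sub>n V\<^bsup>\<otimes>n\<^esup>\<close> is spanned by the words \<open>x\<^sub>1\<dots>x\<^sub>n\<close> with letters in \<open>V\<close>, subject to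
  linearity in each letter; \<open>word V [x\<^sub>1,\<dots>,x\<^sub>n]\<close> is \<open>x\<^sub>1 \<otimes> \<dots> \<otimes> x\<^sub>n\<close>.
\<close>

definition word_rel ::
  "('k::field, 'v::ab_group_add, 'z) space_scheme \<Rightarrow> ('v list \<Rightarrow>\<^sub>0 'k) set" where
  "word_rel V = module.span free_scale
     ({gen (xs @ [v + v'] @ ys) - gen (xs @ [v] @ ys) - gen (xs @ [v'] @ ys) | xs v v' ys.
         xs \<in> lists (vcarrier V) \<and> ys \<in> lists (vcarrier V) \<and> v \<in> vcarrier V \<and> v' \<in> vcarrier V} \<union>
      {gen (xs @ [vscale V a v] @ ys) - free_scale a (gen (xs @ [v] @ ys)) | a xs v ys.
         xs \<in> lists (vcarrier V) \<and> ys \<in> lists (vcarrier V) \<and> v \<in> vcarrier V})"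

definition tensor_algebra ::
  "('k::field, 'v::ab_group_add, 'z) space_scheme \<Rightarrow> ('k, 'v list \<Rightarrow>\<^sub>0 'k) space" where
  "tensor_algebra V = quotient_space (free_space (lists (vcarrier V))) (word_rel V)"

definition word ::
  "('k::field, 'v::ab_group_add, 'z) space_scheme \<Rightarrow> 'v list \<Rightarrow> ('v list \<Rightarrow>\<^sub>0 'k)" where
  "word V xs = quotient_map free_scale (word_rel V) (gen xs)"

definition word_mult ::
  "('k::field, 'v::ab_group_add, 'z) space_scheme \<Rightarrow> ('v list \<Rightarrow>\<^sub>0 'k) \<Rightarrow> ('v list \<Rightarrow>\<^sub>0 'k)
    \<Rightarrow> ('v list \<Rightarrow>\<^sub>0 'k)" where
  "word_mult V s t =
     lin_ext (tensor_algebra V) (\<lambda>xs. lin_ext (tensor_algebra V) (\<lambda>ys. word V (xs @ ys)) t) s"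

text \<open>
  The algebra map from \<open>T(V)\<close> to an algebra \<open>A\<close> with product \<open>m\<close> and unit \<open>e\<close> that
  extends the linear map \<open>g : V \<rightarrow> A\<close>.
\<close>

definition algebra_ext ::
  "('k::field, 'a::ab_group_add, 'z) space_scheme \<Rightarrow> ('a \<Rightarrow> 'a \<Rightarrow> 'a) \<Rightarrow> 'a \<Rightarrow> ('v \<Rightarrow> 'a)
    \<Rightarrow> ('v list \<Rightarrow>\<^sub>0 'k) \<Rightarrow> 'a" where
  "algebra_ext A m e g = lin_ext A (\<lambda>xs. foldr (\<lambda>x. m (g x)) xs e)"


section \<open>Universal enveloping algebra of a rack bialgebra\<close>

definition incl ::
  "('k::field, 'c::ab_group_add, 'z) rack_bialgebra_scheme \<Rightarrow> 'c \<Rightarrow> ('c list \<Rightarrow>\<^sub>0 'k)" where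
  "incl C x = word (ker_counit C) [x - vscale C (counit C x) (rone C)] +
     free_scale (counit C x) (word (ker_counit C) [])"

definition T_bialg ::
  "('k::field, 'c::ab_group_add, 'z) rack_bialgebra_scheme \<Rightarrow> ('k, 'c list \<Rightarrow>\<^sub>0 'k) bialgebra"
  where
  "T_bialg C =
     (let T = tensor_algebra (ker_counit C);
          m = word_mult (ker_counit C);
          e = word (ker_counit C) []
      in \<lparr>vcarrier = vcarrier T, vscale = vscale T,
          cop = algebra_ext (T \<otimes>\<^sub>k T) (tensor_op T T m m) (tens T T e e)
                  (\<lambda>x. tensor_map T T (incl C) (incl C) (cop C x)),
          counit = algebra_ext ground (*) 1 (\<lambda>x. 0),
          bmult = m, bone = e\<rparr>)"

text \<open>
  The right action of \<open>T\<close> on \<open>C\<close>: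
  \<open>y \<cdot> (x\<^sub>1\<dots>x\<^sub>n) = (\<dots>(y \<lhd> x\<^sub>1) \<lhd> \<dots>) \<lhd> x\<^sub>n\<close> for \<open>x\<^sub>i \<in> ker \<epsilon>\<close>.
\<close>

definition T_act ::
  "('k::field, 'c::ab_group_add, 'z) rack_bialgebra_scheme \<Rightarrow> 'c \<Rightarrow> ('c list \<Rightarrow>\<^sub>0 'k) \<Rightarrow> 'c" where
  "T_act C y = lin_ext C (\<lambda>xs. foldl (rack C) y xs)"

definition ideal_generated ::
  "('k::field, 'v::ab_group_add, 'z) bialgebra_scheme \<Rightarrow> 'v set \<Rightarrow> 'v set" where
  "ideal_generated A G =
     \<Inter>{I. module.subspace (vscale A) I \<and> G \<subseteq> I \<and> I \<subseteq> vcarrier A \<and>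
          (\<forall>a\<in>vcarrier A. \<forall>x\<in>I. bmult A a x \<in> I \<and> bmult A x a \<in> I)}"

definition U_ideal ::
  "('k::field, 'c::ab_group_add, 'z) rack_bialgebra_scheme \<Rightarrow> ('c list \<Rightarrow>\<^sub>0 'k) set" where
  "U_ideal C = ideal_generated (T_bialg C)
     {tensor_lift (T_bialg C)
        (\<lambda>y1 y2. bmult (T_bialg C) (incl C y1) (incl C (rack C x y2))) (cop C y)
      - bmult (T_bialg C) (incl C x) (incl C y) | x y. x \<in> vcarrier C \<and> y \<in> vcarrier C}"

definition U_proj ::
  "('k::field, 'c::ab_group_add, 'z) rack_bialgebra_scheme \<Rightarrow> ('c list \<Rightarrow>\<^sub>0 'k) \<Rightarrow> ('c list \<Rightarrow>\<^sub>0 'k)"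
  where
  "U_proj C = quotient_map (vscale (T_bialg C)) (U_ideal C)"

definition U_space ::
  "('k::field, 'c::ab_group_add, 'z) rack_bialgebra_scheme \<Rightarrow> ('k, 'c list \<Rightarrow>\<^sub>0 'k) space" where
  "U_space C = quotient_space (T_bialg C) (U_ideal C)"

text \<open>
  Elements of \<open>U(C) = T/J\<close> are their own representatives in \<open>T\<close>, so the operations below are
  those of \<open>T\<close>, followed by the projection where they take values in \<open>T\<close> or \<open>T \<otimes> T\<close>.
\<close>

definition U_bialg ::
  "('k::field, 'c::ab_group_add, 'z) rack_bialgebra_scheme \<Rightarrow> ('k, 'c list \<Rightarrow>\<^sub>0 'k) bialgebra"
  where
  "U_bialg C =
     \<lparr>vcarrier = vcarrier (U_space C), vscale = vscale (U_space C),
      cop = (\<lambda>u. tensor_map (U_space C) (U_space C) (U_proj C) (U_proj C) (cop (T_bialg C) u)),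
      counit = counit (T_bialg C),
      bmult = (\<lambda>u v. U_proj C (bmult (T_bialg C) u v)),
      bone = U_proj C (bone (T_bialg C))\<rparr>"

definition U_act ::
  "('k::field, 'c::ab_group_add, 'z) rack_bialgebra_scheme \<Rightarrow> 'c \<Rightarrow> ('c list \<Rightarrow>\<^sub>0 'k) \<Rightarrow> 'c" where
  "U_act C y u = T_act C y u"

definition U_can ::
  "('k::field, 'c::ab_group_add, 'z) rack_bialgebra_scheme \<Rightarrow> 'c \<Rightarrow> ('c list \<Rightarrow>\<^sub>0 'k)" where
  "U_can C x = U_proj C (incl C x)"


section \<open>Bialgebra objects in the category of linear maps\<close>

record (overloaded) ('k::field, 'h, 'm) tetramodule = "('k, 'm) space" +
  lact :: "'h \<Rightarrow> 'm \<Rightarrow> 'm"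
  ract :: "'m \<Rightarrow> 'h \<Rightarrow> 'm"
  lcoact :: "'m \<Rightarrow> (('h \<times> 'm) \<Rightarrow>\<^sub>0 'k)"
  rcoact :: "'m \<Rightarrow> (('m \<times> 'h) \<Rightarrow>\<^sub>0 'k)"

definition is_bimodule ::
  "('k::field, 'h::ab_group_add, 'y) bialgebra_scheme
    \<Rightarrow> ('k, 'h, 'm::ab_group_add, 'z) tetramodule_scheme \<Rightarrow> bool" where
  "is_bimodule H M \<longleftrightarrow>
     is_space M \<and>
     bilinear_map H M M (lact M) \<and>
     bilinear_map M H M (ract M) \<and>
     (\<forall>m\<in>vcarrier M. lact M (bone H) m = m \<and> ract M m (bone H) = m) \<and>
     (\<forall>g\<in>vcarrier H. \<forall>h\<in>vcarrier H. \<forall>m\<in>vcarrier M.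
        lact M (bmult H g h) m = lact M g (lact M h m) \<and>
        ract M m (bmult H g h) = ract M (ract M m g) h \<and>
        ract M (lact M g m) h = lact M g (ract M m h))"

definition is_bicomodule ::
  "('k::field, 'h::ab_group_add, 'y) bialgebra_scheme
    \<Rightarrow> ('k, 'h, 'm::ab_group_add, 'z) tetramodule_scheme \<Rightarrow> bool" where
  "is_bicomodule H M \<longleftrightarrow>
     is_space M \<and>
     linear_map M (H \<otimes>\<^sub>k M) (lcoact M) \<and>
     linear_map M (M \<otimes>\<^sub>k H) (rcoact M) \<and>
     (\<forall>m\<in>vcarrier M.
        tensor_lift M (\<lambda>h n. vscale M (counit H h) n) (lcoact M m) = m \<and>
        tensor_lift M (\<lambda>n h. vscale M (counit H h) n) (rcoact M m) = m \<and>
        tensor_assoc H H M (tensor_map (H \<otimes>\<^sub>k H) M (cop H) id (lcoact M m)) =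
          tensor_map H (H \<otimes>\<^sub>k M) id (lcoact M) (lcoact M m) \<and>
        tensor_assoc M H H (tensor_map (M \<otimes>\<^sub>k H) H (rcoact M) id (rcoact M m)) =
          tensor_map M (H \<otimes>\<^sub>k H) id (cop H) (rcoact M m) \<and>
        tensor_assoc H M H (tensor_map (H \<otimes>\<^sub>k M) H (lcoact M) id (rcoact M m)) =
          tensor_map H (M \<otimes>\<^sub>k H) id (rcoact M) (lcoact M m))"

text \<open>
  \<open>H\<close> acts on \<open>H \<otimes> M\<close> by \<open>g (h \<otimes> m) = g\<^sub>(\<^sub>1\<^sub>) h \<otimes> g\<^sub>(\<^sub>2\<^sub>) m\<close> and
  \<open>(h \<otimes> m) g = h g\<^sub>(\<^sub>1\<^sub>) \<otimes> m g\<^sub>(\<^sub>2\<^sub>)\<close>, and likewise on \<open>M \<otimes> H\<close>.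
\<close>

definition is_tetramodule ::
  "('k::field, 'h::ab_group_add, 'y) bialgebra_scheme
    \<Rightarrow> ('k, 'h, 'm::ab_group_add, 'z) tetramodule_scheme \<Rightarrow> bool" where
  "is_tetramodule H M \<longleftrightarrow>
     is_bimodule H M \<and> is_bicomodule H M \<and>
     (\<forall>g\<in>vcarrier H. \<forall>m\<in>vcarrier M.
        lcoact M (lact M g m) = tensor_op H M (bmult H) (lact M) (cop H g) (lcoact M m) \<and>
        lcoact M (ract M m g) = tensor_op H M (bmult H) (ract M) (lcoact M m) (cop H g) \<and>
        rcoact M (lact M g m) = tensor_op M H (lact M) (bmult H) (cop H g) (rcoact M m) \<and>
        rcoact M (ract M m g) = tensor_op M H (ract M) (bmult H) (rcoact M m) (cop H g))"

definition is_bilinear_over ::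
  "('k::field, 'h::ab_group_add, 'y) bialgebra_scheme
    \<Rightarrow> ('k, 'h, 'm::ab_group_add, 'z) tetramodule_scheme \<Rightarrow> ('m \<Rightarrow> 'h) \<Rightarrow> bool" where
  "is_bilinear_over H M f \<longleftrightarrow>
     (\<forall>g\<in>vcarrier H. \<forall>m\<in>vcarrier M.
        f (lact M g m) = bmult H g (f m) \<and> f (ract M m g) = bmult H (f m) g)"

definition is_coderivation ::
  "('k::field, 'h::ab_group_add, 'y) bialgebra_scheme
    \<Rightarrow> ('k, 'h, 'm::ab_group_add, 'z) tetramodule_scheme \<Rightarrow> ('m \<Rightarrow> 'h) \<Rightarrow> bool" where
  "is_coderivation H M f \<longleftrightarrow>
     linear_map M H f \<and>
     (\<forall>m\<in>vcarrier M.
        cop H (f m) = tensor_map H H id f (lcoact M m) + tensor_map H H f id (rcoact M m))"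

definition is_LM_bialgebra ::
  "('k::field, 'h::ab_group_add, 'y) bialgebra_scheme
    \<Rightarrow> ('k, 'h, 'm::ab_group_add, 'z) tetramodule_scheme \<Rightarrow> ('m \<Rightarrow> 'h) \<Rightarrow> bool" where
  "is_LM_bialgebra H M f \<longleftrightarrow>
     is_bialgebra H \<and> is_tetramodule H M \<and> is_bilinear_over H M f \<and> is_coderivation H M f"


section \<open>The tetramodule and the map attached to a rack bialgebra\<close>

definition ker_coact ::
  "('k::field, 'c::ab_group_add, 'z) rack_bialgebra_scheme
    \<Rightarrow> 'c \<Rightarrow> (('c \<times> ('c list \<Rightarrow>\<^sub>0 'k)) \<Rightarrow>\<^sub>0 'k)" where
  "ker_coact C v =
     tensor_map (ker_counit C) (U_bialg C)
       (\<lambda>v1. v1 - vscale C (counit C v1) (rone C)) (U_can C) (cop C v)"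

text \<open>
  The joint coaction \<open>h \<otimes> v \<mapsto> h\<^sub>(\<^sub>1\<^sub>) \<otimes> (h\<^sub>(\<^sub>2\<^sub>) \<otimes> v\<^sub>(\<^sub>0\<^sub>)) \<otimes> h\<^sub>(\<^sub>3\<^sub>) v\<^sub>(\<^sub>1\<^sub>)\<close>
  encodes, after applying the counit to the right or to the left factor, the left coaction
  \<open>h \<otimes> v \<mapsto> h\<^sub>(\<^sub>1\<^sub>) \<otimes> (h\<^sub>(\<^sub>2\<^sub>) \<otimes> v)\<close> and the right coaction
  \<open>h \<otimes> v \<mapsto> (h\<^sub>(\<^sub>1\<^sub>) \<otimes> v\<^sub>(\<^sub>0\<^sub>)) \<otimes> h\<^sub>(\<^sub>2\<^sub>) v\<^sub>(\<^sub>1\<^sub>)\<close>.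
\<close>

definition U_tetra ::
  "('k::field, 'c::ab_group_add, 'z) rack_bialgebra_scheme
    \<Rightarrow> ('k, 'c list \<Rightarrow>\<^sub>0 'k, (('c list \<Rightarrow>\<^sub>0 'k) \<times> 'c) \<Rightarrow>\<^sub>0 'k) tetramodule" where
  "U_tetra C =
     (let H = U_bialg C; V = ker_counit C; M = H \<otimes>\<^sub>k V
      in \<lparr>vcarrier = vcarrier M, vscale = vscale M,
          lact = (\<lambda>g. tensor_lift M (\<lambda>h v. tens H V (bmult H g h) v)),
          ract = (\<lambda>m g. tensor_op H V (bmult H) (U_act C) m (cop H g)),
          lcoact = tensor_lift (H \<otimes>\<^sub>k M) (\<lambda>h v.
            tensor_lift (H \<otimes>\<^sub>k M) (\<lambda>h1 h2. tens H M h1 (tens H V h2 v)) (cop H h)),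
          rcoact = tensor_lift (M \<otimes>\<^sub>k H) (\<lambda>h v.
            tensor_op M H (tens H V) (bmult H) (cop H h) (ker_coact C v))\<rparr>)"

definition joint_coact ::
  "('k::field, 'c::ab_group_add, 'z) rack_bialgebra_scheme
    \<Rightarrow> ((('c list \<Rightarrow>\<^sub>0 'k) \<times> 'c) \<Rightarrow>\<^sub>0 'k)
    \<Rightarrow> (('c list \<Rightarrow>\<^sub>0 'k) \<times> ((((('c list \<Rightarrow>\<^sub>0 'k) \<times> 'c) \<Rightarrow>\<^sub>0 'k) \<times> ('c list \<Rightarrow>\<^sub>0 'k)) \<Rightarrow>\<^sub>0 'k)) \<Rightarrow>\<^sub>0 'k"
  where
  "joint_coact C =
     (let H = U_bialg C; V = ker_counit C; M = U_tetra C; Z = H \<otimes>\<^sub>k (M \<otimes>\<^sub>k H)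
      in tensor_lift Z (\<lambda>h v.
           tensor_lift Z (\<lambda>h1 h23.
             tens H (M \<otimes>\<^sub>k H) h1 (tensor_op M H (tens H V) (bmult H) h23 (ker_coact C v)))
           (tensor_map H (H \<otimes>\<^sub>k H) id (cop H) (cop H h))))"

definition U_map ::
  "('k::field, 'c::ab_group_add, 'z) rack_bialgebra_scheme
    \<Rightarrow> ((('c list \<Rightarrow>\<^sub>0 'k) \<times> 'c) \<Rightarrow>\<^sub>0 'k) \<Rightarrow> ('c list \<Rightarrow>\<^sub>0 'k)" where
  "U_map C = tensor_lift (U_bialg C) (\<lambda>s c. bmult (U_bialg C) s (U_can C c))"

end

theory Submission
  imports Defs
begin

text \<open>
  Composed with \<open>T \<otimes> T \<rightarrow> U \<otimes> U\<close>, the coproduct of \<open>T\<close> is an algebra map. It kills the relations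
  of \<open>U = U(C)\<close>: by cocommutativity the two inner factors of the fourfold coproduct of \<open>y\<close> may be
  exchanged, and then each tensor factor of the image is again an instance of the relation. So
  it descends, and the bialgebra axioms, being equalities of algebra maps, only have to be
  checked on the generators \<open>q(x)\<close>.

  The action and coaction on the kernel of the counit satisfy the Yetter-Drinfeld condition
  \<open>(v\<cdot>g\<^sub>2)\<^sub>0 \<otimes> g\<^sub>1 (v\<cdot>g\<^sub>2)\<^sub>1 = v\<^sub>0\<cdot>g\<^sub>1 \<otimes> v\<^sub>1 g\<^sub>2\<close>. It is multiplicative in \<open>g\<close>, and for
  \<open>g = q(x)\<close> it follows from cocommutativity and the defining relation of \<open>U\<close>. For every such
  module \<open>V\<close> over a bialgebra \<open>H\<close>, the space \<open>H \<otimes> V\<close> is a tetramodule, and a linear map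
  \<open>\<theta> : V \<rightarrow> H\<close> with \<open>g\<^sub>1 \<theta>(v\<cdot>g\<^sub>2) = \<theta>(v) g\<close> and \<open>\<Delta>\<theta>(v) = 1 \<otimes> \<theta>(v) + \<theta>(v\<^sub>0) \<otimes> v\<^sub>1\<close>
  induces a bilinear coderivation \<open>h \<otimes> v \<mapsto> h \<theta>(v)\<close>; here \<open>\<theta> = q\<close>.
\<close>

section \<open>Linear algebra on carriers\<close>

text \<open>Spaces are carriers inside a type, the operations are total functions, and identities
  hold on carriers only; so informal Sweedler notation hides, at every step, memberships and
  linearity in each variable. The function \<open>sweedler\<close> and the rule collection
  \<open>multilin\<close> absorb this. Evaluated on pure tensors, each axiom becomes an equation
  between iterated finite sums, to be proved by exchanging independent sums, rebracketing with
  coassociativity and one step of real algebra.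

  The Yetter-Drinfeld condition is forced by the elements 1 \<otimes> v: comparing the right
  coaction of (1 \<otimes> v)g = g1 \<otimes> v\<cdot>g2 with the coaction of 1 \<otimes> v
  multiplied by g, and applying the counit to the factor \<open>H\<close>, gives exactly this
  condition. The relations of \<open>U(C)\<close> enter twice: once in the Yetter-Drinfeld condition
  for a generator, once as the right linearity of \<open>f\<close> at the elements 1 \<otimes> v. No
  antipode is available at any point, so all conditions have to be stated without one.\<close>

lemma is_space_vector_space: "is_space V \<Longrightarrow> vector_space (vscale V)"
  by (simp add: is_space_def)

lemma is_space_closed:
  assumes "is_space V"
  shows is_space_zero: "0 \<in> vcarrier V"
    and is_space_add: "\<And>x y. x \<in> vcarrier V \<Longrightarrow> y \<in> vcarrier V \<Longrightarrow> x + y \<in> vcarrier V"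
    and is_space_scale: "\<And>a x. x \<in> vcarrier V \<Longrightarrow> vscale V a x \<in> vcarrier V"
    and is_space_diff: "\<And>x y. x \<in> vcarrier V \<Longrightarrow> y \<in> vcarrier V \<Longrightarrow> x - y \<in> vcarrier V"
    and is_space_sum: "\<And>f A. (\<And>x. x \<in> A \<Longrightarrow> f x \<in> vcarrier V) \<Longrightarrow> sum f A \<in> vcarrier V"
proof -
  interpret vector_space "vscale V" using assms by (rule is_space_vector_space)
  have s: "subspace (vcarrier V)" using assms by (simp add: is_space_def)
  show "0 \<in> vcarrier V" "\<And>x y. x \<in> vcarrier V \<Longrightarrow> y \<in> vcarrier V \<Longrightarrow> x + y \<in> vcarrier V"
    "\<And>a x. x \<in> vcarrier V \<Longrightarrow> vscale V a x \<in> vcarrier V"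
    "\<And>x y. x \<in> vcarrier V \<Longrightarrow> y \<in> vcarrier V \<Longrightarrow> x - y \<in> vcarrier V"
    "\<And>f A. (\<And>x. x \<in> A \<Longrightarrow> f x \<in> vcarrier V) \<Longrightarrow> sum f A \<in> vcarrier V"
    using s by (auto intro: subspace_0 subspace_add subspace_scale subspace_diff subspace_sum)
qed

lemma is_spaceI:
  assumes "vector_space (vscale V)" "0 \<in> vcarrier V"
    and "\<And>x y. x \<in> vcarrier V \<Longrightarrow> y \<in> vcarrier V \<Longrightarrow> x + y \<in> vcarrier V"
    and "\<And>a x. x \<in> vcarrier V \<Longrightarrow> vscale V a x \<in> vcarrier V"
  shows "is_space V"
  using assms by (simp add: is_space_def module.subspace_def module_iff_vector_space)

lemma scale_zero_left_space: "is_space V \<Longrightarrow> vscale V 0 x = 0"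
  by (simp add: is_space_def module_iff_vector_space module.scale_zero_left)

lemma scale_zero_right_space: "is_space V \<Longrightarrow> vscale V a 0 = 0"
  by (simp add: is_space_def module_iff_vector_space module.scale_zero_right)

lemma scale_one_space: "is_space V \<Longrightarrow> vscale V 1 x = x"
  by (simp add: is_space_def vector_space_def)

lemma linear_mapI:
  assumes "\<And>x. x \<in> vcarrier V \<Longrightarrow> f x \<in> vcarrier W"
    and "\<And>x y. x \<in> vcarrier V \<Longrightarrow> y \<in> vcarrier V \<Longrightarrow> f (x + y) = f x + f y"
    and "\<And>a x. x \<in> vcarrier V \<Longrightarrow> f (vscale V a x) = vscale W a (f x)"
  shows "linear_map V W f"
  using assms by (simp add: linear_map_def)

lemma linear_map_mem: "linear_map V W f \<Longrightarrow> x \<in> vcarrier V \<Longrightarrow> f x \<in> vcarrier W"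
  and linear_map_add: "linear_map V W f \<Longrightarrow> x \<in> vcarrier V \<Longrightarrow> y \<in> vcarrier V
    \<Longrightarrow> f (x + y) = f x + f y"
  and linear_map_scale: "linear_map V W f \<Longrightarrow> x \<in> vcarrier V
    \<Longrightarrow> f (vscale V a x) = vscale W a (f x)"
  by (simp_all add: linear_map_def)

lemma linear_map_zero:
  assumes "linear_map V W f" "is_space V" "is_space W"
  shows "f 0 = 0"
  using linear_map_scale[OF assms(1) is_space_zero[OF assms(2)], of 0] assms
  by (simp add: scale_zero_left_space scale_zero_right_space)

lemma linear_map_diff:
  assumes "linear_map V W f" "is_space V" "x \<in> vcarrier V" "y \<in> vcarrier V"
  shows "f (x - y) = f x - f y"
  using linear_map_add[OF assms(1) is_space_diff[OF assms(2-4)] assms(4)]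
  by (simp add: eq_diff_eq)

lemma linear_map_sum:
  assumes f: "linear_map V W f" "is_space V" "is_space W"
    and "\<And>x. x \<in> A \<Longrightarrow> g x \<in> vcarrier V"
  shows "f (sum g A) = (\<Sum>x\<in>A. f (g x))"
  using assms(4)
  by (induction A rule: infinite_finite_induct)
    (auto simp: linear_map_zero[OF f] linear_map_add[OF f(1)] is_space_sum[OF f(2)])

lemma bilinear_mapI:
  assumes "\<And>v. v \<in> vcarrier V \<Longrightarrow> linear_map W Z (f v)"
    and "\<And>w. w \<in> vcarrier W \<Longrightarrow> linear_map V Z (\<lambda>v. f v w)"
  shows "bilinear_map V W Z f"
  using assms by (simp add: bilinear_map_def)

lemma bilinear_map_left: "bilinear_map V W Z f \<Longrightarrow> w \<in> vcarrier W \<Longrightarrow> linear_map V Z (\<lambda>v. f v w)"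
  and bilinear_map_right: "bilinear_map V W Z f \<Longrightarrow> v \<in> vcarrier V \<Longrightarrow> linear_map W Z (f v)"
  by (simp_all add: bilinear_map_def)

lemma bilinear_map_mem:
  "bilinear_map V W Z f \<Longrightarrow> v \<in> vcarrier V \<Longrightarrow> w \<in> vcarrier W \<Longrightarrow> f v w \<in> vcarrier Z"
  by (auto simp: bilinear_map_def linear_map_def)

lemma linear_map_ident: "linear_map V V (\<lambda>x. x)"
  by (simp add: linear_map_def)

lemma linear_map_compose:
  "linear_map V W g \<Longrightarrow> linear_map X V f \<Longrightarrow> linear_map X W (\<lambda>x. g (f x))"
  by (simp add: linear_map_def)

lemma bilinear_map_compose_left:
  assumes "bilinear_map V W Z m" "linear_map X V f" "w \<in> vcarrier W"
  shows "linear_map X Z (\<lambda>x. m (f x) w)"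
  using linear_map_compose[OF bilinear_map_left[OF assms(1,3)] assms(2)] .

lemma bilinear_map_compose_right:
  assumes "bilinear_map V W Z m" "linear_map X W f" "v \<in> vcarrier V"
  shows "linear_map X Z (\<lambda>x. m v (f x))"
  using linear_map_compose[OF bilinear_map_right[OF assms(1,3)] assms(2)] .

text \<open>\<open>linear_map\<close> constrains a function on the carrier only. The structure maps
  are defined through \<open>tensor_lift\<close>; their linearity is read off from Sweedler sums
  that agree with them on the carrier.\<close>

lemma linear_map_cong:
  assumes "is_space V" "linear_map V Z f" "\<And>x. x \<in> vcarrier V \<Longrightarrow> f x = g x"
  shows "linear_map V Z g"
proof -
  note c = is_space_closed[OF assms(1)]
  show ?thesis
    by (rule linear_mapI)
      (simp_all add: assms(3)[symmetric] c linear_map_mem[OF assms(2)]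
        linear_map_add[OF assms(2)] linear_map_scale[OF assms(2)])
qed

lemma linear_map_plus:
  assumes "is_space Z" "linear_map V Z f" "linear_map V Z g"
  shows "linear_map V Z (\<lambda>x. f x + g x)"
proof -
  interpret vector_space "vscale Z" using assms(1) by (rule is_space_vector_space)
  show ?thesis
    using assms by (auto simp: linear_map_def is_space_add scale_right_distrib)
qed

lemma bilinear_map_scale:
  assumes "is_space Z"
  shows "bilinear_map ground Z Z (vscale Z)"
proof -
  interpret vector_space "vscale Z" using assms(1) by (rule is_space_vector_space)
  show ?thesis
    using assms
    by (auto simp: bilinear_map_def linear_map_def ground_def is_space_scale
        scale_right_distrib scale_left_distrib mult.commute)
qed

lemma is_space_ground: "is_space ground"
proof (rule is_spaceI)
  show "vector_space (vscale ground)"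
    unfolding ground_def by unfold_locales (auto simp: algebra_simps)
qed (auto simp: ground_def)

lemma mem_ground: "x \<in> vcarrier ground"
  by (simp add: ground_def)

subsection \<open>Quotients of free vector spaces\<close>

lemma vscale_free_space [simp]: "vscale (free_space X) = free_scale"
  and vcarrier_free_space: "vcarrier (free_space X) = {p. Poly_Mapping.keys p \<subseteq> X}"
  by (simp_all add: free_space_def)

lemma is_space_free_space: "is_space (free_space X)"
proof (rule is_spaceI)
  show "x + y \<in> vcarrier (free_space X)"
    if "x \<in> vcarrier (free_space X)" "y \<in> vcarrier (free_space X)" for x y
    using that Poly_Mapping.keys_add[of x y] by (auto simp: vcarrier_free_space)
qed (auto simp: vector_space_free_scale vcarrier_free_space in_keys_iff)

lemma gen_in_free_space: "x \<in> X \<Longrightarrow> gen x \<in> vcarrier (free_space X)"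
  by (simp add: vcarrier_free_space gen_def)

lemma lin_ext_total_linear:
  assumes "is_space Z"
  shows "lin_ext Z g (p + q) = lin_ext Z g p + lin_ext Z g q"
    and "lin_ext Z g (p - q) = lin_ext Z g p - lin_ext Z g q"
    and "lin_ext Z g (free_scale a p) = vscale Z a (lin_ext Z g p)"
    and "lin_ext Z g 0 = 0"
    and "lin_ext Z g (sum h A) = (\<Sum>x\<in>A. lin_ext Z g (h x))"
proof -
  interpret Vector_Spaces.linear free_scale "vscale Z" "lin_ext Z g"
    using assms by (intro linear_lin_ext is_space_vector_space)
  show "lin_ext Z g (p + q) = lin_ext Z g p + lin_ext Z g q"
    "lin_ext Z g (p - q) = lin_ext Z g p - lin_ext Z g q"
    "lin_ext Z g (free_scale a p) = vscale Z a (lin_ext Z g p)"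
    "lin_ext Z g 0 = 0"
    "lin_ext Z g (sum h A) = (\<Sum>x\<in>A. lin_ext Z g (h x))"
    by (simp_all add: add diff scale sum)
qed

lemma free_expand: "p = (\<Sum>x\<in>Poly_Mapping.keys p. free_scale (Poly_Mapping.lookup p x) (gen x))"
proof (rule poly_mapping_eqI)
  fix k
  show "Poly_Mapping.lookup p k =
    Poly_Mapping.lookup (\<Sum>x\<in>Poly_Mapping.keys p. free_scale (Poly_Mapping.lookup p x) (gen x)) k"
    by (simp add: Poly_Mapping.lookup_sum gen_def Poly_Mapping.lookup_single when_def sum.delta' in_keys_iff if_distrib cong: if_cong)
qed

lemma lin_ext_mem:
  assumes "is_space Z" "\<And>x. x \<in> Poly_Mapping.keys p \<Longrightarrow> g x \<in> vcarrier Z"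
  shows "lin_ext Z g p \<in> vcarrier Z"
  unfolding lin_ext_def using assms by (auto intro: is_space_sum is_space_scale)

lemma lin_ext_cong:
  assumes "\<And>x. x \<in> Poly_Mapping.keys p \<Longrightarrow> g x = h x"
  shows "lin_ext Z g p = lin_ext Z h p"
  unfolding lin_ext_def using assms by (auto intro: sum.cong)

text \<open>The chosen representative differs from \<open>p\<close> by an element of
  \<open>N\<close>, and a linear extension that kills the generators \<open>G\<close> kills all of
  \<open>N\<close>. This is what lets functions on words factor through the tensor algebra.\<close>

lemma lin_ext_quotient_map:
  assumes Z: "is_space Z" and N: "N = module.span free_scale G"
    and G: "\<And>r. r \<in> G \<Longrightarrow> lin_ext Z g r = 0"
  shows "lin_ext Z g (quotient_map free_scale N p) = lin_ext Z g p"
proof -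
  interpret F: vector_space free_scale by (rule vector_space_free_scale)
  interpret l: Vector_Spaces.linear free_scale "vscale Z" "lin_ext Z g"
    using Z by (intro linear_lin_ext is_space_vector_space)
  have sub: "module.subspace free_scale N" unfolding N by (rule F.subspace_span)
  have "quotient_map free_scale N p - p \<in> N"
    unfolding quotient_map_eq_iff[OF vector_space_free_scale sub, symmetric]
    by (rule quotient_map_idem[OF vector_space_free_scale sub])
  then have "lin_ext Z g (quotient_map free_scale N p - p) = 0"
    unfolding N by (rule l.eq_0_on_span[rotated]) (rule G)
  then show ?thesis by (simp add: l.diff)
qed

lemma is_space_quotient:
  assumes "is_space V" "module.subspace (vscale V) N"
  shows "is_space (quotient_space V N)"
proof -
  interpret V: vector_space "vscale V" using assms(1) by (rule is_space_vector_space)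
  interpret Vector_Spaces.linear "vscale V" "vscale V" "quotient_map (vscale V) N"
    by (rule linear_quotient_map[OF is_space_vector_space[OF assms(1)] assms(2)])
  have "V.subspace (quotient_map (vscale V) N ` vcarrier V)"
    using assms(1) by (intro subspace_image) (simp add: is_space_def)
  then show ?thesis by (simp add: quotient_space_def is_space_def V.vector_space_axioms)
qed

text \<open>The projection is chosen on the whole type and might a priori move elements out of
  \<open>V\<close>. It changes \<open>p'\<close> only by an element of \<open>N\<close>, so
  \<open>N \<subseteq> vcarrier V\<close> keeps the result inside.\<close>

lemma quotient_mem:
  assumes V: "is_space V" and N: "module.subspace (vscale V) N" and NV: "N \<subseteq> vcarrier V"
    and p: "p \<in> vcarrier (quotient_space V N)"
  shows "p \<in> vcarrier V" "quotient_map (vscale V) N p = p"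
proof -
  note vs = is_space_vector_space[OF V]
  obtain p' where p': "p' \<in> vcarrier V" "p = quotient_map (vscale V) N p'"
    using p by (auto simp: quotient_space_def)
  show 1: "quotient_map (vscale V) N p = p"
    using p' by (simp add: quotient_map_idem[OF vs N])
  have "p - p' \<in> N"
    unfolding quotient_map_eq_iff[OF vs N, symmetric] using 1 p' by simp
  then have "p' + (p - p') \<in> vcarrier V" using NV p' is_space_add[OF V] by blast
  then show "p \<in> vcarrier V" by simp
qed

text \<open>An element of the quotient is a formal sum and its own representative. Projecting its
  expansion in generators returns it, so its own coefficients serve for the classes of the
  generators.\<close>

lemma quotient_free_expand:
  assumes N: "module.subspace free_scale N" and NV: "N \<subseteq> vcarrier (free_space X)"
    and p: "p \<in> vcarrier (quotient_space (free_space X) N)" and Z: "vscale Z = free_scale"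
  shows "p = lin_ext Z (\<lambda>x. quotient_map free_scale N (gen x)) p"
proof -
  interpret Vector_Spaces.linear free_scale free_scale "quotient_map free_scale N"
    by (rule linear_quotient_map[OF vector_space_free_scale N])
  have "p = quotient_map free_scale N p"
    using quotient_mem(2)[OF is_space_free_space _ NV p] N by simp
  also have "\<dots> = quotient_map free_scale N
      (\<Sum>x\<in>Poly_Mapping.keys p. free_scale (Poly_Mapping.lookup p x) (gen x))"
    using free_expand[of p] by simp
  also have "\<dots> = lin_ext Z (\<lambda>x. quotient_map free_scale N (gen x)) p"
    by (simp add: lin_ext_def sum scale Z)
  finally show ?thesis .
qed

text \<open>Uniqueness half of the universal property, shared by tensor products and tensor
  algebras: both are quotients of a free space and hence spanned by the classes of its
  generators.\<close>

lemma quotient_free_ext: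
  assumes N: "module.subspace free_scale N" and NV: "N \<subseteq> vcarrier (free_space X)"
    and p: "p \<in> vcarrier (quotient_space (free_space X) N)"
    and f: "linear_map (quotient_space (free_space X) N) Z f"
    and g: "linear_map (quotient_space (free_space X) N) Z g"
    and Z: "is_space Z"
    and eq: "\<And>x. x \<in> X \<Longrightarrow> f (quotient_map free_scale N (gen x)) = g (quotient_map free_scale N (gen x))"
  shows "f p = g p"
proof -
  let ?Q = "quotient_space (free_space X) N"
  have sc: "vscale ?Q = free_scale" by (simp add: quotient_space_def)
  have Q: "is_space ?Q" using N by (intro is_space_quotient is_space_free_space) simp
  have keys: "Poly_Mapping.keys p \<subseteq> X"
    using quotient_mem(1)[OF is_space_free_space _ NV p] N by (simp add: vcarrier_free_space)
  have mem: "quotient_map free_scale N (gen x) \<in> vcarrier ?Q" if "x \<in> X" for x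
    using that by (simp add: quotient_space_def gen_in_free_space)
  have h: "h p = lin_ext Z (\<lambda>x. h (quotient_map free_scale N (gen x))) p" if "linear_map ?Q Z h" for h
  proof -
    have "h p = h (lin_ext ?Q (\<lambda>x. quotient_map free_scale N (gen x)) p)"
      using quotient_free_expand[OF N NV p sc] by simp
    also have "\<dots> = (\<Sum>x\<in>Poly_Mapping.keys p. h (vscale ?Q (Poly_Mapping.lookup p x) (quotient_map free_scale N (gen x))))"
      unfolding lin_ext_def using keys mem
      by (intro linear_map_sum[OF that Q Z] is_space_scale[OF Q]) auto
    also have "\<dots> = lin_ext Z (\<lambda>x. h (quotient_map free_scale N (gen x))) p"
      unfolding lin_ext_def using keys mem
      by (intro sum.cong refl linear_map_scale[OF that]) auto
    finally show ?thesis .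
  qed
  show ?thesis
    unfolding h[OF f] h[OF g] using keys eq by (intro lin_ext_cong) auto
qed

section \<open>Tensor products and Sweedler sums\<close>

text \<open>Ensures that representatives of tensors are supported on pairs from the two carriers, so
  that a sum over the support never sees values of a function elsewhere.\<close>

lemma tensor_rel_sub:
  fixes V :: "('k::field, 'v::ab_group_add, 'y) space_scheme"
    and W :: "('k, 'w::ab_group_add, 'z) space_scheme"
  assumes V: "is_space V" and W: "is_space W"
  shows "tensor_rel V W \<subseteq> vcarrier (free_space (vcarrier V \<times> vcarrier W))"
proof -
  interpret vector_space free_scale by (rule vector_space_free_scale)
  let ?F = "free_space (vcarrier V \<times> vcarrier W) :: ('k, _) space"
  note c = is_space_closed[OF is_space_free_space[of "vcarrier V \<times> vcarrier W"]]
  have "is_space ?F" by (rule is_space_free_space)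
  then have "subspace (vcarrier ?F)" by (simp add: is_space_def)
  then show ?thesis
    unfolding tensor_rel_def
    by (intro span_minimal)
      (auto intro!: c(3)[simplified] c(4) gen_in_free_space is_space_closed[OF V] is_space_closed[OF W])
qed

lemma is_space_tensor: "is_space (V \<otimes>\<^sub>k W)"
  unfolding tensor_def by (intro is_space_quotient is_space_free_space) (simp add: subspace_tensor_rel)

lemma tensor_keys:
  assumes "is_space V" "is_space W" "t \<in> vcarrier (V \<otimes>\<^sub>k W)"
  shows "Poly_Mapping.keys t \<subseteq> vcarrier V \<times> vcarrier W"
  using quotient_mem(1)[OF is_space_free_space _ tensor_rel_sub[OF assms(1,2)]] assms(3)
  by (simp add: tensor_def vcarrier_free_space subspace_tensor_rel)

lemma tensor_ext:
  assumes "linear_map (V \<otimes>\<^sub>k W) Z f" "linear_map (V \<otimes>\<^sub>k W) Z g"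
    and "is_space V" "is_space W" "is_space Z"
    and "\<And>v w. v \<in> vcarrier V \<Longrightarrow> w \<in> vcarrier W \<Longrightarrow> f (tens V W v w) = g (tens V W v w)"
    and "t \<in> vcarrier (V \<otimes>\<^sub>k W)"
  shows "f t = g t"
  by (rule quotient_free_ext[OF subspace_tensor_rel tensor_rel_sub[OF assms(3,4)]])
    (use assms in \<open>auto simp: tensor_def tens_def\<close>)

lemma bilinear_tens: "bilinear_map V W (V \<otimes>\<^sub>k W) (tens V W)"
  by (simp add: bilinear_map_def linear_map_def tens_in_tensor tens_bilinear)

text \<open>
  Restricting \<open>F\<close> to the carriers makes linearity in \<open>t\<close> and the congruence rule unconditional.
\<close>

definition sweedler ::
  "('k::field, 'v::ab_group_add, 'x) space_scheme \<Rightarrow> ('k, 'w::ab_group_add, 'y) space_scheme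
    \<Rightarrow> ('k, 'u::ab_group_add, 'z) space_scheme
    \<Rightarrow> ('v \<Rightarrow> 'w \<Rightarrow> 'u) \<Rightarrow> (('v \<times> 'w) \<Rightarrow>\<^sub>0 'k) \<Rightarrow> 'u" where
  "sweedler V W Z F = tensor_lift Z (\<lambda>v w. if v \<in> vcarrier V \<and> w \<in> vcarrier W then F v w else 0)"

text \<open>As a congruence rule it hands the simplifier the memberships of the bound variables, so
  that equations valid only on carriers rewrite underneath Sweedler sums.\<close>

lemma sweedler_cong [cong]:
  assumes "t = t'"
    and "\<And>v w. v \<in> vcarrier V \<Longrightarrow> w \<in> vcarrier W \<Longrightarrow> F v w = G v w"
  shows "sweedler V W Z F t = sweedler V W Z G t'"
  unfolding sweedler_def tensor_lift_def assms(1)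
  by (rule lin_ext_cong) (auto simp: assms(2))

lemma tensor_lift_sweedler:
  assumes "is_space V" "is_space W" "t \<in> vcarrier (V \<otimes>\<^sub>k W)"
  shows "tensor_lift Z F t = sweedler V W Z F t"
  unfolding sweedler_def tensor_lift_def using tensor_keys[OF assms]
  by (intro lin_ext_cong) auto

lemma sweedler_tens:
  assumes "is_space V" "is_space W" "is_space Z" "bilinear_map V W Z F"
    and "v \<in> vcarrier V" "w \<in> vcarrier W"
  shows "sweedler V W Z F (tens V W v w) = F v w"
  using tensor_lift_tens[OF assms(4) is_space_vector_space[OF assms(3)] assms(5,6,1,2)]
  by (simp add: tensor_lift_sweedler[OF assms(1,2)] tens_in_tensor assms)

lemma sweedler_mem:
  assumes "is_space Z"
    and "\<And>v w. v \<in> vcarrier V \<Longrightarrow> w \<in> vcarrier W \<Longrightarrow> F v w \<in> vcarrier Z"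
  shows "sweedler V W Z F t \<in> vcarrier Z"
  unfolding sweedler_def tensor_lift_def using assms
  by (intro lin_ext_mem) (auto intro: is_space_zero)

text \<open>Outside the carriers the summand is 0, and \<open>g\<close> preserves 0; this is why
  \<open>t\<close> may be arbitrary.\<close>

lemma sweedler_push:
  assumes g: "linear_map Z Z' g" and "is_space Z" "is_space Z'"
    and F: "\<And>v w. v \<in> vcarrier V \<Longrightarrow> w \<in> vcarrier W \<Longrightarrow> F v w \<in> vcarrier Z"
  shows "g (sweedler V W Z F t) = sweedler V W Z' (\<lambda>v w. g (F v w)) t"
proof -
  let ?F = "\<lambda>x. case x of (v, w) \<Rightarrow> if v \<in> vcarrier V \<and> w \<in> vcarrier W then F v w else 0"
  have m: "?F x \<in> vcarrier Z" for x
    using F is_space_zero[OF assms(2)] by (auto split: prod.splits)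
  have "g (sweedler V W Z F t) = (\<Sum>x\<in>Poly_Mapping.keys t. g (vscale Z (Poly_Mapping.lookup t x) (?F x)))"
    unfolding sweedler_def tensor_lift_def lin_ext_def
    using m by (intro linear_map_sum[OF assms(1-3)] is_space_scale[OF assms(2)])
  also have "\<dots> = (\<Sum>x\<in>Poly_Mapping.keys t. vscale Z' (Poly_Mapping.lookup t x) (g (?F x)))"
    by (intro sum.cong refl linear_map_scale[OF g] m)
  also have "\<dots> = sweedler V W Z' (\<lambda>v w. g (F v w)) t"
    unfolding sweedler_def tensor_lift_def lin_ext_def
    by (intro sum.cong refl) (auto simp: linear_map_zero[OF assms(1-3)])
  finally show ?thesis .
qed

text \<open>Both sides are one finite double sum over the supports of \<open>t\<close> and
  \<open>s\<close>, so independent Sweedler sums commute for arbitrary \<open>F\<close>.\<close>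

lemma sweedler_swap:
  assumes "is_space Z"
  shows "sweedler V W Z (\<lambda>a b. sweedler V' W' Z (F a b) s) t =
    sweedler V' W' Z (\<lambda>c d. sweedler V W Z (\<lambda>a b. F a b c d) t) s"
proof -
  interpret vector_space "vscale Z" using assms by (rule is_space_vector_space)
  let ?F = "\<lambda>x y. case x of (a, b) \<Rightarrow> case y of (c, d) \<Rightarrow>
    if (a \<in> vcarrier V \<and> b \<in> vcarrier W) \<and> (c \<in> vcarrier V' \<and> d \<in> vcarrier W') then F a b c d else 0"
  have 1: "sweedler V W Z (\<lambda>a b. sweedler V' W' Z (F a b) s) t =
    (\<Sum>x\<in>Poly_Mapping.keys t. \<Sum>y\<in>Poly_Mapping.keys s.
       vscale Z (Poly_Mapping.lookup t x * Poly_Mapping.lookup s y) (?F x y))"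
    unfolding sweedler_def tensor_lift_def lin_ext_def
    by (intro sum.cong refl) (auto simp: scale_sum_right intro!: sum.cong)
  have 2: "sweedler V' W' Z (\<lambda>c d. sweedler V W Z (\<lambda>a b. F a b c d) t) s =
    (\<Sum>y\<in>Poly_Mapping.keys s. \<Sum>x\<in>Poly_Mapping.keys t.
       vscale Z (Poly_Mapping.lookup t x * Poly_Mapping.lookup s y) (?F x y))"
    unfolding sweedler_def tensor_lift_def lin_ext_def
    by (intro sum.cong refl) (auto simp: scale_sum_right mult.commute intro!: sum.cong)
  show ?thesis unfolding 1 2 by (rule sum.swap)
qed

lemma sweedler_total_linear:
  assumes "is_space Z"
  shows "sweedler V W Z F (p + q) = sweedler V W Z F p + sweedler V W Z F q"
    and "sweedler V W Z F (p - q) = sweedler V W Z F p - sweedler V W Z F q"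
    and "sweedler V W Z F (free_scale a p) = vscale Z a (sweedler V W Z F p)"
    and "sweedler V W Z F 0 = 0"
  unfolding sweedler_def tensor_lift_def by (simp_all add: lin_ext_total_linear[OF assms])

text \<open>A linear extension is linear on the whole type and therefore passes through the inner
  sum term by term. Of \<open>Z'\<close> only the scaling enters, so it may be any record over
  formal sums that has this scaling.\<close>

lemma sweedler_sweedler:
  assumes Z: "is_space Z" and A: "vscale Z' = free_scale"
  shows "sweedler A B Z G (sweedler V W Z' F t) =
    sweedler V W Z (\<lambda>v w. sweedler A B Z G (F v w)) t"
proof -
  let ?G = "\<lambda>(v, w). if v \<in> vcarrier A \<and> w \<in> vcarrier B then G v w else 0"
  have "sweedler A B Z G (sweedler V W Z' F t) = (\<Sum>x\<in>Poly_Mapping.keys t.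
     vscale Z (Poly_Mapping.lookup t x) (lin_ext Z ?G (case x of (v, w) \<Rightarrow> if v \<in> vcarrier V \<and> w \<in> vcarrier W then F v w else 0)))"
    unfolding sweedler_def tensor_lift_def
    by (subst (2) lin_ext_def) (simp add: lin_ext_total_linear[OF Z] A)
  also have "\<dots> = sweedler V W Z (\<lambda>v w. sweedler A B Z G (F v w)) t"
    unfolding sweedler_def tensor_lift_def
    by (subst (3) lin_ext_def) (intro sum.cong refl, auto simp: lin_ext_total_linear[OF Z])
  finally show ?thesis .
qed

lemma sweedler_linear_fun:
  assumes "is_space Z"
    and "\<And>v w. v \<in> vcarrier V \<Longrightarrow> w \<in> vcarrier W \<Longrightarrow> linear_map X Z (\<lambda>x. F x v w)"
  shows "linear_map X Z (\<lambda>x. sweedler V W Z (F x) t)"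
proof (rule linear_mapI)
  interpret vector_space "vscale Z" using assms(1) by (rule is_space_vector_space)
  show "sweedler V W Z (F x) t \<in> vcarrier Z" if "x \<in> vcarrier X" for x
    by (rule sweedler_mem[OF assms(1)]) (rule linear_map_mem[OF assms(2) that])
  show "sweedler V W Z (F (x + y)) t = sweedler V W Z (F x) t + sweedler V W Z (F y) t"
    if "x \<in> vcarrier X" "y \<in> vcarrier X" for x y
    unfolding sweedler_def tensor_lift_def lin_ext_def sum.distrib[symmetric]
    using linear_map_add[OF assms(2) that]
    by (intro sum.cong refl) (auto simp: scale_right_distrib)
  show "sweedler V W Z (F (vscale X a x)) t = vscale Z a (sweedler V W Z (F x) t)"
    if "x \<in> vcarrier X" for x a
    unfolding sweedler_def tensor_lift_def lin_ext_def scale_sum_right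
    using linear_map_scale[OF assms(2) that]
    by (intro sum.cong refl) (auto simp: mult.commute)
qed

lemma sweedler_linear_arg:
  assumes Z: "is_space Z" and g: "linear_map X (V \<otimes>\<^sub>k W) g"
    and F: "\<And>v w. v \<in> vcarrier V \<Longrightarrow> w \<in> vcarrier W \<Longrightarrow> F v w \<in> vcarrier Z"
  shows "linear_map X Z (\<lambda>x. sweedler V W Z F (g x))"
  by (rule linear_mapI)
    (simp_all add: sweedler_mem[OF Z F] linear_map_add[OF g] linear_map_scale[OF g]
      sweedler_total_linear[OF Z])

lemma sweedler_diff:
  assumes "is_space Z"
  shows "sweedler V W Z (\<lambda>v w. F v w - G v w) t = sweedler V W Z F t - sweedler V W Z G t"
proof -
  interpret vector_space "vscale Z" using assms(1) by (rule is_space_vector_space)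
  show ?thesis
    unfolding sweedler_def tensor_lift_def lin_ext_def sum_subtractf[symmetric]
    by (intro sum.cong refl) (auto simp: scale_right_diff_distrib)
qed

lemma sweedler_eta:
  assumes "is_space V" "is_space W" "t \<in> vcarrier (V \<otimes>\<^sub>k W)" "vscale Z = free_scale"
  shows "sweedler V W Z (tens V W) t = t"
proof -
  have "t = lin_ext Z (\<lambda>x. quotient_map free_scale (tensor_rel V W) (gen x)) t"
    using assms by (intro quotient_free_expand[OF subspace_tensor_rel tensor_rel_sub])
      (auto simp: tensor_def)
  also have "\<dots> = tensor_lift Z (tens V W) t"
    unfolding tensor_lift_def by (rule lin_ext_cong) (auto simp: tens_def)
  finally show ?thesis using tensor_lift_sweedler[OF assms(1-3)] by metis
qed

lemma tensor_map_sweedler: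
  assumes "is_space V" "is_space W" "t \<in> vcarrier (V \<otimes>\<^sub>k W)"
  shows "tensor_map A B f g t = sweedler V W (A \<otimes>\<^sub>k B) (\<lambda>v w. tens A B (f v) (g w)) t"
  unfolding tensor_map_def by (rule tensor_lift_sweedler[OF assms])

lemma tensor_op_sweedler:
  assumes "is_space V" "is_space W" "s \<in> vcarrier (V \<otimes>\<^sub>k W)"
    and "is_space V'" "is_space W'" "t \<in> vcarrier (V' \<otimes>\<^sub>k W')"
  shows "tensor_op A B f g s t = sweedler V W (A \<otimes>\<^sub>k B) (\<lambda>v w.
    sweedler V' W' (A \<otimes>\<^sub>k B) (\<lambda>v' w'. tens A B (f v v') (g w w')) t) s"
  unfolding tensor_op_def
  by (simp add: tensor_lift_sweedler[OF assms(1-3)] tensor_lift_sweedler[OF assms(4-6)])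

text \<open>One space occurs as several records, such as \<open>U_space C\<close> and
  \<open>U_bialg C\<close>, or \<open>H \<otimes>\<^sub>k V\<close> and the tetramodule built on it.
  Tensor products see only the carrier and the scaling.\<close>

lemma tensor_cong:
  assumes "vcarrier V = vcarrier V'" "vscale V = vscale V'"
    and "vcarrier W = vcarrier W'" "vscale W = vscale W'"
  shows "V \<otimes>\<^sub>k W = V' \<otimes>\<^sub>k W'" "tens V W = tens V' W'"
proof -
  have "tensor_rel V W = tensor_rel V' W'" unfolding tensor_rel_def assms ..
  then show "V \<otimes>\<^sub>k W = V' \<otimes>\<^sub>k W'" "tens V W = tens V' W'"
    by (simp_all add: tensor_def tens_def assms fun_eq_iff)
qed

lemma tensor_lift_cong_space:
  "vscale Z = vscale Z' \<Longrightarrow> tensor_lift Z = tensor_lift Z'"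
  by (simp add: tensor_lift_def lin_ext_def fun_eq_iff)

lemma sweedler_space_cong:
  "vscale Z = vscale Z' \<Longrightarrow> sweedler V W Z = sweedler V W Z'"
  unfolding sweedler_def by (simp add: fun_eq_iff tensor_lift_cong_space[of Z Z'])

named_theorems multilin "syntax-directed rules for multilinearity"

text \<open>Each rule strips the outermost operation of an expression and reduces its linearity in
  one variable, or its membership, to the same question about the arguments. Repeated resolution
  then settles nested Sweedler sums; further structure maps are added once they are known to be
  linear.\<close>

lemmas [multilin] = linear_map_ident is_space_tensor bilinear_mapI
  sweedler_linear_fun sweedler_linear_arg sweedler_mem tens_in_tensor
  bilinear_map_compose_left[OF bilinear_tens] bilinear_map_compose_right[OF bilinear_tens]

lemma tensor_map_linear:
  assumes "is_space V" "is_space W" "is_space A" "is_space B"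
    and f: "linear_map V A f" and g: "linear_map W B g"
  shows "linear_map (V \<otimes>\<^sub>k W) (A \<otimes>\<^sub>k B) (tensor_map A B f g)"
proof (rule linear_map_cong[OF is_space_tensor])
  show "linear_map (V \<otimes>\<^sub>k W) (A \<otimes>\<^sub>k B) (\<lambda>t. sweedler V W (A \<otimes>\<^sub>k B) (\<lambda>v w. tens A B (f v) (g w)) t)"
    by (rule multilin linear_map_mem[OF f] linear_map_mem[OF g] | assumption)+
qed (simp add: tensor_map_sweedler[OF assms(1,2)])

lemma tensor_map_tens:
  assumes "is_space V" "is_space W" "is_space A" "is_space B"
    and f: "linear_map V A f" and g: "linear_map W B g"
    and "v \<in> vcarrier V" "w \<in> vcarrier W"
  shows "tensor_map A B f g (tens V W v w) = tens A B (f v) (g w)"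
proof -
  have "bilinear_map V W (A \<otimes>\<^sub>k B) (\<lambda>v w. tens A B (f v) (g w))"
    by (rule multilin linear_map_mem[OF f] linear_map_mem[OF g] f g | assumption)+
  then show ?thesis
    using assms by (simp add: tensor_map_sweedler[OF assms(1,2)] tens_in_tensor sweedler_tens is_space_tensor)
qed

lemma tensor_op_linear:
  assumes "is_space V" "is_space W" "is_space V'" "is_space W'" "is_space A" "is_space B"
    and f: "bilinear_map V V' A f" and g: "bilinear_map W W' B g"
  shows "bilinear_map (V \<otimes>\<^sub>k W) (V' \<otimes>\<^sub>k W') (A \<otimes>\<^sub>k B) (tensor_op A B f g)"
proof (rule bilinear_mapI)
  note [multilin] = bilinear_map_mem[OF f] bilinear_map_mem[OF g]
  fix s assume s: "s \<in> vcarrier (V \<otimes>\<^sub>k W)"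
  have "linear_map (V' \<otimes>\<^sub>k W') (A \<otimes>\<^sub>k B) (\<lambda>t. sweedler V W (A \<otimes>\<^sub>k B) (\<lambda>v w.
      sweedler V' W' (A \<otimes>\<^sub>k B) (\<lambda>v' w'. tens A B (f v v') (g w w')) t) s)"
    by (rule multilin | assumption)+
  then show "linear_map (V' \<otimes>\<^sub>k W') (A \<otimes>\<^sub>k B) (tensor_op A B f g s)"
    by (rule linear_map_cong[OF is_space_tensor]) (simp add: tensor_op_sweedler[OF assms(1,2) s assms(3,4)])
next
  note [multilin] = bilinear_map_mem[OF f] bilinear_map_mem[OF g]
  fix t assume t: "t \<in> vcarrier (V' \<otimes>\<^sub>k W')"
  have "linear_map (V \<otimes>\<^sub>k W) (A \<otimes>\<^sub>k B) (\<lambda>s. sweedler V W (A \<otimes>\<^sub>k B) (\<lambda>v w.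
      sweedler V' W' (A \<otimes>\<^sub>k B) (\<lambda>v' w'. tens A B (f v v') (g w w')) t) s)"
    by (rule multilin | assumption)+
  then show "linear_map (V \<otimes>\<^sub>k W) (A \<otimes>\<^sub>k B) (\<lambda>s. tensor_op A B f g s t)"
    by (rule linear_map_cong[OF is_space_tensor]) (simp add: tensor_op_sweedler[OF assms(1,2) _ assms(3,4) t])
qed

lemma tensor_op_tens:
  assumes s: "is_space V" "is_space W" "is_space V'" "is_space W'" "is_space A" "is_space B"
    and f: "bilinear_map V V' A f" and g: "bilinear_map W W' B g"
    and v: "v \<in> vcarrier V" "w \<in> vcarrier W" "v' \<in> vcarrier V'" "w' \<in> vcarrier W'"
  shows "tensor_op A B f g (tens V W v w) (tens V' W' v' w') = tens A B (f v v') (g w w')"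
proof -
  note [multilin] = bilinear_map_mem[OF f] bilinear_map_mem[OF g]
    bilinear_map_compose_left[OF f] bilinear_map_compose_right[OF f]
    bilinear_map_compose_left[OF g] bilinear_map_compose_right[OF g]
  have 1: "bilinear_map V' W' (A \<otimes>\<^sub>k B) (\<lambda>v' w'. tens A B (f v v') (g w w'))"
    if "v \<in> vcarrier V" "w \<in> vcarrier W" for v w
    by (insert that, (rule multilin | assumption)+)
  have 2: "bilinear_map V W (A \<otimes>\<^sub>k B) (\<lambda>v w. tens A B (f v v') (g w w'))"
    by (rule multilin v | assumption)+
  show ?thesis
    using s v by (simp add: tensor_op_sweedler[OF s(1,2) _ s(3,4)] tens_in_tensor sweedler_tens[OF _ _ _ 1]
      sweedler_tens[OF _ _ _ 2] is_space_tensor)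
qed

lemma tensor_assoc_sweedler:
  assumes "is_space U" "is_space V" "is_space W" "t \<in> vcarrier ((U \<otimes>\<^sub>k V) \<otimes>\<^sub>k W)"
  shows "tensor_assoc U V W t = sweedler (U \<otimes>\<^sub>k V) W (U \<otimes>\<^sub>k (V \<otimes>\<^sub>k W)) (\<lambda>s w.
     sweedler U V (U \<otimes>\<^sub>k (V \<otimes>\<^sub>k W)) (\<lambda>u v. tens U (V \<otimes>\<^sub>k W) u (tens V W v w)) s) t"
  unfolding tensor_assoc_def
  by (simp add: tensor_lift_sweedler[OF is_space_tensor assms(3,4)]
      tensor_lift_sweedler[OF assms(1,2)])

lemma tensor_assoc_linear:
  assumes "is_space U" "is_space V" "is_space W"
  shows "linear_map ((U \<otimes>\<^sub>k V) \<otimes>\<^sub>k W) (U \<otimes>\<^sub>k (V \<otimes>\<^sub>k W)) (tensor_assoc U V W)"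
proof (rule linear_map_cong[OF is_space_tensor])
  show "linear_map ((U \<otimes>\<^sub>k V) \<otimes>\<^sub>k W) (U \<otimes>\<^sub>k (V \<otimes>\<^sub>k W))
    (sweedler (U \<otimes>\<^sub>k V) W (U \<otimes>\<^sub>k (V \<otimes>\<^sub>k W)) (\<lambda>s w.
     sweedler U V (U \<otimes>\<^sub>k (V \<otimes>\<^sub>k W)) (\<lambda>u v. tens U (V \<otimes>\<^sub>k W) u (tens V W v w)) s))"
    by (rule multilin | assumption)+
qed (simp add: tensor_assoc_sweedler assms)

lemma tensor_assoc_tens:
  assumes "is_space U" "is_space V" "is_space W"
    and "u \<in> vcarrier U" "v \<in> vcarrier V" "w \<in> vcarrier W"
  shows "tensor_assoc U V W (tens (U \<otimes>\<^sub>k V) W (tens U V u v) w) =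
    tens U (V \<otimes>\<^sub>k W) u (tens V W v w)"
proof -
  have 1: "bilinear_map (U \<otimes>\<^sub>k V) W (U \<otimes>\<^sub>k (V \<otimes>\<^sub>k W)) (\<lambda>s w.
     sweedler U V (U \<otimes>\<^sub>k (V \<otimes>\<^sub>k W)) (\<lambda>u v. tens U (V \<otimes>\<^sub>k W) u (tens V W v w)) s)"
    by (rule multilin | assumption)+
  have 2: "bilinear_map U V (U \<otimes>\<^sub>k (V \<otimes>\<^sub>k W)) (\<lambda>u v. tens U (V \<otimes>\<^sub>k W) u (tens V W v w))"
    by (insert assms, (rule multilin | assumption)+)
  show ?thesis
    using assms by (simp add: tensor_assoc_sweedler tens_in_tensor sweedler_tens[OF _ _ _ 1]
      sweedler_tens[OF _ _ _ 2] is_space_tensor)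
qed

lemma tensor_swap_sweedler:
  assumes "is_space V" "is_space W" "t \<in> vcarrier (V \<otimes>\<^sub>k W)"
  shows "tensor_swap V W t = sweedler V W (W \<otimes>\<^sub>k V) (\<lambda>v w. tens W V w v) t"
  unfolding tensor_swap_def by (rule tensor_lift_sweedler[OF assms])

section \<open>Algebras\<close>

definition is_algebra ::
  "('k::field, 'a::ab_group_add, 'z) space_scheme \<Rightarrow> ('a \<Rightarrow> 'a \<Rightarrow> 'a) \<Rightarrow> 'a \<Rightarrow> bool" where
  "is_algebra A m e \<longleftrightarrow> is_space A \<and> bilinear_map A A A m \<and> e \<in> vcarrier A \<and>
     (\<forall>a\<in>vcarrier A. \<forall>b\<in>vcarrier A. \<forall>c\<in>vcarrier A. m (m a b) c = m a (m b c)) \<and>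
     (\<forall>a\<in>vcarrier A. m e a = a \<and> m a e = a)"

definition is_algebra_map ::
  "('k::field, 'a::ab_group_add, 'y) space_scheme \<Rightarrow> ('a \<Rightarrow> 'a \<Rightarrow> 'a) \<Rightarrow> 'a
    \<Rightarrow> ('k, 'b::ab_group_add, 'z) space_scheme \<Rightarrow> ('b \<Rightarrow> 'b \<Rightarrow> 'b) \<Rightarrow> 'b \<Rightarrow> ('a \<Rightarrow> 'b) \<Rightarrow> bool" where
  "is_algebra_map A m e B n u f \<longleftrightarrow> linear_map A B f \<and> f e = u \<and>
     (\<forall>a\<in>vcarrier A. \<forall>b\<in>vcarrier A. f (m a b) = n (f a) (f b))"

lemma is_algebraD:
  assumes "is_algebra A m e"
  shows "is_space A" "bilinear_map A A A m" "e \<in> vcarrier A"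
    and "\<And>a b c. a \<in> vcarrier A \<Longrightarrow> b \<in> vcarrier A \<Longrightarrow> c \<in> vcarrier A \<Longrightarrow> m (m a b) c = m a (m b c)"
    and "\<And>a. a \<in> vcarrier A \<Longrightarrow> m e a = a" "\<And>a. a \<in> vcarrier A \<Longrightarrow> m a e = a"
    and "\<And>a b. a \<in> vcarrier A \<Longrightarrow> b \<in> vcarrier A \<Longrightarrow> m a b \<in> vcarrier A"
  using assms by (auto simp: is_algebra_def intro: bilinear_map_mem)

lemma is_algebra_mapD:
  assumes "is_algebra_map A m e B n u f"
  shows "linear_map A B f" "f e = u"
    and "\<And>a b. a \<in> vcarrier A \<Longrightarrow> b \<in> vcarrier A \<Longrightarrow> f (m a b) = n (f a) (f b)"
    and "\<And>a. a \<in> vcarrier A \<Longrightarrow> f a \<in> vcarrier B"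
  using assms by (auto simp: is_algebra_map_def intro: linear_map_mem)

lemma is_algebra_map_compose:
  "is_algebra_map B n u D p w g \<Longrightarrow> is_algebra_map A m e B n u f
    \<Longrightarrow> is_algebra_map A m e D p w (\<lambda>x. g (f x))"
  unfolding is_algebra_map_def by (auto simp: linear_map_def)

lemma is_algebra_map_ident: "is_algebra_map A m e A m e (\<lambda>x. x)"
  by (simp add: is_algebra_map_def linear_map_ident)

lemma is_algebra_ground: "is_algebra ground (*) 1"
  by (auto simp: is_algebra_def is_space_ground mem_ground bilinear_map_def linear_map_def
      algebra_simps) (auto simp: ground_def)

text \<open>The axioms are linear in each argument, so the arguments may be replaced by pure tensors
  one at a time; on pure tensors the axioms hold componentwise.\<close>

lemma is_algebra_tensor:
  assumes A: "is_algebra A m e" and B: "is_algebra B n u"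
  shows "is_algebra (A \<otimes>\<^sub>k B) (tensor_op A B m n) (tens A B e u)"
proof -
  note a = is_algebraD[OF A] and b = is_algebraD[OF B]
  let ?X = "A \<otimes>\<^sub>k B" and ?t = "tensor_op A B m n"
  note X = is_space_tensor[of A B]
  have bil: "bilinear_map ?X ?X ?X ?t"
    by (rule tensor_op_linear[OF a(1) b(1) a(1) b(1) a(1) b(1) a(2) b(2)])
  note L = bilinear_map_compose_left[OF bil] bilinear_map_compose_right[OF bil]
    bilinear_map_mem[OF bil] linear_map_ident
  note pure = tensor_op_tens[OF a(1) b(1) a(1) b(1) a(1) b(1) a(2) b(2)]
  note mem = tens_in_tensor
  have "?t (?t x y) z = ?t x (?t y z)"
    if x: "x \<in> vcarrier ?X" and y: "y \<in> vcarrier ?X" and z: "z \<in> vcarrier ?X" for x y z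
  proof (rule tensor_ext[OF _ _ a(1) b(1) X _ x])
    fix a1 b1 assume 1: "a1 \<in> vcarrier A" "b1 \<in> vcarrier B"
    show "?t (?t (tens A B a1 b1) y) z = ?t (tens A B a1 b1) (?t y z)"
    proof (rule tensor_ext[OF _ _ a(1) b(1) X _ y])
      fix a2 b2 assume 2: "a2 \<in> vcarrier A" "b2 \<in> vcarrier B"
      show "?t (?t (tens A B a1 b1) (tens A B a2 b2)) z = ?t (tens A B a1 b1) (?t (tens A B a2 b2) z)"
      proof (rule tensor_ext[OF _ _ a(1) b(1) X _ z])
        fix a3 b3 assume 3: "a3 \<in> vcarrier A" "b3 \<in> vcarrier B"
        show "?t (?t (tens A B a1 b1) (tens A B a2 b2)) (tens A B a3 b3) =
          ?t (tens A B a1 b1) (?t (tens A B a2 b2) (tens A B a3 b3))"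
          using 1 2 3 by (simp add: pure a b)
      qed (insert 1 2, (rule L mem | assumption)+)
    qed (insert 1 z, (rule L mem | assumption)+)
  qed (insert y z, (rule L mem | assumption)+)
  moreover have "?t (tens A B e u) x = x" if x: "x \<in> vcarrier ?X" for x
    by (rule tensor_ext[OF _ _ a(1) b(1) X _ x])
      (rule L mem a(3) b(3) | simp add: pure a b)+
  moreover have "?t x (tens A B e u) = x" if x: "x \<in> vcarrier ?X" for x
    by (rule tensor_ext[OF _ _ a(1) b(1) X _ x])
      (rule L mem a(3) b(3) | simp add: pure a b)+
  ultimately show ?thesis
    unfolding is_algebra_def using X bil mem a(3) b(3) by blast
qed

lemma is_algebra_map_tensor_map:
  assumes A: "is_algebra A m e" and B: "is_algebra B n u"
    and A': "is_algebra A' m' e'" and B': "is_algebra B' n' u'"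
    and f: "is_algebra_map A m e A' m' e' f" and g: "is_algebra_map B n u B' n' u' g"
  shows "is_algebra_map (A \<otimes>\<^sub>k B) (tensor_op A B m n) (tens A B e u)
    (A' \<otimes>\<^sub>k B') (tensor_op A' B' m' n') (tens A' B' e' u') (tensor_map A' B' f g)"
proof -
  note a = is_algebraD[OF A] and b = is_algebraD[OF B]
  note a' = is_algebraD[OF A'] and b' = is_algebraD[OF B']
  note F = is_algebra_mapD[OF f] and G = is_algebra_mapD[OF g]
  let ?X = "A \<otimes>\<^sub>k B" and ?t = "tensor_op A B m n" and ?X' = "A' \<otimes>\<^sub>k B'" and ?t' = "tensor_op A' B' m' n'"
  let ?h = "tensor_map A' B' f g"
  have lin: "linear_map ?X ?X' ?h"
    by (rule tensor_map_linear[OF a(1) b(1) a'(1) b'(1) F(1) G(1)])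
  have bil: "bilinear_map ?X ?X ?X ?t"
    by (rule tensor_op_linear[OF a(1) b(1) a(1) b(1) a(1) b(1) a(2) b(2)])
  have bil': "bilinear_map ?X' ?X' ?X' ?t'"
    by (rule tensor_op_linear[OF a'(1) b'(1) a'(1) b'(1) a'(1) b'(1) a'(2) b'(2)])
  note L = bilinear_map_compose_left[OF bil] bilinear_map_compose_right[OF bil]
    bilinear_map_compose_left[OF bil'] bilinear_map_compose_right[OF bil']
    bilinear_map_mem[OF bil] linear_map_ident linear_map_compose[OF lin] linear_map_mem[OF lin]
  note pure = tensor_op_tens[OF a(1) b(1) a(1) b(1) a(1) b(1) a(2) b(2)]
    tensor_op_tens[OF a'(1) b'(1) a'(1) b'(1) a'(1) b'(1) a'(2) b'(2)]
    tensor_map_tens[OF a(1) b(1) a'(1) b'(1) F(1) G(1)]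
  have "?h (?t x y) = ?t' (?h x) (?h y)" if x: "x \<in> vcarrier ?X" and y: "y \<in> vcarrier ?X" for x y
  proof (rule tensor_ext[OF _ _ a(1) b(1) is_space_tensor[of A' B'] _ x])
    fix a1 b1 assume 1: "a1 \<in> vcarrier A" "b1 \<in> vcarrier B"
    show "?h (?t (tens A B a1 b1) y) = ?t' (?h (tens A B a1 b1)) (?h y)"
    proof (rule tensor_ext[OF _ _ a(1) b(1) is_space_tensor[of A' B'] _ y])
      show "?h (?t (tens A B a1 b1) (tens A B a2 b2)) = ?t' (?h (tens A B a1 b1)) (?h (tens A B a2 b2))"
        if 2: "a2 \<in> vcarrier A" "b2 \<in> vcarrier B" for a2 b2
        using 1 2 by (simp add: pure a b F G)
    qed (insert 1, (rule L tens_in_tensor | assumption)+)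
  qed (insert y, (rule L tens_in_tensor | assumption)+)
  moreover have "?h (tens A B e u) = tens A' B' e' u'"
    using a(3) b(3) by (simp add: pure F G)
  ultimately show ?thesis using lin unfolding is_algebra_map_def by blast
qed

text \<open>Turns coassociativity of a multiplicative coproduct into an equality of two algebra
  maps, which can be tested on generators.\<close>

lemma is_algebra_map_tensor_assoc:
  assumes A: "is_algebra A m e" and B: "is_algebra B n u" and D: "is_algebra D p w"
  shows "is_algebra_map ((A \<otimes>\<^sub>k B) \<otimes>\<^sub>k D) (tensor_op (A \<otimes>\<^sub>k B) D (tensor_op A B m n) p)
      (tens (A \<otimes>\<^sub>k B) D (tens A B e u) w)
    (A \<otimes>\<^sub>k (B \<otimes>\<^sub>k D)) (tensor_op A (B \<otimes>\<^sub>k D) m (tensor_op B D n p))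
      (tens A (B \<otimes>\<^sub>k D) e (tens B D u w)) (tensor_assoc A B D)"
proof -
  note a = is_algebraD[OF A] and b = is_algebraD[OF B] and d = is_algebraD[OF D]
  note AB = is_algebra_tensor[OF A B] and BD = is_algebra_tensor[OF B D]
  note ab = is_algebraD[OF AB] and bd = is_algebraD[OF BD]
  note l = is_algebraD[OF is_algebra_tensor[OF AB D]]
    and r = is_algebraD[OF is_algebra_tensor[OF A BD]]
  let ?L = "(A \<otimes>\<^sub>k B) \<otimes>\<^sub>k D" and ?R = "A \<otimes>\<^sub>k (B \<otimes>\<^sub>k D)"
  let ?l = "tensor_op (A \<otimes>\<^sub>k B) D (tensor_op A B m n) p"
    and ?r = "tensor_op A (B \<otimes>\<^sub>k D) m (tensor_op B D n p)"
  let ?h = "tensor_assoc A B D"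
  note lin = tensor_assoc_linear[OF a(1) b(1) d(1)]
  note L = bilinear_map_compose_left[OF l(2)] bilinear_map_compose_right[OF l(2)]
    bilinear_map_compose_left[OF r(2)] bilinear_map_compose_right[OF r(2)]
    bilinear_map_mem[OF l(2)] linear_map_compose[OF lin] linear_map_mem[OF lin] linear_map_ident
    bilinear_map_compose_left[OF bilinear_tens] bilinear_map_compose_right[OF bilinear_tens]
  note pure = tensor_op_tens[OF a(1) b(1) a(1) b(1) a(1) b(1) a(2) b(2)]
    tensor_op_tens[OF b(1) d(1) b(1) d(1) b(1) d(1) b(2) d(2)]
    tensor_op_tens[OF ab(1) d(1) ab(1) d(1) ab(1) d(1) ab(2) d(2)]
    tensor_op_tens[OF a(1) bd(1) a(1) bd(1) a(1) bd(1) a(2) bd(2)]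
    tensor_assoc_tens[OF a(1) b(1) d(1)]
  have "?h (?l x y) = ?r (?h x) (?h y)" if x: "x \<in> vcarrier ?L" and y: "y \<in> vcarrier ?L" for x y
  proof (rule tensor_ext[OF _ _ ab(1) d(1) r(1) _ x])
    fix s1 d1 assume s1: "s1 \<in> vcarrier (A \<otimes>\<^sub>k B)" and d1: "d1 \<in> vcarrier D"
    show "?h (?l (tens (A \<otimes>\<^sub>k B) D s1 d1) y) = ?r (?h (tens (A \<otimes>\<^sub>k B) D s1 d1)) (?h y)"
    proof (rule tensor_ext[OF _ _ ab(1) d(1) r(1) _ y])
      fix s2 d2 assume s2: "s2 \<in> vcarrier (A \<otimes>\<^sub>k B)" and d2: "d2 \<in> vcarrier D"
      show "?h (?l (tens (A \<otimes>\<^sub>k B) D s1 d1) (tens (A \<otimes>\<^sub>k B) D s2 d2)) =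
        ?r (?h (tens (A \<otimes>\<^sub>k B) D s1 d1)) (?h (tens (A \<otimes>\<^sub>k B) D s2 d2))"
      proof (rule tensor_ext[OF _ _ a(1) b(1) r(1) _ s1])
        fix a1 b1 assume 1: "a1 \<in> vcarrier A" "b1 \<in> vcarrier B"
        show "?h (?l (tens (A \<otimes>\<^sub>k B) D (tens A B a1 b1) d1) (tens (A \<otimes>\<^sub>k B) D s2 d2)) =
          ?r (?h (tens (A \<otimes>\<^sub>k B) D (tens A B a1 b1) d1)) (?h (tens (A \<otimes>\<^sub>k B) D s2 d2))"
        proof (rule tensor_ext[OF _ _ a(1) b(1) r(1) _ s2])
          fix a2 b2 assume 2: "a2 \<in> vcarrier A" "b2 \<in> vcarrier B"
          show "?h (?l (tens (A \<otimes>\<^sub>k B) D (tens A B a1 b1) d1) (tens (A \<otimes>\<^sub>k B) D (tens A B a2 b2) d2)) =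
            ?r (?h (tens (A \<otimes>\<^sub>k B) D (tens A B a1 b1) d1)) (?h (tens (A \<otimes>\<^sub>k B) D (tens A B a2 b2) d2))"
            using 1 2 d1 d2 by (simp add: pure a(7) b(7) d(7) tens_in_tensor)
        qed (insert 1 d1 d2, (rule L tens_in_tensor | assumption)+)
      qed (insert s2 d1 d2, (rule L tens_in_tensor | assumption)+)
    qed (insert s1 d1, (rule L tens_in_tensor | assumption)+)
  qed (insert y, (rule L tens_in_tensor | assumption)+)
  then show ?thesis
    using lin a(3) b(3) d(3) by (simp add: is_algebra_map_def pure)
qed

text \<open>This is \<open>f \<otimes> id\<close> followed by the identification of
  \<open>k \<otimes> B\<close> with \<open>B\<close>; with it a counit axiom becomes an equality of
  algebra maps.\<close>

lemma is_algebra_map_counit_left: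
  assumes A: "is_algebra A m e" and B: "is_algebra B n u" and f: "is_algebra_map A m e ground (*) 1 f"
  shows "is_algebra_map (A \<otimes>\<^sub>k B) (tensor_op A B m n) (tens A B e u) B n u
    (sweedler A B B (\<lambda>a b. vscale B (f a) b))"
proof -
  note a = is_algebraD[OF A] and b = is_algebraD[OF B] and F = is_algebra_mapD[OF f]
  interpret vector_space "vscale B" using b(1) by (rule is_space_vector_space)
  let ?X = "A \<otimes>\<^sub>k B" and ?t = "tensor_op A B m n" and ?h = "sweedler A B B (\<lambda>a b. vscale B (f a) b)"
  have bil: "bilinear_map A B B (\<lambda>a b. vscale B (f a) b)"
    by (rule multilin bilinear_map_compose_left[OF bilinear_map_scale[OF b(1)]]
        bilinear_map_compose_right[OF bilinear_map_scale[OF b(1)]] F(1) F(4) | assumption)+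
  have lin: "linear_map ?X B ?h"
    by (rule multilin b(1) bilinear_map_mem[OF bil] | assumption)+
  have bt: "bilinear_map ?X ?X ?X ?t"
    by (rule tensor_op_linear[OF a(1) b(1) a(1) b(1) a(1) b(1) a(2) b(2)])
  note L = bilinear_map_compose_left[OF bt] bilinear_map_compose_right[OF bt]
    bilinear_map_compose_left[OF b(2)] bilinear_map_compose_right[OF b(2)]
    bilinear_map_mem[OF bt] linear_map_ident linear_map_compose[OF lin] linear_map_mem[OF lin]
  note pure = tensor_op_tens[OF a(1) b(1) a(1) b(1) a(1) b(1) a(2) b(2)] sweedler_tens[OF a(1) b(1) b(1) bil]
    linear_map_scale[OF bilinear_map_left[OF b(2)]] linear_map_scale[OF bilinear_map_right[OF b(2)]]
  have "?h (?t x y) = n (?h x) (?h y)" if x: "x \<in> vcarrier ?X" and y: "y \<in> vcarrier ?X" for x y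
  proof (rule tensor_ext[OF _ _ a(1) b(1) b(1) _ x])
    fix a1 b1 assume 1: "a1 \<in> vcarrier A" "b1 \<in> vcarrier B"
    show "?h (?t (tens A B a1 b1) y) = n (?h (tens A B a1 b1)) (?h y)"
    proof (rule tensor_ext[OF _ _ a(1) b(1) b(1) _ y])
      show "?h (?t (tens A B a1 b1) (tens A B a2 b2)) = n (?h (tens A B a1 b1)) (?h (tens A B a2 b2))"
        if 2: "a2 \<in> vcarrier A" "b2 \<in> vcarrier B" for a2 b2
        using 1 2 by (simp add: pure a b F is_space_scale)
    qed (insert 1, (rule L tens_in_tensor | assumption)+)
  qed (insert y, (rule L tens_in_tensor | assumption)+)
  moreover have "?h (tens A B e u) = u" using a(3) b(3) by (simp add: pure F)
  ultimately show ?thesis using lin unfolding is_algebra_map_def by blast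
qed

lemma is_algebra_map_counit_right:
  assumes A: "is_algebra A m e" and B: "is_algebra B n u" and f: "is_algebra_map B n u ground (*) 1 f"
  shows "is_algebra_map (A \<otimes>\<^sub>k B) (tensor_op A B m n) (tens A B e u) A m e
    (sweedler A B A (\<lambda>a b. vscale A (f b) a))"
proof -
  note a = is_algebraD[OF A] and b = is_algebraD[OF B] and F = is_algebra_mapD[OF f]
  interpret vector_space "vscale A" using a(1) by (rule is_space_vector_space)
  let ?X = "A \<otimes>\<^sub>k B" and ?t = "tensor_op A B m n" and ?h = "sweedler A B A (\<lambda>a b. vscale A (f b) a)"
  have bil: "bilinear_map A B A (\<lambda>a b. vscale A (f b) a)"
    by (rule multilin bilinear_map_compose_left[OF bilinear_map_scale[OF a(1)]]
        bilinear_map_compose_right[OF bilinear_map_scale[OF a(1)]] F(1) F(4) | assumption)+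
  have lin: "linear_map ?X A ?h"
    by (rule multilin a(1) bilinear_map_mem[OF bil] | assumption)+
  have bt: "bilinear_map ?X ?X ?X ?t"
    by (rule tensor_op_linear[OF a(1) b(1) a(1) b(1) a(1) b(1) a(2) b(2)])
  note L = bilinear_map_compose_left[OF bt] bilinear_map_compose_right[OF bt]
    bilinear_map_compose_left[OF a(2)] bilinear_map_compose_right[OF a(2)]
    bilinear_map_mem[OF bt] linear_map_ident linear_map_compose[OF lin] linear_map_mem[OF lin]
  note pure = tensor_op_tens[OF a(1) b(1) a(1) b(1) a(1) b(1) a(2) b(2)] sweedler_tens[OF a(1) b(1) a(1) bil]
    linear_map_scale[OF bilinear_map_left[OF a(2)]] linear_map_scale[OF bilinear_map_right[OF a(2)]]
  have "?h (?t x y) = m (?h x) (?h y)" if x: "x \<in> vcarrier ?X" and y: "y \<in> vcarrier ?X" for x y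
  proof (rule tensor_ext[OF _ _ a(1) b(1) a(1) _ x])
    fix a1 b1 assume 1: "a1 \<in> vcarrier A" "b1 \<in> vcarrier B"
    show "?h (?t (tens A B a1 b1) y) = m (?h (tens A B a1 b1)) (?h y)"
    proof (rule tensor_ext[OF _ _ a(1) b(1) a(1) _ y])
      show "?h (?t (tens A B a1 b1) (tens A B a2 b2)) = m (?h (tens A B a1 b1)) (?h (tens A B a2 b2))"
        if 2: "a2 \<in> vcarrier A" "b2 \<in> vcarrier B" for a2 b2
        using 1 2 by (simp add: pure a b F is_space_scale)
    qed (insert 1, (rule L tens_in_tensor | assumption)+)
  qed (insert y, (rule L tens_in_tensor | assumption)+)
  moreover have "?h (tens A B e u) = e" using a(3) b(3) by (simp add: pure F)
  ultimately show ?thesis using lin unfolding is_algebra_map_def by blast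
qed

section \<open>The tensor algebra\<close>

text \<open>Multilinearity for all word lengths at once. Singling out a letter as
  \<open>xs @ [v] @ ys\<close> mirrors the generators of \<open>word_rel\<close>, so these word
  functions factor through the tensor algebra.\<close>

definition word_linear ::
  "('k::field, 'v::ab_group_add, 'y) space_scheme \<Rightarrow> ('k, 'a::ab_group_add, 'z) space_scheme
    \<Rightarrow> ('v list \<Rightarrow> 'a) \<Rightarrow> bool" where
  "word_linear V Z \<phi> \<longleftrightarrow> (\<forall>xs\<in>lists (vcarrier V). \<phi> xs \<in> vcarrier Z) \<and>
     (\<forall>xs\<in>lists (vcarrier V). \<forall>ys\<in>lists (vcarrier V). linear_map V Z (\<lambda>v. \<phi> (xs @ [v] @ ys)))"

lemma word_linearI:
  assumes "\<And>xs. xs \<in> lists (vcarrier V) \<Longrightarrow> \<phi> xs \<in> vcarrier Z"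
    and "\<And>xs ys v v'. xs \<in> lists (vcarrier V) \<Longrightarrow> ys \<in> lists (vcarrier V) \<Longrightarrow>
      v \<in> vcarrier V \<Longrightarrow> v' \<in> vcarrier V \<Longrightarrow>
      \<phi> (xs @ [v + v'] @ ys) = \<phi> (xs @ [v] @ ys) + \<phi> (xs @ [v'] @ ys)"
    and "\<And>xs ys v a. xs \<in> lists (vcarrier V) \<Longrightarrow> ys \<in> lists (vcarrier V) \<Longrightarrow> v \<in> vcarrier V \<Longrightarrow>
      \<phi> (xs @ [vscale V a v] @ ys) = vscale Z a (\<phi> (xs @ [v] @ ys))"
  shows "word_linear V Z \<phi>"
  unfolding word_linear_def linear_map_def using assms by (simp del: append_Cons)

lemma vscale_tensor_algebra [simp]: "vscale (tensor_algebra V) = free_scale"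
  by (simp add: tensor_algebra_def quotient_space_def)

lemma subspace_word_rel: "module.subspace free_scale (word_rel V)"
  unfolding word_rel_def by (rule module.subspace_span[OF module_free_scale])

lemma word_rel_sub:
  fixes V :: "('k::field, 'v::ab_group_add, 'y) space_scheme"
  assumes V: "is_space V"
  shows "word_rel V \<subseteq> vcarrier (free_space (lists (vcarrier V)))"
proof -
  interpret vector_space free_scale by (rule vector_space_free_scale)
  let ?F = "free_space (lists (vcarrier V)) :: ('k, _) space"
  note c = is_space_closed[OF is_space_free_space[of "lists (vcarrier V)"]]
  have "is_space ?F" by (rule is_space_free_space)
  then have "subspace (vcarrier ?F)" by (simp add: is_space_def)
  then show ?thesis
    unfolding word_rel_def
    by (intro span_minimal)
      (auto intro!: c(3)[simplified] c(4) gen_in_free_space is_space_closed[OF V])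
qed

lemma is_space_tensor_algebra: "is_space (tensor_algebra V)"
  unfolding tensor_algebra_def
  by (intro is_space_quotient is_space_free_space) (simp add: subspace_word_rel)

lemma tensor_algebra_keys:
  assumes "is_space V" "t \<in> vcarrier (tensor_algebra V)"
  shows "Poly_Mapping.keys t \<subseteq> lists (vcarrier V)"
  using quotient_mem(1)[OF is_space_free_space _ word_rel_sub[OF assms(1)]] assms(2)
  by (simp add: tensor_algebra_def vcarrier_free_space subspace_word_rel)

lemma word_mem: "xs \<in> lists (vcarrier V) \<Longrightarrow> word V xs \<in> vcarrier (tensor_algebra V)"
  by (simp add: word_def tensor_algebra_def quotient_space_def gen_in_free_space)

lemma tensor_algebra_ext:
  assumes "linear_map (tensor_algebra V) Z f" "linear_map (tensor_algebra V) Z g"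
    and "is_space V" "is_space Z"
    and "\<And>xs. xs \<in> lists (vcarrier V) \<Longrightarrow> f (word V xs) = g (word V xs)"
    and "t \<in> vcarrier (tensor_algebra V)"
  shows "f t = g t"
  by (rule quotient_free_ext[OF subspace_word_rel word_rel_sub[OF assms(3)]])
    (use assms in \<open>auto simp: tensor_algebra_def word_def\<close>)

lemma lin_ext_word:
  assumes Z: "is_space Z" and \<phi>: "word_linear V Z \<phi>"
  shows "lin_ext Z \<phi> (word V xs) = \<phi> xs"
proof -
  note l = lin_ext_total_linear[OF Z, of \<phi>]
    and g = lin_ext_gen[OF is_space_vector_space[OF Z], of \<phi>]
  have "lin_ext Z \<phi> (word V xs) = lin_ext Z \<phi> (gen xs)"
    unfolding word_def
  proof (rule lin_ext_quotient_map[OF Z word_rel_def], elim UnE CollectE exE conjE, goal_cases)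
    case (1 r xs v v' ys)
    then show ?case
      using \<phi> linear_map_add[of V Z "\<lambda>v. \<phi> (xs @ [v] @ ys)" v v']
      by (simp add: l g word_linear_def del: append_Cons)
  next
    case (2 r a xs v ys)
    then show ?case
      using \<phi> linear_map_scale[of V Z "\<lambda>v. \<phi> (xs @ [v] @ ys)" v a]
      by (simp add: l g word_linear_def del: append_Cons)
  qed
  then show ?thesis by (simp add: g)
qed

lemma lin_ext_linear_map:
  assumes "is_space V" "is_space Z" "\<And>xs. xs \<in> lists (vcarrier V) \<Longrightarrow> \<phi> xs \<in> vcarrier Z"
  shows "linear_map (tensor_algebra V) Z (lin_ext Z \<phi>)"
proof (rule linear_mapI)
  show "lin_ext Z \<phi> t \<in> vcarrier Z" if "t \<in> vcarrier (tensor_algebra V)" for t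
    by (rule lin_ext_mem[OF assms(2)])
      (rule assms(3)[OF subsetD[OF tensor_algebra_keys[OF assms(1) that]]])
qed (simp_all add: lin_ext_total_linear[OF assms(2)])

lemma word_linear_word:
  fixes V :: "('k::field, 'v::ab_group_add, 'y) space_scheme"
  shows "word_linear V (tensor_algebra V) (word V)"
proof (rule word_linearI)
  interpret F: vector_space "free_scale :: 'k \<Rightarrow> ('v list \<Rightarrow>\<^sub>0 'k) \<Rightarrow> _"
    by (rule vector_space_free_scale)
  interpret q: Vector_Spaces.linear free_scale free_scale "quotient_map free_scale (word_rel V)"
    by (rule linear_quotient_map[OF vector_space_free_scale subspace_word_rel])
  note eq = quotient_map_eq_iff[OF vector_space_free_scale subspace_word_rel]
  fix xs ys :: "'v list" and v v' and a :: 'k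
  assume xs: "xs \<in> lists (vcarrier V)" "ys \<in> lists (vcarrier V)" "v \<in> vcarrier V"
  show "word V (xs @ [vscale V a v] @ ys) = vscale (tensor_algebra V) a (word V (xs @ [v] @ ys))"
    unfolding word_def vscale_tensor_algebra q.scale[symmetric] eq unfolding word_rel_def
    by (intro F.span_base UnI2 CollectI exI[of _ a] exI[of _ xs] exI[of _ v] exI[of _ ys])
      (use xs in auto)
  assume "v' \<in> vcarrier V"
  then show "word V (xs @ [v + v'] @ ys) = word V (xs @ [v] @ ys) + word V (xs @ [v'] @ ys)"
    unfolding word_def q.add[symmetric] eq unfolding word_rel_def
    by (intro F.span_base UnI1 CollectI exI[of _ xs] exI[of _ v] exI[of _ v'] exI[of _ ys])
      (use xs in \<open>auto simp: diff_diff_eq\<close>)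
qed (rule word_mem)

lemma word_linear_append:
  assumes "word_linear V Z \<phi>" "zs \<in> lists (vcarrier V)"
  shows "word_linear V Z (\<lambda>xs. \<phi> (xs @ zs))" "word_linear V Z (\<lambda>xs. \<phi> (zs @ xs))"
proof -
  have 1: "linear_map V Z (\<lambda>v. \<phi> (xs @ [v] @ (ys @ zs)))" "linear_map V Z (\<lambda>v. \<phi> ((zs @ xs) @ [v] @ ys))"
    if "xs \<in> lists (vcarrier V)" "ys \<in> lists (vcarrier V)" for xs ys
    using assms that unfolding word_linear_def by (metis append_in_lists_conv)+
  show "word_linear V Z (\<lambda>xs. \<phi> (xs @ zs))" "word_linear V Z (\<lambda>xs. \<phi> (zs @ xs))"
    using assms 1 by (simp_all add: word_linear_def)
qed

text \<open>Serves the nested extension in \<open>word_mult\<close>: the inner sum runs over words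
  with letters in \<open>V\<close>, and a linear combination of letterwise linear functions is
  letterwise linear.\<close>

lemma word_linear_lin_ext:
  assumes V: "is_space V" and Z: "is_space Z" and t: "t \<in> vcarrier (tensor_algebra V)"
    and \<phi>: "\<And>ys. ys \<in> lists (vcarrier V) \<Longrightarrow> word_linear V Z (\<lambda>xs. \<phi> xs ys)"
  shows "word_linear V Z (\<lambda>xs. lin_ext Z (\<phi> xs) t)"
proof -
  interpret vector_space "vscale Z" using Z by (rule is_space_vector_space)
  note k = subsetD[OF tensor_algebra_keys[OF V t]]
  have \<phi>1: "\<phi> xs ys \<in> vcarrier Z" if "xs \<in> lists (vcarrier V)" "ys \<in> lists (vcarrier V)" for xs ys
    using \<phi> that by (simp add: word_linear_def)
  have \<phi>2: "linear_map V Z (\<lambda>v. \<phi> (xs @ [v] @ xs') ys)"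
    if "xs \<in> lists (vcarrier V)" "xs' \<in> lists (vcarrier V)" "ys \<in> lists (vcarrier V)" for xs xs' ys
    using \<phi> that by (simp add: word_linear_def)
  show ?thesis
  proof (rule word_linearI)
    show "lin_ext Z (\<phi> xs) t \<in> vcarrier Z" if "xs \<in> lists (vcarrier V)" for xs
      by (rule lin_ext_mem[OF Z]) (rule \<phi>1[OF that k])
    show "lin_ext Z (\<phi> (xs @ [v + v'] @ ys)) t =
        lin_ext Z (\<phi> (xs @ [v] @ ys)) t + lin_ext Z (\<phi> (xs @ [v'] @ ys)) t"
      if "xs \<in> lists (vcarrier V)" "ys \<in> lists (vcarrier V)" "v \<in> vcarrier V" "v' \<in> vcarrier V"
      for xs ys v v'
      using linear_map_add[OF \<phi>2[OF that(1,2) k] that(3,4)]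
      by (simp add: lin_ext_def sum.distrib scale_right_distrib)
    show "lin_ext Z (\<phi> (xs @ [vscale V a v] @ ys)) t = vscale Z a (lin_ext Z (\<phi> (xs @ [v] @ ys)) t)"
      if "xs \<in> lists (vcarrier V)" "ys \<in> lists (vcarrier V)" "v \<in> vcarrier V" for xs ys v a
      using linear_map_scale[OF \<phi>2[OF that(1,2) k] that(3)]
      by (simp add: lin_ext_def scale_sum_right mult.commute)
  qed
qed

lemma word_mult_word:
  assumes "is_space V" "xs \<in> lists (vcarrier V)" "ys \<in> lists (vcarrier V)"
  shows "word_mult V (word V xs) (word V ys) = word V (xs @ ys)"
proof -
  let ?T = "tensor_algebra V"
  note T = is_space_tensor_algebra[of V]
  have "word_mult V (word V xs) (word V ys) = lin_ext ?T (\<lambda>zs. word V (xs @ zs)) (word V ys)"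
    unfolding word_mult_def
    by (intro lin_ext_word[OF T] word_linear_lin_ext assms(1) T word_mem assms(3)
        word_linear_append word_linear_word)
  also have "\<dots> = word V (xs @ ys)"
    by (intro lin_ext_word[OF T] word_linear_append word_linear_word assms(2))
  finally show ?thesis .
qed

lemma word_mult_bilinear:
  assumes V: "is_space V"
  shows "bilinear_map (tensor_algebra V) (tensor_algebra V) (tensor_algebra V) (word_mult V)"
proof (rule bilinear_mapI)
  let ?T = "tensor_algebra V"
  note T = is_space_tensor_algebra[of V]
  interpret vector_space "free_scale :: 'a \<Rightarrow> ('b list \<Rightarrow>\<^sub>0 'a) \<Rightarrow> _"
    by (rule vector_space_free_scale)
  have l: "linear_map ?T ?T (lin_ext ?T (\<lambda>ys. word V (xs @ ys)))" if "xs \<in> lists (vcarrier V)" for xs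
    by (rule lin_ext_linear_map[OF V T]) (use that in \<open>simp add: word_mem\<close>)
  fix t assume t: "t \<in> vcarrier ?T"
  note k = subsetD[OF tensor_algebra_keys[OF V t]]
  show "linear_map ?T ?T (\<lambda>s. word_mult V s t)"
    unfolding word_mult_def by (rule lin_ext_linear_map[OF V T]) (rule linear_map_mem[OF l t])
  show "linear_map ?T ?T (word_mult V t)"
  proof (rule linear_mapI)
    show "word_mult V t s \<in> vcarrier ?T" if "s \<in> vcarrier ?T" for s
      unfolding word_mult_def by (rule lin_ext_mem[OF T]) (rule linear_map_mem[OF l[OF k] that])
    show "word_mult V t (x + y) = word_mult V t x + word_mult V t y" for x y
      by (simp add: word_mult_def lin_ext_total_linear[OF T] lin_ext_def[of _ _ t]
        sum.distrib scale_right_distrib)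
    show "word_mult V t (vscale ?T c x) = vscale ?T c (word_mult V t x)" for c x
      by (simp add: word_mult_def lin_ext_total_linear(3)[OF T] lin_ext_def[of _ _ t]
        scale_sum_right mult.commute)
  qed
qed

lemma is_algebra_tensor_algebra:
  assumes V: "is_space V"
  shows "is_algebra (tensor_algebra V) (word_mult V) (word V [])"
proof -
  let ?T = "tensor_algebra V" and ?m = "word_mult V"
  note T = is_space_tensor_algebra[of V] and bil = word_mult_bilinear[OF V]
  note L = bilinear_map_compose_left[OF bil] bilinear_map_compose_right[OF bil]
    bilinear_map_mem[OF bil] linear_map_ident word_mem
  have "?m (?m x y) z = ?m x (?m y z)"
    if x: "x \<in> vcarrier ?T" and y: "y \<in> vcarrier ?T" and z: "z \<in> vcarrier ?T" for x y z
  proof (rule tensor_algebra_ext[OF _ _ V T _ x])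
    fix xs assume xs: "xs \<in> lists (vcarrier V)"
    show "?m (?m (word V xs) y) z = ?m (word V xs) (?m y z)"
    proof (rule tensor_algebra_ext[OF _ _ V T _ y])
      fix ys assume ys: "ys \<in> lists (vcarrier V)"
      show "?m (?m (word V xs) (word V ys)) z = ?m (word V xs) (?m (word V ys) z)"
        by (rule tensor_algebra_ext[OF _ _ V T _ z])
          (insert xs ys, (rule L | assumption | simp add: word_mult_word V)+)
    qed (insert xs z, (rule L | assumption)+)
  qed (insert y z, (rule L | assumption)+)
  moreover have "?m (word V []) x = x" if x: "x \<in> vcarrier ?T" for x
    by (rule tensor_algebra_ext[OF _ _ V T _ x]) (rule L | simp add: word_mult_word V)+
  moreover have "?m x (word V []) = x" if x: "x \<in> vcarrier ?T" for x
    by (rule tensor_algebra_ext[OF _ _ V T _ x]) (rule L | simp add: word_mult_word V)+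
  ultimately show ?thesis
    unfolding is_algebra_def using T bil word_mem[of "[]" V] by auto
qed

lemma word_Cons:
  "is_space V \<Longrightarrow> x \<in> vcarrier V \<Longrightarrow> xs \<in> lists (vcarrier V)
    \<Longrightarrow> word V (x # xs) = word_mult V (word V [x]) (word V xs)"
  by (simp add: word_mult_word)

text \<open>Universal property of the tensor algebra. Multiplicativity reduces to two words, where
  folding the concatenation means folding the first word onto the value of the second.\<close>

lemma is_algebra_map_algebra_ext:
  assumes V: "is_space V" and A: "is_algebra A m e" and g: "linear_map V A g"
  shows "is_algebra_map (tensor_algebra V) (word_mult V) (word V []) A m e (algebra_ext A m e g)"
    and "x \<in> vcarrier V \<Longrightarrow> algebra_ext A m e g (word V [x]) = g x"
proof -
  note a = is_algebraD[OF A] and t = is_algebraD[OF is_algebra_tensor_algebra[OF V]]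
  let ?T = "tensor_algebra V" and ?\<phi> = "\<lambda>xs. foldr (\<lambda>x. m (g x)) xs e" and ?h = "algebra_ext A m e g"
  note gm = linear_map_mem[OF g]
  have m1: "foldr (\<lambda>x. m (g x)) xs y \<in> vcarrier A" if "xs \<in> lists (vcarrier V)" "y \<in> vcarrier A" for xs y
    using that by (induction xs) (auto intro: a(7) gm)
  have "linear_map A A (foldr (\<lambda>x. m (g x)) xs)" if "xs \<in> lists (vcarrier V)" for xs
    using that
  proof (induction xs)
    case (Cons x xs)
    then show ?case
      using bilinear_map_compose_right[OF a(2), of A "foldr (\<lambda>x. m (g x)) xs"] gm by (simp add: o_def)
  qed (simp add: id_def linear_map_ident)
  from linear_map_compose[OF this bilinear_map_compose_left[OF a(2) g m1[OF _ a(3)]]]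
  have wl: "word_linear V A ?\<phi>"
    unfolding word_linear_def using m1[OF _ a(3)] by simp
  have hw: "?h (word V xs) = ?\<phi> xs" for xs
    unfolding algebra_ext_def by (rule lin_ext_word[OF a(1) wl])
  have lin: "linear_map ?T A ?h"
    unfolding algebra_ext_def by (rule lin_ext_linear_map[OF V a(1)]) (rule m1[OF _ a(3)])
  have fold: "foldr (\<lambda>x. m (g x)) xs y = m (?\<phi> xs) y" if "xs \<in> lists (vcarrier V)" "y \<in> vcarrier A" for xs y
    using that by (induction xs) (auto simp: a gm m1)
  note L = bilinear_map_compose_left[OF t(2)] bilinear_map_compose_right[OF t(2)]
    bilinear_map_compose_left[OF a(2)] bilinear_map_compose_right[OF a(2)]
    linear_map_ident word_mem linear_map_compose[OF lin] linear_map_mem[OF lin]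
  have "?h (word_mult V x y) = m (?h x) (?h y)" if x: "x \<in> vcarrier ?T" and y: "y \<in> vcarrier ?T" for x y
  proof (rule tensor_algebra_ext[OF _ _ V a(1) _ x])
    fix xs assume xs: "xs \<in> lists (vcarrier V)"
    show "?h (word_mult V (word V xs) y) = m (?h (word V xs)) (?h y)"
    proof (rule tensor_algebra_ext[OF _ _ V a(1) _ y])
      fix ys assume ys: "ys \<in> lists (vcarrier V)"
      show "?h (word_mult V (word V xs) (word V ys)) = m (?h (word V xs)) (?h (word V ys))"
        using xs ys fold[OF xs m1[OF ys a(3)]] by (simp add: word_mult_word V hw)
    qed (insert xs, (rule L | assumption)+)
  qed (insert y, (rule L | assumption)+)
  then show "is_algebra_map ?T (word_mult V) (word V []) A m e ?h"
    using lin by (simp add: is_algebra_map_def hw)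
  show "?h (word V [x]) = g x" if "x \<in> vcarrier V"
    using that by (simp add: hw a gm)
qed

text \<open>Complements \<open>tensor_algebra_ext\<close> by allowing arbitrary predicates, in
  particular universally quantified ones; induction over the enveloping algebra rests on it.\<close>

lemma tensor_algebra_induct [consumes 2, case_names word add scale]:
  assumes V: "is_space V" and t: "t \<in> vcarrier (tensor_algebra V)"
    and word: "\<And>xs. xs \<in> lists (vcarrier V) \<Longrightarrow> Q (word V xs)"
    and add: "\<And>s t. s \<in> vcarrier (tensor_algebra V) \<Longrightarrow> t \<in> vcarrier (tensor_algebra V)
      \<Longrightarrow> Q s \<Longrightarrow> Q t \<Longrightarrow> Q (s + t)"
    and scale: "\<And>a t. t \<in> vcarrier (tensor_algebra V) \<Longrightarrow> Q t \<Longrightarrow> Q (free_scale a t)"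
  shows "Q t"
proof -
  let ?T = "tensor_algebra V"
  note T = is_space_tensor_algebra[of V]
  have w: "word V = (\<lambda>xs. quotient_map free_scale (word_rel V) (gen xs))"
    by (simp add: word_def fun_eq_iff)
  have "t = lin_ext ?T (word V) t"
    unfolding w
    by (rule quotient_free_expand[OF subspace_word_rel word_rel_sub[OF V] t[unfolded tensor_algebra_def]
          vscale_tensor_algebra])
  also have "\<dots> = (\<Sum>xs\<in>Poly_Mapping.keys t. free_scale (Poly_Mapping.lookup t xs) (word V xs))"
    by (simp add: lin_ext_def)
  finally have t_eq: "t = \<dots>" .
  \<comment> \<open>The empty sum is obtained as 0 times the empty word, so the induction rule gets
    by without a case for 0.\<close>
  have "Q 0" using scale[OF word_mem[of "[]"] word[of "[]"], of 0] scale_zero_left_space[OF T] by simp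
  have "A \<subseteq> lists (vcarrier V) \<Longrightarrow> (\<Sum>xs\<in>A. free_scale (f xs) (word V xs)) \<in> vcarrier ?T \<and>
      Q (\<Sum>xs\<in>A. free_scale (f xs) (word V xs))" for A f
  proof (induction A rule: infinite_finite_induct)
    case (insert x A)
    have "free_scale (f x) (word V x) \<in> vcarrier ?T"
      using is_space_scale[OF T word_mem[of x V], of "f x"] insert by simp
    then show ?case
      using insert by (simp add: add scale word word_mem is_space_add[OF T])
  qed (simp_all add: is_space_zero[OF T] \<open>Q 0\<close>)
  then show ?thesis using tensor_algebra_keys[OF V t] t_eq by metis
qed

section \<open>Sweedler calculus in coalgebras\<close>

text \<open>This lemma and the next turn the two sides of a coassociativity axiom into iterated
  Sweedler sums of pure tensors.\<close>

lemma tensor_assoc_map_sweedler: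
  assumes s: "is_space X" "is_space A" "is_space B" "is_space D"
    and p: "linear_map X (A \<otimes>\<^sub>k B) p" and t: "t \<in> vcarrier (X \<otimes>\<^sub>k D)"
  shows "tensor_assoc A B D (tensor_map (A \<otimes>\<^sub>k B) D p id t) =
    sweedler X D (A \<otimes>\<^sub>k (B \<otimes>\<^sub>k D)) (\<lambda>x d.
      sweedler A B (A \<otimes>\<^sub>k (B \<otimes>\<^sub>k D)) (\<lambda>a b. tens A (B \<otimes>\<^sub>k D) a (tens B D b d)) (p x)) t"
proof -
  let ?Z = "A \<otimes>\<^sub>k (B \<otimes>\<^sub>k D)"
  note [multilin] = linear_map_mem[OF p]
  have m: "tensor_map (A \<otimes>\<^sub>k B) D p id t \<in> vcarrier ((A \<otimes>\<^sub>k B) \<otimes>\<^sub>k D)"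
    unfolding tensor_map_sweedler[OF s(1,4) t] id_apply by (rule multilin | assumption)+
  have b: "bilinear_map (A \<otimes>\<^sub>k B) D ?Z (\<lambda>s w. sweedler A B ?Z (\<lambda>u v. tens A (B \<otimes>\<^sub>k D) u (tens B D v w)) s)"
    by (rule multilin | assumption)+
  show ?thesis
    unfolding tensor_assoc_sweedler[OF s(2-4) m] unfolding tensor_map_sweedler[OF s(1,4) t]
    by (simp add: sweedler_sweedler[OF is_space_tensor] sweedler_tens[OF is_space_tensor s(4) is_space_tensor b]
        linear_map_mem[OF p])
qed

lemma tensor_map_id_sweedler:
  assumes s: "is_space Y" "is_space A" "is_space B" "is_space D"
    and q: "linear_map Y (B \<otimes>\<^sub>k D) q" and t: "t \<in> vcarrier (A \<otimes>\<^sub>k Y)"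
  shows "tensor_map A (B \<otimes>\<^sub>k D) id q t =
    sweedler A Y (A \<otimes>\<^sub>k (B \<otimes>\<^sub>k D)) (\<lambda>a y.
      sweedler B D (A \<otimes>\<^sub>k (B \<otimes>\<^sub>k D)) (\<lambda>b d. tens A (B \<otimes>\<^sub>k D) a (tens B D b d)) (q y)) t"
proof -
  have "sweedler B D (A \<otimes>\<^sub>k (B \<otimes>\<^sub>k D)) (\<lambda>b d. tens A (B \<otimes>\<^sub>k D) a (tens B D b d)) r = tens A (B \<otimes>\<^sub>k D) a r"
    if "a \<in> vcarrier A" "r \<in> vcarrier (B \<otimes>\<^sub>k D)" for a r
    using sweedler_push[OF bilinear_map_right[OF bilinear_tens[of A "B \<otimes>\<^sub>k D"] that(1)] is_space_tensor is_space_tensor,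
        where t = r and F = "tens B D" and V = B and W = D]
    by (simp add: sweedler_eta[OF s(3,4) that(2)] tens_in_tensor)
  then show ?thesis
    by (simp add: tensor_map_sweedler[OF s(2,1) t] linear_map_mem[OF q])
qed

text \<open>The spaces are kept distinct so that the lemma covers both coproducts (all spaces equal)
  and right comodules (\<open>X\<close> and \<open>A\<close> the comodule, the other three the
  coalgebra).\<close>

lemma coassoc_sweedler:
  assumes s: "is_space X" "is_space Y" "is_space A" "is_space B" "is_space D" "is_space Z"
    and p: "linear_map X (A \<otimes>\<^sub>k B) p" and t: "t \<in> vcarrier (X \<otimes>\<^sub>k D)"
    and q: "linear_map Y (B \<otimes>\<^sub>k D) q" and t': "t' \<in> vcarrier (A \<otimes>\<^sub>k Y)"
    and eq: "tensor_assoc A B D (tensor_map (A \<otimes>\<^sub>k B) D p id t) = tensor_map A (B \<otimes>\<^sub>k D) id q t'"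
    and F1: "\<And>b d. b \<in> vcarrier B \<Longrightarrow> d \<in> vcarrier D \<Longrightarrow> linear_map A Z (\<lambda>a. F a b d)"
    and F2: "\<And>a d. a \<in> vcarrier A \<Longrightarrow> d \<in> vcarrier D \<Longrightarrow> linear_map B Z (\<lambda>b. F a b d)"
    and F3: "\<And>a b. a \<in> vcarrier A \<Longrightarrow> b \<in> vcarrier B \<Longrightarrow> linear_map D Z (F a b)"
  shows "sweedler X D Z (\<lambda>x d. sweedler A B Z (\<lambda>a b. F a b d) (p x)) t =
    sweedler A Y Z (\<lambda>a y. sweedler B D Z (\<lambda>b d. F a b d) (q y)) t'"
proof -
  let ?G = "\<lambda>a r. sweedler B D Z (\<lambda>b d. F a b d) r"
  \<comment> \<open>The linear map on \<open>A \<otimes> (B \<otimes> D)\<close> induced by the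
    trilinear \<open>F\<close>. Applying it to both sides of \<open>eq\<close> gives the
    claim.\<close>
  let ?H = "sweedler A (B \<otimes>\<^sub>k D) Z ?G"
  have 1: "bilinear_map A (B \<otimes>\<^sub>k D) Z ?G"
    by (rule multilin s F1 F2 F3 linear_map_mem[OF F1] | assumption)+
  have 2: "bilinear_map B D Z (F a)" if "a \<in> vcarrier A" for a
    by (insert that, (rule bilinear_mapI F2 F3 | assumption)+)
  have H: "?H (tens A (B \<otimes>\<^sub>k D) a (tens B D b d)) = F a b d"
    if "a \<in> vcarrier A" "b \<in> vcarrier B" "d \<in> vcarrier D" for a b d
    using that by (simp add: sweedler_tens[OF s(3) is_space_tensor s(6) 1] tens_in_tensor
        sweedler_tens[OF s(4,5,6) 2])
  have "?H (tensor_assoc A B D (tensor_map (A \<otimes>\<^sub>k B) D p id t)) = ?H (tensor_map A (B \<otimes>\<^sub>k D) id q t')"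
    unfolding eq ..
  then show ?thesis
    unfolding tensor_assoc_map_sweedler[OF s(1,3,4,5) p t] tensor_map_id_sweedler[OF s(2-5) q t']
    by (simp add: sweedler_sweedler[OF s(6)] H)
qed

lemma is_coalgebraD:
  assumes "is_coalgebra C"
  shows "is_space C" "linear_map C (C \<otimes>\<^sub>k C) (cop C)" "linear_map C ground (counit C)"
  using assms by (simp_all add: is_coalgebra_def)

lemma cop_coassoc:
  assumes C: "is_coalgebra C" and x: "x \<in> vcarrier C" and Z: "is_space Z"
    and F: "\<And>b d. b \<in> vcarrier C \<Longrightarrow> d \<in> vcarrier C \<Longrightarrow> linear_map C Z (\<lambda>a. F a b d)"
      "\<And>a d. a \<in> vcarrier C \<Longrightarrow> d \<in> vcarrier C \<Longrightarrow> linear_map C Z (\<lambda>b. F a b d)"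
      "\<And>a b. a \<in> vcarrier C \<Longrightarrow> b \<in> vcarrier C \<Longrightarrow> linear_map C Z (\<lambda>d. F a b d)"
  shows "sweedler C C Z (\<lambda>a b. sweedler C C Z (\<lambda>c d. F c d b) (cop C a)) (cop C x) =
    sweedler C C Z (\<lambda>a b. sweedler C C Z (\<lambda>c d. F a c d) (cop C b)) (cop C x)"
proof -
  note c = is_coalgebraD[OF C] and m = linear_map_mem[OF is_coalgebraD(2)[OF C] x]
  show ?thesis
    by (rule coassoc_sweedler[OF c(1) c(1) c(1) c(1) c(1) Z c(2) m c(2) m _ F])
      (use C x in \<open>simp_all add: is_coalgebra_def\<close>)
qed

lemma cop_counit:
  assumes C: "is_coalgebra C" and x: "x \<in> vcarrier C" and Z: "is_space Z" and g: "linear_map C Z g"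
  shows "sweedler C C Z (\<lambda>a b. vscale Z (counit C a) (g b)) (cop C x) = g x"
    and "sweedler C C Z (\<lambda>a b. vscale Z (counit C b) (g a)) (cop C x) = g x"
proof -
  note c = is_coalgebraD[OF C] and m = linear_map_mem[OF is_coalgebraD(2)[OF C] x]
  have 1: "sweedler C C C (\<lambda>a b. vscale C (counit C a) b) (cop C x) = x"
    "sweedler C C C (\<lambda>a b. vscale C (counit C b) a) (cop C x) = x"
    using C x unfolding tensor_lift_sweedler[OF c(1) c(1) m, symmetric] by (simp_all add: is_coalgebra_def)
  have "g (sweedler C C C (\<lambda>a b. vscale C (counit C a) b) (cop C x)) =
      sweedler C C Z (\<lambda>a b. vscale Z (counit C a) (g b)) (cop C x)"
    "g (sweedler C C C (\<lambda>a b. vscale C (counit C b) a) (cop C x)) =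
      sweedler C C Z (\<lambda>a b. vscale Z (counit C b) (g a)) (cop C x)"
    by (simp_all add: sweedler_push[OF g c(1) Z] is_space_scale[OF c(1)] linear_map_scale[OF g])
  then show "sweedler C C Z (\<lambda>a b. vscale Z (counit C a) (g b)) (cop C x) = g x"
    and "sweedler C C Z (\<lambda>a b. vscale Z (counit C b) (g a)) (cop C x) = g x"
    by (simp_all add: 1)
qed

lemma cop_cocommutative:
  assumes C: "is_coalgebra C" "cocommutative C" and x: "x \<in> vcarrier C" and Z: "is_space Z"
    and F: "bilinear_map C C Z F"
  shows "sweedler C C Z F (cop C x) = sweedler C C Z (\<lambda>a b. F b a) (cop C x)"
proof -
  note c = is_coalgebraD[OF C(1)] and m = linear_map_mem[OF is_coalgebraD(2)[OF C(1)] x]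
  have "cop C x = sweedler C C (C \<otimes>\<^sub>k C) (\<lambda>v w. tens C C w v) (cop C x)"
    using C(2) x unfolding tensor_swap_sweedler[OF c(1) c(1) m, symmetric] by (simp add: cocommutative_def)
  then have "sweedler C C Z F (cop C x) =
    sweedler C C Z F (sweedler C C (C \<otimes>\<^sub>k C) (\<lambda>v w. tens C C w v) (cop C x))"
    by simp
  also have "\<dots> = sweedler C C Z (\<lambda>a b. F b a) (cop C x)"
    by (simp add: sweedler_sweedler[OF Z] sweedler_tens[OF c(1) c(1) Z F])
  finally show ?thesis .
qed

text \<open>The four legs are bracketed as (12)(34). Rebracketed as 1((23)4), the inner pair is a
  coproduct of its own, to which cocommutativity applies; then the brackets are restored.\<close>

lemma cop_middle_swap:
  assumes C: "is_coalgebra C" "cocommutative C" and x: "x \<in> vcarrier C" and Z: "is_space Z"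
    and F: "\<And>b c d. b \<in> vcarrier C \<Longrightarrow> c \<in> vcarrier C \<Longrightarrow> d \<in> vcarrier C \<Longrightarrow> linear_map C Z (\<lambda>a. F a b c d)"
      "\<And>a c d. a \<in> vcarrier C \<Longrightarrow> c \<in> vcarrier C \<Longrightarrow> d \<in> vcarrier C \<Longrightarrow> linear_map C Z (\<lambda>b. F a b c d)"
      "\<And>a b d. a \<in> vcarrier C \<Longrightarrow> b \<in> vcarrier C \<Longrightarrow> d \<in> vcarrier C \<Longrightarrow> linear_map C Z (\<lambda>c. F a b c d)"
      "\<And>a b c. a \<in> vcarrier C \<Longrightarrow> b \<in> vcarrier C \<Longrightarrow> c \<in> vcarrier C \<Longrightarrow> linear_map C Z (\<lambda>d. F a b c d)"
  shows "sweedler C C Z (\<lambda>a b. sweedler C C Z (\<lambda>a1 a2.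
      sweedler C C Z (\<lambda>b1 b2. F a1 a2 b1 b2) (cop C b)) (cop C a)) (cop C x) =
    sweedler C C Z (\<lambda>a b. sweedler C C Z (\<lambda>a1 a2.
      sweedler C C Z (\<lambda>b1 b2. F a1 b1 a2 b2) (cop C b)) (cop C a)) (cop C x)"
proof -
  note c = is_coalgebraD[OF C(1)]
  note [multilin] = Z F linear_map_mem[OF F(1)] linear_map_compose[OF c(2)]
  \<comment> \<open>The rebracketing for a general \<open>G\<close>: it is used for \<open>F\<close>
    and for \<open>F\<close> with its two middle arguments exchanged.\<close>
  have core: "sweedler C C Z (\<lambda>a b. sweedler C C Z (\<lambda>a1 a2.
      sweedler C C Z (\<lambda>b1 b2. G a1 a2 b1 b2) (cop C b)) (cop C a)) (cop C x) =
    sweedler C C Z (\<lambda>a b. sweedler C C Z (\<lambda>e d. sweedler C C Z (\<lambda>c1 c2. G a c1 c2 d) (cop C e)) (cop C b)) (cop C x)"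
    if [multilin]: "\<And>b c d. b \<in> vcarrier C \<Longrightarrow> c \<in> vcarrier C \<Longrightarrow> d \<in> vcarrier C \<Longrightarrow> linear_map C Z (\<lambda>a. G a b c d)"
      "\<And>a c d. a \<in> vcarrier C \<Longrightarrow> c \<in> vcarrier C \<Longrightarrow> d \<in> vcarrier C \<Longrightarrow> linear_map C Z (\<lambda>b. G a b c d)"
      "\<And>a b d. a \<in> vcarrier C \<Longrightarrow> b \<in> vcarrier C \<Longrightarrow> d \<in> vcarrier C \<Longrightarrow> linear_map C Z (\<lambda>c. G a b c d)"
      "\<And>a b c. a \<in> vcarrier C \<Longrightarrow> b \<in> vcarrier C \<Longrightarrow> c \<in> vcarrier C \<Longrightarrow> linear_map C Z (\<lambda>d. G a b c d)"
    for G
  proof -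
    note [multilin] = linear_map_mem[OF that(1)]
    have "sweedler C C Z (\<lambda>a b. sweedler C C Z (\<lambda>a1 a2.
        sweedler C C Z (\<lambda>b1 b2. G a1 a2 b1 b2) (cop C b)) (cop C a)) (cop C x) =
      sweedler C C Z (\<lambda>a b. sweedler C C Z (\<lambda>e d.
        sweedler C C Z (\<lambda>b1 b2. G a e b1 b2) (cop C d)) (cop C b)) (cop C x)"
      by (rule cop_coassoc[OF C(1) x Z]) (rule multilin | assumption)+
    also have "\<dots> = sweedler C C Z (\<lambda>a b. sweedler C C Z (\<lambda>e d. sweedler C C Z (\<lambda>c1 c2. G a c1 c2 d) (cop C e)) (cop C b)) (cop C x)"
      by (rule sweedler_cong[OF refl], rule cop_coassoc[OF C(1) _ Z, symmetric])
        (rule multilin | assumption)+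
    finally show ?thesis .
  qed
  have "sweedler C C Z (\<lambda>a b. sweedler C C Z (\<lambda>e d. sweedler C C Z (\<lambda>c1 c2. F a c1 c2 d) (cop C e)) (cop C b)) (cop C x) =
    sweedler C C Z (\<lambda>a b. sweedler C C Z (\<lambda>e d. sweedler C C Z (\<lambda>c1 c2. F a c2 c1 d) (cop C e)) (cop C b)) (cop C x)"
    by (rule sweedler_cong[OF refl], rule sweedler_cong[OF refl], rule cop_cocommutative[OF C _ Z])
      (rule multilin | assumption)+
  moreover have "sweedler C C Z (\<lambda>a b. sweedler C C Z (\<lambda>a1 a2.
        sweedler C C Z (\<lambda>b1 b2. F a1 a2 b1 b2) (cop C b)) (cop C a)) (cop C x) =
      sweedler C C Z (\<lambda>a b. sweedler C C Z (\<lambda>e d. sweedler C C Z (\<lambda>c1 c2. F a c1 c2 d) (cop C e)) (cop C b)) (cop C x)"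
    by (rule core) (rule F | assumption)+
  moreover have "sweedler C C Z (\<lambda>a b. sweedler C C Z (\<lambda>a1 a2.
        sweedler C C Z (\<lambda>b1 b2. F a1 b1 a2 b2) (cop C b)) (cop C a)) (cop C x) =
      sweedler C C Z (\<lambda>a b. sweedler C C Z (\<lambda>e d. sweedler C C Z (\<lambda>c1 c2. F a c2 c1 d) (cop C e)) (cop C b)) (cop C x)"
    by (rule core[of "\<lambda>a b c d. F a c b d"]) (rule F | assumption)+
  ultimately show ?thesis by (simp only:)
qed

lemma bilinear_sweedler:
  assumes m: "bilinear_map A B Z m" and s: "is_space A" "is_space B" "is_space Z"
    and f: "\<And>v w. v \<in> vcarrier V \<Longrightarrow> w \<in> vcarrier W \<Longrightarrow> f v w \<in> vcarrier A"
    and g: "\<And>v w. v \<in> vcarrier V' \<Longrightarrow> w \<in> vcarrier W' \<Longrightarrow> g v w \<in> vcarrier B"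
  shows "m (sweedler V W A f t) (sweedler V' W' B g t') =
    sweedler V W Z (\<lambda>v w. sweedler V' W' Z (\<lambda>v' w'. m (f v w) (g v' w')) t') t"
  by (subst sweedler_push[OF bilinear_map_left[OF m] s(1,3) f])
    (simp_all add: sweedler_push[OF bilinear_map_right[OF m] s(2,3)] sweedler_mem[OF s(2)] f g)

text \<open>Here \<open>t\<close> stands for the coproduct of \<open>m x y\<close>. Leaving the
  product general lets the lemma serve the rack product as well as the products of \<open>U\<close>
  and of an abstract bialgebra.\<close>

lemma cop_mult_sweedler:
  assumes C: "is_coalgebra C" and D: "is_coalgebra D" and B: "is_space B" and Z: "is_space Z"
    and m: "bilinear_map C D B m" and x: "x \<in> vcarrier C" "y \<in> vcarrier D"
    and eq: "t = tensor_op B B m m (cop C x) (cop D y)"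
    and F: "bilinear_map B B Z F"
  shows "sweedler B B Z F t = sweedler C C Z (\<lambda>x1 x2. sweedler D D Z (\<lambda>y1 y2. F (m x1 y1) (m x2 y2)) (cop D y)) (cop C x)"
proof -
  note c = is_coalgebraD[OF C] and d = is_coalgebraD[OF D]
  show ?thesis
    unfolding eq
    unfolding tensor_op_sweedler[OF c(1) c(1) linear_map_mem[OF c(2) x(1)] d(1) d(1) linear_map_mem[OF d(2) x(2)]]
    by (simp add: sweedler_sweedler[OF Z] sweedler_tens[OF B B Z F] bilinear_map_mem[OF m])
qed

section \<open>The universal enveloping algebra\<close>

locale cocommutative_rack_bialgebra =
  fixes C :: "('k::field, 'c::ab_group_add) rack_bialgebra"
  assumes rack_bialgebra: "is_rack_bialgebra C" and cocommutative: "cocommutative C"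
begin

abbreviation "V \<equiv> ker_counit C"
abbreviation "T \<equiv> tensor_algebra V"
abbreviation "mT \<equiv> word_mult V"
abbreviation "eT \<equiv> word V []"
abbreviation "i \<equiv> incl C"
abbreviation "SC \<equiv> sweedler C C"
abbreviation "J \<equiv> U_ideal C"
abbreviation "p \<equiv> U_proj C"
abbreviation "U \<equiv> U_bialg C"
abbreviation "mU \<equiv> bmult U"
abbreviation "eU \<equiv> bone U"
abbreviation "q \<equiv> U_can C"
abbreviation "SU \<equiv> sweedler U U"
abbreviation "SV \<equiv> sweedler V U"
abbreviation "aug x \<equiv> x - vscale C (counit C x) (rone C)"
abbreviation rk (infixl "\<lhd>" 75) where "x \<lhd> y \<equiv> rack C x y"

section \<open>Consequences of the axioms of \<open>C\<close>, and its splitting into scalars and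
  kernel\<close>

lemma coalg: "is_coalgebra C"
  using rack_bialgebra by (simp add: is_rack_bialgebra_def)

lemmas space_C = is_coalgebraD(1)[OF coalg] and cop_lin = is_coalgebraD(2)[OF coalg]
  and counit_lin = is_coalgebraD(3)[OF coalg]

lemma one_C: "rone C \<in> vcarrier C" "cop C (rone C) = tens C C (rone C) (rone C)" "counit C (rone C) = 1"
  and rack_bilinear: "bilinear_map C C C (rack C)"
  and cop_rack: "\<And>x y. x \<in> vcarrier C \<Longrightarrow> y \<in> vcarrier C \<Longrightarrow>
    cop C (x \<lhd> y) = tensor_op C C (rack C) (rack C) (cop C x) (cop C y)"
  and counit_rack: "\<And>x y. x \<in> vcarrier C \<Longrightarrow> y \<in> vcarrier C \<Longrightarrow> counit C (x \<lhd> y) = counit C x * counit C y"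
  and rack_one: "\<And>x. x \<in> vcarrier C \<Longrightarrow> x \<lhd> rone C = x"
  and one_rack: "\<And>x. x \<in> vcarrier C \<Longrightarrow> rone C \<lhd> x = vscale C (counit C x) (rone C)"
  using rack_bialgebra by (simp_all add: is_rack_bialgebra_def)

lemma self_distributive:
  assumes "x \<in> vcarrier C" "y \<in> vcarrier C" "z \<in> vcarrier C"
  shows "(x \<lhd> y) \<lhd> z = SC C (\<lambda>z1 z2. (x \<lhd> z1) \<lhd> (y \<lhd> z2)) (cop C z)"
  using rack_bialgebra assms
  by (simp add: is_rack_bialgebra_def tensor_lift_sweedler[OF space_C space_C linear_map_mem[OF cop_lin]])

lemma V_simps [simp]: "vscale V = vscale C"
  and V_mem: "x \<in> vcarrier V \<longleftrightarrow> x \<in> vcarrier C \<and> counit C x = 0"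
  by (simp_all add: ker_counit_def)

lemma counit_simps:
  "x \<in> vcarrier C \<Longrightarrow> y \<in> vcarrier C \<Longrightarrow> counit C (x + y) = counit C x + counit C y"
  "x \<in> vcarrier C \<Longrightarrow> counit C (vscale C a x) = a * counit C x"
  "x \<in> vcarrier C \<Longrightarrow> y \<in> vcarrier C \<Longrightarrow> counit C (x - y) = counit C x - counit C y"
  "counit C 0 = 0"
  using linear_map_add[OF counit_lin] linear_map_scale[OF counit_lin] linear_map_diff[OF counit_lin space_C]
    linear_map_zero[OF counit_lin space_C is_space_ground]
  by (simp_all add: ground_def)

lemma space_V: "is_space V"
  using is_space_closed[OF space_C] is_space_vector_space[OF space_C]
  by (intro is_spaceI) (simp_all add: V_mem counit_simps)

lemma aug_lin: "linear_map C V (\<lambda>x. aug x)"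
proof (rule linear_mapI)
  interpret vector_space "vscale C" using space_C by (rule is_space_vector_space)
  show "aug x \<in> vcarrier V" if "x \<in> vcarrier C" for x
    using that is_space_closed[OF space_C] one_C by (simp add: V_mem counit_simps)
  show "aug (x + y) = aug x + aug y" if "x \<in> vcarrier C" "y \<in> vcarrier C" for x y
    using that by (simp add: counit_simps scale_left_distrib)
  show "aug (vscale C a x) = vscale V a (aug x)" if "x \<in> vcarrier C" for x a
    using that by (simp add: counit_simps scale_right_diff_distrib)
qed

lemma aug_V: "x \<in> vcarrier V \<Longrightarrow> aug x = x"
  by (simp add: V_mem scale_zero_left_space[OF space_C])

lemma aug_one: "aug (rone C) = 0"
  by (simp add: one_C scale_one_space[OF space_C])

lemma V_C_lin: "linear_map V C (\<lambda>x. x)"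
  by (simp add: linear_map_def V_mem)

lemma algebra_T: "is_algebra T mT eT"
  by (rule is_algebra_tensor_algebra[OF space_V])

lemmas space_T = is_space_tensor_algebra[of V] and alg_T = is_algebraD[OF algebra_T]

lemma letter_lin: "linear_map V T (\<lambda>x. word V [x])"
proof -
  have "linear_map V T (\<lambda>v. word V ([] @ [v] @ []))"
    using word_linear_word[of V] lists.Nil unfolding word_linear_def by blast
  then show ?thesis by simp
qed

lemma incl_lin: "linear_map C T i"
  unfolding incl_def
  using bilinear_map_compose_left[OF bilinear_map_scale[OF space_T] counit_lin alg_T(3)]
  by (intro linear_map_plus[OF space_T] linear_map_compose[OF letter_lin aug_lin]) simp

lemma incl_V: "x \<in> vcarrier V \<Longrightarrow> i x = word V [x]"
  by (simp add: incl_def aug_V) (simp add: V_mem scale_zero_left_space[OF space_T, simplified])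

lemma incl_one: "i (rone C) = eT"
  using linear_map_zero[OF letter_lin space_V space_T] scale_one_space[OF space_T]
  by (simp add: incl_def aug_one) (simp add: one_C)

lemma T_bialg_simps [simp]:
  "vcarrier (T_bialg C) = vcarrier T" "vscale (T_bialg C) = free_scale"
  "bmult (T_bialg C) = mT" "bone (T_bialg C) = eT"
  "counit (T_bialg C) = algebra_ext ground (*) 1 (\<lambda>x. 0)"
  by (simp_all add: T_bialg_def Let_def)

section \<open>The ideal of relations\<close>

definition relator :: "'c \<Rightarrow> 'c \<Rightarrow> ('c list \<Rightarrow>\<^sub>0 'k)" where
  "relator x y = SC T (\<lambda>y1 y2. mT (i y1) (i (x \<lhd> y2))) (cop C y) - mT (i x) (i y)"

lemma relator_mem: "x \<in> vcarrier C \<Longrightarrow> y \<in> vcarrier C \<Longrightarrow> relator x y \<in> vcarrier T"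
  unfolding relator_def
  by (intro is_space_diff[OF space_T] sweedler_mem[OF space_T] alg_T(7) linear_map_mem[OF incl_lin]
      bilinear_map_mem[OF rack_bilinear])

lemma U_ideal_eq: "J = ideal_generated (T_bialg C) {relator x y | x y. x \<in> vcarrier C \<and> y \<in> vcarrier C}"
proof -
  have "tensor_lift (T_bialg C) F (cop C y) = SC T F (cop C y)" if "y \<in> vcarrier C" for F y
    unfolding tensor_lift_sweedler[OF space_C space_C linear_map_mem[OF cop_lin that], symmetric]
    by (simp add: tensor_lift_cong_space[of "T_bialg C" T])
  then show ?thesis
    unfolding U_ideal_def relator_def by (intro arg_cong[where f = "ideal_generated _"] Collect_cong iff_exI) auto
qed

lemma U_ideal_least:
  assumes "module.subspace free_scale I" "I \<subseteq> vcarrier T"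
    and "\<And>x y. x \<in> vcarrier C \<Longrightarrow> y \<in> vcarrier C \<Longrightarrow> relator x y \<in> I"
    and "\<And>a x. a \<in> vcarrier T \<Longrightarrow> x \<in> I \<Longrightarrow> mT a x \<in> I" "\<And>a x. a \<in> vcarrier T \<Longrightarrow> x \<in> I \<Longrightarrow> mT x a \<in> I"
  shows "J \<subseteq> I"
  unfolding U_ideal_eq ideal_generated_def by (rule Inter_lower) (use assms in auto)

lemma subspace_T: "module.subspace free_scale (vcarrier T)"
  using space_T by (simp add: is_space_def)

lemma U_ideal_sub: "J \<subseteq> vcarrier T"
  by (rule U_ideal_least[OF subspace_T]) (simp_all add: relator_mem alg_T)

lemma subspace_U_ideal: "module.subspace free_scale J"
  unfolding U_ideal_eq ideal_generated_def
  by (rule module.subspace_Inter[OF module_free_scale]) simp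

lemma U_ideal_ideal:
  assumes "a \<in> vcarrier T" "x \<in> J"
  shows "mT a x \<in> J" "mT x a \<in> J"
  using assms unfolding U_ideal_eq ideal_generated_def by auto

lemma relator_U_ideal: "x \<in> vcarrier C \<Longrightarrow> y \<in> vcarrier C \<Longrightarrow> relator x y \<in> J"
  unfolding U_ideal_eq ideal_generated_def by auto

text \<open>The elements of \<open>T\<close> killed by an algebra map form a two-sided ideal, and
  \<open>J\<close> is the least one containing the relators.\<close>

lemma algebra_map_U_ideal:
  assumes A: "is_algebra A m e" and f: "is_algebra_map T mT eT A m e f"
    and rel: "\<And>x y. x \<in> vcarrier C \<Longrightarrow> y \<in> vcarrier C \<Longrightarrow> f (relator x y) = 0"
    and t: "t \<in> J"
  shows "f t = 0"
proof -
  note a = is_algebraD[OF A] and F = is_algebra_mapD[OF f]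
  let ?I = "{t \<in> vcarrier T. f t = 0}"
  have m0: "m 0 x = 0" "m x 0 = 0" if "x \<in> vcarrier A" for x
    using linear_map_zero[OF bilinear_map_left[OF a(2) that] a(1) a(1)]
      linear_map_zero[OF bilinear_map_right[OF a(2) that] a(1) a(1)] by auto
  have "J \<subseteq> ?I"
  proof (rule U_ideal_least)
    show "module.subspace free_scale ?I"
      using is_space_closed(1,2,3)[OF space_T] linear_map_zero[OF F(1) space_T a(1)]
        linear_map_add[OF F(1)] linear_map_scale[OF F(1)] scale_zero_right_space[OF a(1)]
      by (auto simp: module.subspace_def[OF module_free_scale])
  qed (auto simp: relator_mem rel alg_T F m0)
  then show ?thesis using t by auto
qed

section \<open>The quotient algebra and its generators\<close>

lemma p_eq: "p = quotient_map free_scale J"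
  by (simp add: U_proj_def)

lemma vscale_U [simp]: "vscale U = free_scale"
  and U_ops [simp]: "mU = (\<lambda>u v. p (mT u v))" "eU = p eT" "counit U = counit (T_bialg C)"
  by (simp_all add: U_bialg_def U_space_def quotient_space_def)

lemma U_carrier: "vcarrier U = p ` vcarrier T"
  by (simp add: U_bialg_def U_space_def quotient_space_def p_eq)

lemma U_quotient: "vcarrier U = vcarrier (quotient_space T J)"
  by (simp add: U_carrier quotient_space_def p_eq)

lemma space_U: "is_space U"
  using is_space_quotient[OF space_T] subspace_U_ideal
  by (simp add: is_space_def U_quotient) (simp add: quotient_space_def)

lemma U_T: "u \<in> vcarrier U \<Longrightarrow> u \<in> vcarrier T" and p_U: "u \<in> vcarrier U \<Longrightarrow> p u = u"
  using quotient_mem[OF space_T _ U_ideal_sub, of u] subspace_U_ideal by (simp_all add: U_quotient p_eq)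

lemma p_mem: "t \<in> vcarrier T \<Longrightarrow> p t \<in> vcarrier U"
  by (simp add: U_carrier)

lemma p_eq_iff: "p s = p t \<longleftrightarrow> s - t \<in> J"
  unfolding p_eq by (rule quotient_map_eq_iff[OF vector_space_free_scale subspace_U_ideal])

lemma p_lin: "linear_map T U p"
proof -
  interpret Vector_Spaces.linear free_scale free_scale p
    unfolding p_eq by (rule linear_quotient_map[OF vector_space_free_scale subspace_U_ideal])
  show ?thesis by (auto simp: linear_map_def p_mem add scale)
qed

lemma p_diff_mem: "t \<in> vcarrier T \<Longrightarrow> p t - t \<in> J"
  unfolding p_eq_iff[symmetric] using p_U[OF p_mem] .

text \<open>\<open>p s\<close> and \<open>s\<close> differ by an element of \<open>J\<close>, hence
  so do the products, as \<open>J\<close> is two-sided. This is the well-definedness of the product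
  of \<open>U\<close>.\<close>

lemma p_mult: 
  assumes s: "s \<in> vcarrier T" and t: "t \<in> vcarrier T"
  shows "p (mT (p s) t) = p (mT s t)" "p (mT s (p t)) = p (mT s t)"
proof -
  note d = linear_map_diff[OF bilinear_map_left[OF alg_T(2) t] space_T U_T[OF p_mem[OF s]] s]
    linear_map_diff[OF bilinear_map_right[OF alg_T(2) s] space_T U_T[OF p_mem[OF t]] t]
  show "p (mT (p s) t) = p (mT s t)" "p (mT s (p t)) = p (mT s t)"
    unfolding p_eq_iff d[symmetric]
    using U_ideal_ideal(2)[OF t p_diff_mem[OF s]] U_ideal_ideal(1)[OF s p_diff_mem[OF t]] .
qed

lemma mU_bilinear: "bilinear_map U U U mU"
proof -
  have l: "linear_map U T (\<lambda>u. u)" by (simp add: linear_map_def U_T)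
  show ?thesis
    unfolding U_ops
    by (rule bilinear_mapI; rule linear_map_compose[OF p_lin])
      (auto intro: bilinear_map_compose_left[OF alg_T(2) l] bilinear_map_compose_right[OF alg_T(2) l] U_T)
qed

lemma algebra_U: "is_algebra U mU eU"
  unfolding is_algebra_def
proof (intro conjI ballI)
  show "mU (mU a b) c = mU a (mU b c)" if "a \<in> vcarrier U" "b \<in> vcarrier U" "c \<in> vcarrier U" for a b c
    using that by (simp add: p_mult alg_T U_T)
  show "mU eU a = a" "mU a eU = a" if "a \<in> vcarrier U" for a
    using that by (simp_all add: p_mult alg_T U_T p_U)
qed (simp_all only: space_U mU_bilinear, simp add: p_mem alg_T)

lemmas alg_U = is_algebraD[OF algebra_U]

lemma p_algebra_map: "is_algebra_map T mT eT U mU eU p"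
  by (simp add: is_algebra_map_def p_lin p_mult alg_T U_T p_mem)

text \<open>Elements of \<open>U\<close> are representatives in \<open>T\<close>, so the descended
  map is \<open>f\<close> itself. Compatibility with \<open>p\<close> is what makes it
  multiplicative for the product of \<open>U\<close>.\<close>

lemma algebra_map_descends:
  assumes A: "is_algebra A m e" and f: "is_algebra_map T mT eT A m e f"
    and rel: "\<And>x y. x \<in> vcarrier C \<Longrightarrow> y \<in> vcarrier C \<Longrightarrow> f (relator x y) = 0"
  shows "t \<in> vcarrier T \<Longrightarrow> f (p t) = f t" and "is_algebra_map U mU eU A m e f"
proof -
  note F = is_algebra_mapD[OF f]
  show 1: "f (p t) = f t" if "t \<in> vcarrier T" for t
    using algebra_map_U_ideal[OF assms p_diff_mem[OF that]]
      linear_map_diff[OF F(1) space_T U_T[OF p_mem[OF that]] that] by simp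
  show "is_algebra_map U mU eU A m e f"
    unfolding is_algebra_map_def
    using F by (auto simp: 1 alg_T U_T linear_map_def)
qed

lemma q_eq: "q x = p (i x)"
  by (simp add: U_can_def)

lemma q_lin: "linear_map C U q"
  unfolding q_eq[abs_def] by (rule linear_map_compose[OF p_lin incl_lin])

lemma q_one: "q (rone C) = eU"
  by (simp add: q_eq incl_one)

text \<open>As an algebra \<open>U\<close> is generated by the values of \<open>q\<close> on the
  kernel of the counit. Generators are split off on the left, which suits right actions: the
  generator acts first.\<close>

lemma U_induct [consumes 1, case_names one gen add scale]:
  assumes u: "u \<in> vcarrier U" and one: "Q eU"
    and gen: "\<And>x u. x \<in> vcarrier V \<Longrightarrow> u \<in> vcarrier U \<Longrightarrow> Q u \<Longrightarrow> Q (mU (q x) u)"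
    and add: "\<And>u v. u \<in> vcarrier U \<Longrightarrow> v \<in> vcarrier U \<Longrightarrow> Q u \<Longrightarrow> Q v \<Longrightarrow> Q (u + v)"
    and scale: "\<And>a u. u \<in> vcarrier U \<Longrightarrow> Q u \<Longrightarrow> Q (free_scale a u)"
  shows "Q u"
proof -
  \<comment> \<open>The words and partial sums that make up \<open>u\<close> need not be elements of
    \<open>U\<close>, so the induction over \<open>T\<close> establishes the property for their
    projections.\<close>
  have "Q (p u)"
    using space_V U_T[OF u]
  proof (induction rule: tensor_algebra_induct)
    case (word xs)
    then show ?case
    proof (induction xs)
      case (Cons x xs)
      have "p (word V (x # xs)) = mU (q x) (p (word V xs))"
        using Cons.hyps by (simp add: word_Cons[OF space_V, of x xs] q_eq incl_V p_mult word_mem alg_T U_T p_mem)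
      then show ?case using gen[of x "p (word V xs)"] Cons by (simp add: p_mem word_mem)
    qed (use one in simp)
  next
    case (add s t)
    then show ?case using assms(4)[of "p s" "p t"] by (simp add: linear_map_add[OF p_lin] p_mem)
  next
    case (scale a t)
    then show ?case using assms(5)[of "p t" a] linear_map_scale[OF p_lin, of t a] by (simp add: p_mem)
  qed
  then show ?thesis by (simp add: p_U[OF u])
qed

lemma algebra_map_eq_U:
  assumes A: "is_space A"
    and f: "is_algebra_map U mU eU A m e f" and g: "is_algebra_map U mU eU A m e g"
    and eq: "\<And>x. x \<in> vcarrier C \<Longrightarrow> f (q x) = g (q x)"
    and u: "u \<in> vcarrier U"
  shows "f u = g u"
  using u
proof (induction rule: U_induct)
  note F = is_algebra_mapD[OF f] and G = is_algebra_mapD[OF g]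
  case one
  show ?case by (simp only: F(2) G(2))
next
  note F = is_algebra_mapD[OF f] and G = is_algebra_mapD[OF g]
  case (gen x u)
  then have "x \<in> vcarrier C" by (simp add: V_mem)
  then show ?case using gen by (simp only: F(3) G(3) eq linear_map_mem[OF q_lin])
next
  case (add u v)
  then show ?case
    by (simp add: linear_map_add[OF is_algebra_mapD(1)[OF f]] linear_map_add[OF is_algebra_mapD(1)[OF g]])
next
  case (scale a u)
  then show ?case
    using linear_map_scale[OF is_algebra_mapD(1)[OF f], of u a] linear_map_scale[OF is_algebra_mapD(1)[OF g], of u a]
    by simp
qed

lemma U_relation:
  assumes "x \<in> vcarrier C" "y \<in> vcarrier C"
  shows "SC U (\<lambda>y1 y2. mU (q y1) (q (x \<lhd> y2))) (cop C y) = mU (q x) (q y)"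
proof -
  note m = linear_map_mem[OF incl_lin] bilinear_map_mem[OF rack_bilinear]
  have "p (SC T (\<lambda>y1 y2. mT (i y1) (i (x \<lhd> y2))) (cop C y)) = p (mT (i x) (i y))"
    unfolding p_eq_iff using relator_U_ideal[OF assms] by (simp add: relator_def)
  then show ?thesis
    using assms by (simp add: sweedler_push[OF p_lin space_T space_U] alg_T m q_eq p_mult U_T p_mem)
qed

declare U_ops [simp del]

abbreviation "mUU \<equiv> tensor_op U U mU mU"
abbreviation "UU \<equiv> U \<otimes>\<^sub>k U"
abbreviation "eUU \<equiv> tens U U eU eU"

lemmas [multilin] = space_C space_U space_V alg_U(3) alg_U(7)
  linear_map_mem[OF q_lin] linear_map_compose[OF q_lin]
  bilinear_map_mem[OF rack_bilinear] bilinear_map_compose_left[OF rack_bilinear]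
  bilinear_map_compose_right[OF rack_bilinear]
  bilinear_map_compose_left[OF alg_U(2)] bilinear_map_compose_right[OF alg_U(2)]
  linear_map_mem[OF cop_lin] linear_map_compose[OF cop_lin]

text \<open>Every \<open>x\<close> is \<open>aug x\<close> plus a multiple of \<open>rone C\<close>.
  Maps out of \<open>T\<close> are prescribed on the kernel of the counit only, whereas the relators
  involve \<open>i\<close> on all of \<open>C\<close>.\<close>

lemma C_ext:
  assumes f: "linear_map C Z f" and g: "linear_map C Z g" and "is_space Z"
    and one: "f (rone C) = g (rone C)" and V: "\<And>x. x \<in> vcarrier V \<Longrightarrow> f x = g x"
    and x: "x \<in> vcarrier C"
  shows "f x = g x"
proof -
  have *: "h x = h (aug x) + vscale Z (counit C x) (h (rone C))" if h: "linear_map C Z h" for h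
    using linear_map_add[OF h, of "aug x" "vscale C (counit C x) (rone C)"]
      linear_map_scale[OF h one_C(1)] linear_map_mem[OF aug_lin x] x
    by (simp add: V_mem is_space_scale[OF space_C] one_C)
  show ?thesis unfolding *[OF f] *[OF g] using one V linear_map_mem[OF aug_lin x] by simp
qed

section \<open>The coproduct of \<open>U\<close>\<close>

lemma algebra_UU: "is_algebra UU mUU eUU"
  by (rule is_algebra_tensor[OF algebra_U algebra_U])

lemma cop_T_map:
  shows "is_algebra_map T mT eT (T \<otimes>\<^sub>k T) (tensor_op T T mT mT) (tens T T eT eT) (cop (T_bialg C))"
    and "x \<in> vcarrier V \<Longrightarrow> cop (T_bialg C) (word V [x]) = tensor_map T T i i (cop C x)"
proof -
  have g: "linear_map V (T \<otimes>\<^sub>k T) (\<lambda>x. tensor_map T T i i (cop C x))"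
    by (rule linear_map_compose[OF tensor_map_linear[OF space_C space_C space_T space_T incl_lin incl_lin]])
      (rule linear_map_compose[OF cop_lin V_C_lin])
  have eq: "cop (T_bialg C) = algebra_ext (T \<otimes>\<^sub>k T) (tensor_op T T mT mT) (tens T T eT eT)
      (\<lambda>x. tensor_map T T i i (cop C x))"
    by (simp add: T_bialg_def Let_def)
  note ext = is_algebra_map_algebra_ext[OF space_V is_algebra_tensor[OF algebra_T algebra_T] g]
  show "is_algebra_map T mT eT (T \<otimes>\<^sub>k T) (tensor_op T T mT mT) (tens T T eT eT) (cop (T_bialg C))"
    "x \<in> vcarrier V \<Longrightarrow> cop (T_bialg C) (word V [x]) = tensor_map T T i i (cop C x)"
    unfolding eq by (rule ext, erule ext)
qed

lemma cop_U: "cop U u = tensor_map U U p p (cop (T_bialg C) u)"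
proof -
  have c: "vcarrier (U_space C) = vcarrier U" "vscale (U_space C) = vscale U"
    by (simp_all add: U_bialg_def)
  have "cop U u = tensor_map (U_space C) (U_space C) p p (cop (T_bialg C) u)"
    by (simp add: U_bialg_def)
  also have "tensor_map (U_space C) (U_space C) p p = tensor_map U U p p"
    unfolding tensor_map_def tensor_cong[OF c c] ..
  finally show ?thesis .
qed

text \<open>\<open>cop U\<close> is a formula on representatives and thus defined on all of
  \<open>T\<close>: it is the coproduct of \<open>T\<close> followed by the projection to
  \<open>U \<otimes> U\<close>. Whether it respects \<open>p\<close> is a separate question, settled
  by its values on relators.\<close>

lemma cop_U_map_T: "is_algebra_map T mT eT UU mUU eUU (cop U)"
  unfolding cop_U[abs_def]
  by (rule is_algebra_map_compose[OF is_algebra_map_tensor_map[OF algebra_T algebra_T algebra_U algebra_U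
          p_algebra_map p_algebra_map] cop_T_map(1)])

lemma cop_U_incl:
  assumes "x \<in> vcarrier C"
  shows "cop U (i x) = SC UU (\<lambda>a b. tens U U (q a) (q b)) (cop C x)"
proof (rule C_ext[OF _ _ is_space_tensor _ _ assms])
  show "linear_map C UU (\<lambda>x. cop U (i x))"
    by (rule linear_map_compose[OF is_algebra_mapD(1)[OF cop_U_map_T] incl_lin])
  show "linear_map C UU (\<lambda>x. SC UU (\<lambda>a b. tens U U (q a) (q b)) (cop C x))"
    by (rule multilin | assumption)+
  have "bilinear_map C C UU (\<lambda>a b. tens U U (q a) (q b))"
    by (rule multilin | assumption)+
  then show "cop U (i (rone C)) = SC UU (\<lambda>a b. tens U U (q a) (q b)) (cop C (rone C))"
    by (simp add: incl_one is_algebra_mapD(2)[OF cop_U_map_T] one_C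
        sweedler_tens[OF space_C space_C is_space_tensor] q_one)
  fix x assume x: "x \<in> vcarrier V"
  then have c: "cop C x \<in> vcarrier (C \<otimes>\<^sub>k C)" by (simp add: V_mem linear_map_mem[OF cop_lin])
  have m: "tensor_map T T i i (cop C x) \<in> vcarrier (T \<otimes>\<^sub>k T)"
    by (rule linear_map_mem[OF tensor_map_linear[OF space_C space_C space_T space_T incl_lin incl_lin] c])
  have b: "bilinear_map T T UU (\<lambda>v w. tens U U (p v) (p w))"
    by (rule multilin linear_map_compose[OF p_lin] linear_map_mem[OF p_lin] | assumption)+
  show "cop U (i x) = SC UU (\<lambda>a b. tens U U (q a) (q b)) (cop C x)"
    unfolding incl_V[OF x] cop_U cop_T_map(2)[OF x] tensor_map_sweedler[OF space_T space_T m]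
    unfolding tensor_map_sweedler[OF space_C space_C c]
    by (simp add: sweedler_sweedler[OF is_space_tensor] sweedler_tens[OF space_T space_T is_space_tensor b]
        linear_map_mem[OF incl_lin] q_eq)
qed

lemma cop_rack_sweedler:
  assumes "is_space Z" "bilinear_map C C Z F" "x \<in> vcarrier C" "y \<in> vcarrier C"
  shows "SC Z F (cop C (x \<lhd> y)) = SC Z (\<lambda>x1 x2.
    SC Z (\<lambda>y1 y2. F (x1 \<lhd> y1) (x2 \<lhd> y2)) (cop C y)) (cop C x)"
  by (rule cop_mult_sweedler[OF coalg coalg space_C assms(1) rack_bilinear assms(3,4) cop_rack[OF assms(3,4)] assms(2)])

lemmas mUU_sweedler = bilinear_sweedler[OF is_algebraD(2)[OF algebra_UU] is_space_tensor is_space_tensor is_space_tensor]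

lemma cop_U_relator:
  assumes x: "x \<in> vcarrier C" and y: "y \<in> vcarrier C"
  shows "cop U (relator x y) = 0"
proof -
  let ?Z = "UU"
  note Z = is_space_tensor[of U U] and D = is_algebra_mapD[OF cop_U_map_T]
  note mem = linear_map_mem[OF incl_lin] linear_map_mem[OF q_lin] bilinear_map_mem[OF rack_bilinear]
    alg_T(7) alg_U(7) tens_in_tensor
  note pure = tensor_op_tens[OF space_U space_U space_U space_U space_U space_U alg_U(2) alg_U(2)]
  have 1: "cop U (i (x \<lhd> b)) = SC ?Z (\<lambda>x1 x2. SC ?Z
      (\<lambda>b1 b2. tens U U (q (x1 \<lhd> b1)) (q (x2 \<lhd> b2))) (cop C b)) (cop C x)" if "b \<in> vcarrier C" for b
    using x that unfolding cop_U_incl[OF bilinear_map_mem[OF rack_bilinear x that]]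
    by (intro cop_rack_sweedler[OF Z]) (rule multilin | assumption)+
  have "cop U (SC T (\<lambda>y1 y2. mT (i y1) (i (x \<lhd> y2))) (cop C y)) =
     SC ?Z (\<lambda>a b. mUU (cop U (i a)) (cop U (i (x \<lhd> b)))) (cop C y)"
    using x by (simp add: sweedler_push[OF D(1) space_T Z] mem D)
  also have "\<dots> = SC ?Z (\<lambda>a b. SC ?Z (\<lambda>a1 a2. SC ?Z (\<lambda>x1 x2.
      SC ?Z (\<lambda>b1 b2. tens U U (mU (q a1) (q (x1 \<lhd> b1))) (mU (q a2) (q (x2 \<lhd> b2))))
        (cop C b)) (cop C x)) (cop C a)) (cop C y)"
    by (simp add: 1 cop_U_incl mUU_sweedler mem sweedler_mem[OF Z])
      (simp add: sweedler_push[OF bilinear_map_right[OF is_algebraD(2)[OF algebra_UU]] Z Z] pure mem)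
  \<comment> \<open>The sum over the coproduct of \<open>x\<close> moves outside, so that the
    fourfold coproduct of \<open>y\<close> becomes contiguous.\<close>
  also have "\<dots> = SC ?Z (\<lambda>x1 x2. SC ?Z (\<lambda>a b. SC ?Z (\<lambda>a1 a2.
      SC ?Z (\<lambda>b1 b2. tens U U (mU (q a1) (q (x1 \<lhd> b1))) (mU (q a2) (q (x2 \<lhd> b2))))
        (cop C b)) (cop C a)) (cop C y)) (cop C x)"
    by (subst sweedler_swap[OF Z, of _ _ _ _ _ "cop C x"]) (subst sweedler_swap[OF Z, of _ _ _ _ _ "cop C x"], rule refl)
  \<comment> \<open>Exchanging \<open>a2\<close> and \<open>b1\<close> gives the left tensor factor
    both parts of \<open>a\<close> and the right one both parts of \<open>b\<close>.\<close>
  also have "\<dots> = SC ?Z (\<lambda>x1 x2. SC ?Z (\<lambda>a b. SC ?Z (\<lambda>a1 a2.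
      SC ?Z (\<lambda>b1 b2. tens U U (mU (q a1) (q (x1 \<lhd> a2))) (mU (q b1) (q (x2 \<lhd> b2))))
        (cop C b)) (cop C a)) (cop C y)) (cop C x)"
    by (rule sweedler_cong[OF refl], rule cop_middle_swap[OF coalg cocommutative y Z])
      (rule multilin | assumption)+
  \<comment> \<open>The two inner sums are now independent and move into the factors of
    \<open>tens U U\<close>; each is the left side of \<open>U_relation\<close>, with
    \<open>x1\<close> and \<open>x2\<close> in the place of \<open>x\<close>.\<close>
  also have "\<dots> = SC ?Z (\<lambda>x1 x2. SC ?Z (\<lambda>a b.
      tens U U (SC U (\<lambda>a1 a2. mU (q a1) (q (x1 \<lhd> a2))) (cop C a))
        (SC U (\<lambda>b1 b2. mU (q b1) (q (x2 \<lhd> b2))) (cop C b))) (cop C y)) (cop C x)"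
    by (simp add: bilinear_sweedler[OF bilinear_tens space_U space_U Z] mem)
  also have "\<dots> = mUU (cop U (i x)) (cop U (i y))"
    using x y by (simp add: U_relation cop_U_incl mUU_sweedler mem pure)
  also have "\<dots> = cop U (mT (i x) (i y))"
    using x y by (simp add: D mem)
  finally show ?thesis
    unfolding relator_def using x y
    by (subst linear_map_diff[OF D(1) space_T]) (simp_all add: sweedler_mem[OF space_T] mem)
qed

lemma cop_U_map: "is_algebra_map U mU eU UU mUU eUU (cop U)"
  and cop_U_p: "t \<in> vcarrier T \<Longrightarrow> cop U (p t) = cop U t"
  by (rule algebra_map_descends[OF algebra_UU cop_U_map_T cop_U_relator]; assumption)+

lemmas cop_U_lin = is_algebra_mapD(1)[OF cop_U_map]

lemma cop_q:
  "x \<in> vcarrier C \<Longrightarrow> cop U (q x) = SC UU (\<lambda>a b. tens U U (q a) (q b)) (cop C x)"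
  by (simp add: q_eq cop_U_p linear_map_mem[OF incl_lin] cop_U_incl[unfolded q_eq])

lemma cop_q_sweedler:
  assumes "is_space Z" "bilinear_map U U Z F" "x \<in> vcarrier C"
  shows "SU Z F (cop U (q x)) = SC Z (\<lambda>a b. F (q a) (q b)) (cop C x)"
  by (simp add: cop_q[OF assms(3)] sweedler_sweedler[OF assms(1)] linear_map_mem[OF q_lin]
      sweedler_tens[OF space_U space_U assms(1,2)])

section \<open>The counit of \<open>U\<close> and the bialgebra axioms\<close>

lemma counit_T_map: "is_algebra_map T mT eT ground (*) 1 (counit U)"
  and counit_incl: "x \<in> vcarrier C \<Longrightarrow> counit U (i x) = counit C x"
proof -
  have g: "linear_map V ground (\<lambda>x. 0)" by (simp add: linear_map_def ground_def)
  note ext = is_algebra_map_algebra_ext[OF space_V is_algebra_ground g]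
  show 1: "is_algebra_map T mT eT ground (*) 1 (counit U)"
    using ext(1) by (simp add: U_ops)
  show "counit U (i x) = counit C x" if "x \<in> vcarrier C"
  proof (rule C_ext[OF linear_map_compose[OF is_algebra_mapD(1)[OF 1] incl_lin] counit_lin is_space_ground _ _ that])
    show "counit U (i (rone C)) = counit C (rone C)"
      by (simp add: incl_one is_algebra_mapD(2)[OF 1] one_C)
    show "counit U (i x) = counit C x" if "x \<in> vcarrier V" for x
      using ext(2)[OF that] that by (simp add: U_ops incl_V V_mem)
  qed
qed

text \<open>Both terms of the relator have counit \<epsilon>(x)\<epsilon>(y): for the first,
  \<epsilon>(y1)\<epsilon>(x)\<epsilon>(y2) collapses by the counit law of \<open>C\<close>.\<close>

lemma counit_relator:
  assumes x: "x \<in> vcarrier C" and y: "y \<in> vcarrier C"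
  shows "counit U (relator x y) = 0"
proof -
  note F = is_algebra_mapD[OF counit_T_map]
  note mem = linear_map_mem[OF incl_lin] bilinear_map_mem[OF rack_bilinear] alg_T(7)
  have g: "linear_map C ground (\<lambda>b. counit C x * counit C b)"
    using bilinear_map_compose_right[OF bilinear_map_scale[OF is_space_ground] counit_lin mem_ground]
    by (simp add: ground_def)
  have "counit U (SC T (\<lambda>y1 y2. mT (i y1) (i (x \<lhd> y2))) (cop C y)) =
     SC ground (\<lambda>a b. vscale ground (counit C a) (counit C x * counit C b)) (cop C y)"
    using x by (simp add: sweedler_push[OF F(1) space_T is_space_ground] mem F counit_incl counit_rack)
      (simp add: ground_def)
  also have "\<dots> = counit C x * counit C y"
    by (rule cop_counit(1)[OF coalg y is_space_ground g])
  also have "\<dots> = counit U (mT (i x) (i y))"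
    using x y by (simp add: F mem counit_incl)
  finally show ?thesis
    unfolding relator_def using x y
    by (subst linear_map_diff[OF F(1) space_T]) (simp_all add: sweedler_mem[OF space_T] mem)
qed

lemma counit_U_map: "is_algebra_map U mU eU ground (*) 1 (counit U)"
  and counit_U_p: "t \<in> vcarrier T \<Longrightarrow> counit U (p t) = counit U t"
  by (rule algebra_map_descends[OF is_algebra_ground counit_T_map counit_relator]; assumption)+

lemma counit_q: "x \<in> vcarrier C \<Longrightarrow> counit U (q x) = counit C x"
  by (simp add: q_eq counit_U_p linear_map_mem[OF incl_lin] counit_incl)

lemma coalgebra_U: "is_coalgebra U"
  unfolding is_coalgebra_def
proof (intro conjI ballI)
  note D = is_algebra_mapD[OF cop_U_map] and E = is_algebra_mapD[OF counit_U_map]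
  let ?Z = "U \<otimes>\<^sub>k UU"
  show "is_space U" by (rule space_U)
  show "linear_map U UU (cop U)" by (rule D)
  show "linear_map U ground (counit U)" by (rule E)
  fix u assume u: "u \<in> vcarrier U"
  have id: "is_algebra_map U mU eU U mU eU id"
    using is_algebra_map_ident[of U] by (simp add: id_def)
  have l: "is_algebra_map U mU eU ?Z (tensor_op U UU mU mUU) (tens U UU eU eUU)
      (\<lambda>u. tensor_assoc U U U (tensor_map UU U (cop U) id (cop U u)))"
    by (rule is_algebra_map_compose[OF is_algebra_map_tensor_assoc[OF algebra_U algebra_U algebra_U]])
      (rule is_algebra_map_compose[OF is_algebra_map_tensor_map[OF algebra_U algebra_U algebra_UU algebra_U
            cop_U_map id] cop_U_map])
  have r: "is_algebra_map U mU eU ?Z (tensor_op U UU mU mUU) (tens U UU eU eUU)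
      (\<lambda>u. tensor_map U UU id (cop U) (cop U u))"
    by (rule is_algebra_map_compose[OF is_algebra_map_tensor_map[OF algebra_U algebra_U algebra_U algebra_UU
            id cop_U_map] cop_U_map])
  show "tensor_assoc U U U (tensor_map UU U (cop U) id (cop U u)) =
    tensor_map U UU id (cop U) (cop U u)"
  proof (rule algebra_map_eq_U[OF is_space_tensor l r _ u])
    fix x assume x: "x \<in> vcarrier C"
    note [multilin] = linear_map_mem[OF D(1)] linear_map_compose[OF D(1)]
    have m: "cop U (q x) \<in> vcarrier UU"
      by (rule D(4)) (rule linear_map_mem[OF q_lin x])
    have b1: "bilinear_map U U ?Z (\<lambda>x d. SU ?Z (\<lambda>a b. tens U UU a (tens U U b d)) (cop U x))"
      by (rule multilin | assumption)+
    have b2: "bilinear_map U U ?Z (\<lambda>a y. SU ?Z (\<lambda>b d. tens U UU a (tens U U b d)) (cop U y))"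
      by (rule multilin | assumption)+
    have b3: "bilinear_map U U ?Z (\<lambda>a b. tens U UU a (tens U U b d))" if "d \<in> vcarrier U" for d
      by (insert that, (rule multilin | assumption)+)
    have b4: "bilinear_map U U ?Z (\<lambda>b d. tens U UU a (tens U U b d))" if "a \<in> vcarrier U" for a
      by (insert that, (rule multilin | assumption)+)
    \<comment> \<open>On generators the axiom is coassociativity of \<open>C\<close>, transported by
      \<open>q\<close> in each of the three factors.\<close>
    have "SC ?Z (\<lambda>a b. SC ?Z (\<lambda>c d. tens U UU (q c) (tens U U (q d) (q b))) (cop C a)) (cop C x) =
      SC ?Z (\<lambda>a b. SC ?Z (\<lambda>c d. tens U UU (q a) (tens U U (q c) (q d))) (cop C b)) (cop C x)"
      by (rule cop_coassoc[OF coalg x is_space_tensor]) (rule multilin | assumption)+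
    then show "tensor_assoc U U U (tensor_map UU U (cop U) id (cop U (q x))) =
      tensor_map U UU id (cop U) (cop U (q x))"
      unfolding tensor_assoc_map_sweedler[OF space_U space_U space_U space_U D(1) m]
        tensor_map_id_sweedler[OF space_U space_U space_U space_U D(1) m]
      using x by (simp add: cop_q_sweedler[OF is_space_tensor] b1 b2 b3 b4 linear_map_mem[OF q_lin])
  qed
  have lift: "tensor_lift U F (cop U u) = SU U F (cop U u)" for F
    by (rule tensor_lift_sweedler[OF space_U space_U D(4)[OF u]])
  note s = bilinear_map_compose_left[OF bilinear_map_scale[OF space_U]]
    bilinear_map_compose_right[OF bilinear_map_scale[OF space_U]]
  show "tensor_lift U (\<lambda>a b. vscale U (counit U a) b) (cop U u) = u"
    unfolding lift
  proof (rule algebra_map_eq_U[OF space_U is_algebra_map_compose[OF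
          is_algebra_map_counit_left[OF algebra_U algebra_U counit_U_map] cop_U_map] is_algebra_map_ident _ u])
    fix x assume x: "x \<in> vcarrier C"
    have "bilinear_map U U U (\<lambda>a b. vscale U (counit U a) b)"
      by (rule multilin s E(1) E(4) | assumption)+
    then show "SU U (\<lambda>a b. vscale U (counit U a) b) (cop U (q x)) = q x"
      using cop_counit(1)[OF coalg x space_U q_lin] by (simp add: cop_q_sweedler[OF space_U _ x] counit_q)
  qed
  show "tensor_lift U (\<lambda>a b. vscale U (counit U b) a) (cop U u) = u"
    unfolding lift
  proof (rule algebra_map_eq_U[OF space_U is_algebra_map_compose[OF
          is_algebra_map_counit_right[OF algebra_U algebra_U counit_U_map] cop_U_map] is_algebra_map_ident _ u])
    fix x assume x: "x \<in> vcarrier C"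
    have "bilinear_map U U U (\<lambda>a b. vscale U (counit U b) a)"
      by (rule multilin s E(1) E(4) | assumption)+
    then show "SU U (\<lambda>a b. vscale U (counit U b) a) (cop U (q x)) = q x"
      using cop_counit(2)[OF coalg x space_U q_lin] by (simp add: cop_q_sweedler[OF space_U _ x] counit_q)
  qed
qed

lemma bialgebra_U: "is_bialgebra U"
proof -
  note D = is_algebra_mapD[OF cop_U_map] and E = is_algebra_mapD[OF counit_U_map]
  show ?thesis
    unfolding is_bialgebra_def
    by (intro conjI ballI coalgebra_U alg_U D(2,3) E(2,3))
qed

end

section \<open>Tetramodules from Yetter-Drinfeld modules\<close>

text \<open>The construction of \<open>U_tetra\<close> with action and coaction as parameters: the
  left structures come from \<open>H\<close> alone, the right ones are diagonal in \<open>H\<close>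
  and \<open>V\<close>.\<close>

definition yd_tetramodule ::
  "('k::field, 'h::ab_group_add, 'y) bialgebra_scheme \<Rightarrow> ('k, 'v::ab_group_add, 'z) space_scheme
    \<Rightarrow> ('v \<Rightarrow> 'h \<Rightarrow> 'v) \<Rightarrow> ('v \<Rightarrow> (('v \<times> 'h) \<Rightarrow>\<^sub>0 'k)) \<Rightarrow> ('k, 'h, ('h \<times> 'v) \<Rightarrow>\<^sub>0 'k) tetramodule" where
  "yd_tetramodule H V act \<delta> =
     (let M = H \<otimes>\<^sub>k V
      in \<lparr>vcarrier = vcarrier M, vscale = vscale M,
          lact = (\<lambda>g. tensor_lift M (\<lambda>h v. tens H V (bmult H g h) v)),
          ract = (\<lambda>m g. tensor_op H V (bmult H) act m (cop H g)),
          lcoact = tensor_lift (H \<otimes>\<^sub>k M) (\<lambda>h v.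
            tensor_lift (H \<otimes>\<^sub>k M) (\<lambda>h1 h2. tens H M h1 (tens H V h2 v)) (cop H h)),
          rcoact = tensor_lift (M \<otimes>\<^sub>k H) (\<lambda>h v.
            tensor_op M H (tens H V) (bmult H) (cop H h) (\<delta> v))\<rparr>)"

text \<open>The familiar formula for the coaction of v \<triangleleft> g contains an antipode. The
  compatibility used here is its form without one, with g1 kept as a factor on the left of the
  coaction, and makes sense over any bialgebra.\<close>

locale yetter_drinfeld =
  fixes H :: "('k::field, 'h::ab_group_add, 'y) bialgebra_scheme"
    and V :: "('k, 'v::ab_group_add, 'z) space_scheme"
    and act :: "'v \<Rightarrow> 'h \<Rightarrow> 'v" (infixl "\<triangleleft>" 75)
    and \<delta> :: "'v \<Rightarrow> (('v \<times> 'h) \<Rightarrow>\<^sub>0 'k)"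
  assumes bialgebra: "is_bialgebra H"
    and space_V: "is_space V"
    and act_bilinear: "bilinear_map V H V act"
    and act_one: "v \<in> vcarrier V \<Longrightarrow> v \<triangleleft> bone H = v"
    and act_mult: "v \<in> vcarrier V \<Longrightarrow> g \<in> vcarrier H \<Longrightarrow> h \<in> vcarrier H \<Longrightarrow>
      v \<triangleleft> bmult H g h = (v \<triangleleft> g) \<triangleleft> h"
    and \<delta>_lin: "linear_map V (V \<otimes>\<^sub>k H) \<delta>"
    and \<delta>_counit: "v \<in> vcarrier V \<Longrightarrow> sweedler V H V (\<lambda>a b. vscale V (counit H b) a) (\<delta> v) = v"
    and \<delta>_coassoc: "v \<in> vcarrier V \<Longrightarrow> tensor_assoc V H H (tensor_map (V \<otimes>\<^sub>k H) H \<delta> id (\<delta> v)) =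
      tensor_map V (H \<otimes>\<^sub>k H) id (cop H) (\<delta> v)"
    and yetter_drinfeld: "v \<in> vcarrier V \<Longrightarrow> g \<in> vcarrier H \<Longrightarrow>
      sweedler H H (V \<otimes>\<^sub>k H) (\<lambda>g1 g2. sweedler V H (V \<otimes>\<^sub>k H)
        (\<lambda>a b. tens V H a (bmult H g1 b)) (\<delta> (v \<triangleleft> g2))) (cop H g) =
      sweedler H H (V \<otimes>\<^sub>k H) (\<lambda>g1 g2. sweedler V H (V \<otimes>\<^sub>k H)
        (\<lambda>a b. tens V H (a \<triangleleft> g1) (bmult H b g2)) (\<delta> v)) (cop H g)"
begin

abbreviation mult (infixl "\<star>" 75) where "g \<star> h \<equiv> bmult H g h"
abbreviation "M \<equiv> yd_tetramodule H V act \<delta>"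
abbreviation "SH \<equiv> sweedler H H"
abbreviation "SV \<equiv> sweedler V H"

lemma coalgebra_H: "is_coalgebra H"
  and algebra_H: "is_algebra H (bmult H) (bone H)"
  using bialgebra by (simp_all add: is_bialgebra_def is_algebra_def is_coalgebra_def)

lemmas H_coalg = is_coalgebraD[OF coalgebra_H] and H_alg = is_algebraD[OF algebra_H]

lemma cop_mult_H: "g \<in> vcarrier H \<Longrightarrow> h \<in> vcarrier H \<Longrightarrow>
    cop H (g \<star> h) = tensor_op H H (bmult H) (bmult H) (cop H g) (cop H h)"
  and counit_mult: "g \<in> vcarrier H \<Longrightarrow> h \<in> vcarrier H \<Longrightarrow> counit H (g \<star> h) = counit H g * counit H h"
  and cop_one: "cop H (bone H) = tens H H (bone H) (bone H)"
  using bialgebra by (simp_all add: is_bialgebra_def)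

lemma M_simps: "vcarrier M = vcarrier (H \<otimes>\<^sub>k V)" "vscale M = free_scale"
  by (simp_all add: yd_tetramodule_def Let_def)

lemmas vscale_M [simp] = M_simps(2)

lemma space_M: "is_space M"
  using is_space_tensor[of H V] by (simp add: is_space_def M_simps)

lemma tens_M: "bilinear_map H V M (tens H V)"
  using bilinear_tens[of H V] by (simp add: bilinear_map_def linear_map_def M_simps)

lemmas mem_M = bilinear_map_mem[OF tens_M]

lemma tensor_M: "H \<otimes>\<^sub>k M = H \<otimes>\<^sub>k (H \<otimes>\<^sub>k V)" "tens H M = tens H (H \<otimes>\<^sub>k V)"
  "M \<otimes>\<^sub>k H = (H \<otimes>\<^sub>k V) \<otimes>\<^sub>k H" "tens M H = tens (H \<otimes>\<^sub>k V) H"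
  by (rule tensor_cong; simp add: M_simps)+

lemma M_ext:
  assumes "linear_map M Z f" "linear_map M Z g" "is_space Z"
    and "\<And>h v. h \<in> vcarrier H \<Longrightarrow> v \<in> vcarrier V \<Longrightarrow> f (tens H V h v) = g (tens H V h v)"
    and "m \<in> vcarrier M"
  shows "f m = g m"
  by (rule tensor_ext[OF _ _ H_coalg(1) space_V assms(3)])
    (use assms in \<open>simp_all add: linear_map_def M_simps\<close>)

lemma M_tensor_lin: "linear_map M (H \<otimes>\<^sub>k V) (\<lambda>m. m)"
  by (simp add: linear_map_def M_simps)

lemmas [multilin] = M_tensor_lin H_coalg(1) space_V space_M H_alg(3) H_alg(7) mem_M
  bilinear_map_compose_left[OF H_alg(2)] bilinear_map_compose_right[OF H_alg(2)]
  bilinear_map_mem[OF act_bilinear]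
  bilinear_map_compose_left[OF act_bilinear] bilinear_map_compose_right[OF act_bilinear]
  bilinear_map_compose_left[OF tens_M] bilinear_map_compose_right[OF tens_M]
  linear_map_mem[OF H_coalg(2)] linear_map_compose[OF H_coalg(2)]
  linear_map_mem[OF \<delta>_lin] linear_map_compose[OF \<delta>_lin]

lemma cop_mult_sweedler_H:
  assumes "is_space Z" "bilinear_map H H Z F" "g \<in> vcarrier H" "h \<in> vcarrier H"
  shows "SH Z F (cop H (g \<star> h)) = SH Z (\<lambda>g1 g2.
    SH Z (\<lambda>h1 h2. F (g1 \<star> h1) (g2 \<star> h2)) (cop H h)) (cop H g)"
  by (rule cop_mult_sweedler[OF coalgebra_H coalgebra_H H_coalg(1) assms(1) H_alg(2) assms(3,4)
        cop_mult_H[OF assms(3,4)] assms(2)])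

text \<open>Applying the linear map on \<open>V \<otimes> H\<close> induced by \<open>F\<close> to
  both sides makes the condition usable inside larger Sweedler sums.\<close>

lemma yetter_drinfeld_sweedler:
  assumes "v \<in> vcarrier V" "g \<in> vcarrier H" and Z: "is_space Z" and F: "bilinear_map V H Z F"
  shows "SH Z (\<lambda>g1 g2. SV Z (\<lambda>a b. F a (g1 \<star> b)) (\<delta> (v \<triangleleft> g2))) (cop H g) =
    SH Z (\<lambda>g1 g2. SV Z (\<lambda>a b. F (a \<triangleleft> g1) (b \<star> g2)) (\<delta> v)) (cop H g)"
  using arg_cong[OF yetter_drinfeld[OF assms(1,2)], of "SV Z F"]
  by (simp add: sweedler_sweedler[OF Z] sweedler_tens[OF space_V H_coalg(1) Z F] H_alg(7)
      bilinear_map_mem[OF act_bilinear])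

lemma \<delta>_coassoc_sweedler:
  assumes v: "v \<in> vcarrier V" and Z: "is_space Z"
    and F: "\<And>b d. b \<in> vcarrier H \<Longrightarrow> d \<in> vcarrier H \<Longrightarrow> linear_map V Z (\<lambda>a. F a b d)"
      "\<And>a d. a \<in> vcarrier V \<Longrightarrow> d \<in> vcarrier H \<Longrightarrow> linear_map H Z (\<lambda>b. F a b d)"
      "\<And>a b. a \<in> vcarrier V \<Longrightarrow> b \<in> vcarrier H \<Longrightarrow> linear_map H Z (\<lambda>d. F a b d)"
  shows "SV Z (\<lambda>a b. SV Z (\<lambda>c d. F c d b) (\<delta> a)) (\<delta> v) =
    SV Z (\<lambda>a b. SH Z (\<lambda>c d. F a c d) (cop H b)) (\<delta> v)"
proof -
  note m = linear_map_mem[OF \<delta>_lin v]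
  show ?thesis
    by (rule coassoc_sweedler[OF space_V H_coalg(1) space_V H_coalg(1) H_coalg(1) Z \<delta>_lin m H_coalg(2) m
          \<delta>_coassoc[OF v] F])
qed

section \<open>The four structure maps as Sweedler sums\<close>

lemma lact_eq: "m \<in> vcarrier M \<Longrightarrow> lact M g m = sweedler H V M (\<lambda>h v. tens H V (g \<star> h) v) m"
  using sweedler_space_cong[of M "H \<otimes>\<^sub>k V" H V]
  by (simp add: M_simps(1) tensor_lift_sweedler[OF H_coalg(1) space_V])
    (simp add: yd_tetramodule_def Let_def tensor_lift_sweedler[OF H_coalg(1) space_V]
      tensor_lift_cong_space[of "\<lparr>vcarrier = vcarrier (H \<otimes>\<^sub>k V), vscale = free_scale\<rparr>" "H \<otimes>\<^sub>k V"])

lemma ract_eq: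
  assumes "m \<in> vcarrier M" "g \<in> vcarrier H"
  shows "ract M m g = sweedler H V M (\<lambda>h v. SH M (\<lambda>g1 g2. tens H V (h \<star> g1) (v \<triangleleft> g2)) (cop H g)) m"
proof -
  have "ract M m g = tensor_op H V (bmult H) act m (cop H g)"
    by (simp add: yd_tetramodule_def Let_def)
  also have "\<dots> = sweedler H V (H \<otimes>\<^sub>k V) (\<lambda>h v. SH (H \<otimes>\<^sub>k V) (\<lambda>g1 g2. tens H V (h \<star> g1) (v \<triangleleft> g2)) (cop H g)) m"
    using assms by (intro tensor_op_sweedler[OF H_coalg(1) space_V _ H_coalg(1) H_coalg(1)])
      (simp_all add: M_simps linear_map_mem[OF H_coalg(2)])
  finally show ?thesis
    using sweedler_space_cong[of M "H \<otimes>\<^sub>k V" H V] sweedler_space_cong[of M "H \<otimes>\<^sub>k V" H H] by simp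
qed

lemma lcoact_eq:
  assumes "m \<in> vcarrier M"
  shows "lcoact M m = sweedler H V (H \<otimes>\<^sub>k M) (\<lambda>h v.
    SH (H \<otimes>\<^sub>k M) (\<lambda>h1 h2. tens H M h1 (tens H V h2 v)) (cop H h)) m"
proof -
  have "lcoact M m = tensor_lift (H \<otimes>\<^sub>k M) (\<lambda>h v.
      tensor_lift (H \<otimes>\<^sub>k M) (\<lambda>h1 h2. tens H M h1 (tens H V h2 v)) (cop H h)) m"
    unfolding tensor_M by (simp add: yd_tetramodule_def Let_def)
  then show ?thesis
    using assms by (simp add: M_simps tensor_lift_sweedler[OF H_coalg(1) space_V]
        tensor_lift_sweedler[OF H_coalg(1) H_coalg(1) linear_map_mem[OF H_coalg(2)]])
qed

lemma rcoact_eq: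
  assumes "m \<in> vcarrier M"
  shows "rcoact M m = sweedler H V (M \<otimes>\<^sub>k H) (\<lambda>h v. SH (M \<otimes>\<^sub>k H) (\<lambda>h1 h2.
    SV (M \<otimes>\<^sub>k H) (\<lambda>a b. tens M H (tens H V h1 a) (h2 \<star> b)) (\<delta> v)) (cop H h)) m"
proof -
  have "rcoact M m = tensor_lift (M \<otimes>\<^sub>k H) (\<lambda>h v.
      tensor_op M H (tens H V) (bmult H) (cop H h) (\<delta> v)) m"
    unfolding tensor_op_def tensor_M by (simp add: yd_tetramodule_def Let_def tensor_op_def)
  then show ?thesis
    using assms by (simp add: M_simps tensor_lift_sweedler[OF H_coalg(1) space_V]
        tensor_op_sweedler[OF H_coalg(1) H_coalg(1) linear_map_mem[OF H_coalg(2)]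
          space_V H_coalg(1) linear_map_mem[OF \<delta>_lin]])
qed

lemma lact_bilinear: "bilinear_map H M M (lact M)"
proof (rule bilinear_mapI)
  show "linear_map M M (lact M g)" if "g \<in> vcarrier H" for g
    by (rule linear_map_cong[OF space_M _ lact_eq[symmetric]])
      (insert that, (rule multilin | assumption)+)
  show "linear_map H M (\<lambda>g. lact M g m)" if "m \<in> vcarrier M" for m
    unfolding lact_eq[OF that] by (rule multilin | assumption)+
qed

lemma ract_bilinear: "bilinear_map M H M (ract M)"
proof (rule bilinear_mapI)
  show "linear_map M M (\<lambda>m. ract M m g)" if "g \<in> vcarrier H" for g
    by (rule linear_map_cong[OF space_M _ ract_eq[symmetric]])
      (insert that, (rule multilin | assumption)+)
  show "linear_map H M (ract M m)" if "m \<in> vcarrier M" for m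
    by (rule linear_map_cong[OF H_coalg(1) _ ract_eq[symmetric]])
      (insert that, (rule multilin | assumption)+)
qed

lemma lcoact_lin: "linear_map M (H \<otimes>\<^sub>k M) (lcoact M)"
  by (rule linear_map_cong[OF space_M _ lcoact_eq[symmetric]]) (rule multilin | assumption)+

lemma rcoact_lin: "linear_map M (M \<otimes>\<^sub>k H) (rcoact M)"
  by (rule linear_map_cong[OF space_M _ rcoact_eq[symmetric]]) (rule multilin | assumption)+

lemma lact_tens: "g \<in> vcarrier H \<Longrightarrow> h \<in> vcarrier H \<Longrightarrow> v \<in> vcarrier V \<Longrightarrow>
    lact M g (tens H V h v) = tens H V (g \<star> h) v"
  by (simp add: lact_eq mem_M sweedler_tens multilin)

lemma ract_tens: "g \<in> vcarrier H \<Longrightarrow> h \<in> vcarrier H \<Longrightarrow> v \<in> vcarrier V \<Longrightarrow>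
    ract M (tens H V h v) g = SH M (\<lambda>g1 g2. tens H V (h \<star> g1) (v \<triangleleft> g2)) (cop H g)"
  by (simp add: ract_eq mem_M sweedler_tens multilin)

lemma lcoact_tens: "h \<in> vcarrier H \<Longrightarrow> v \<in> vcarrier V \<Longrightarrow>
    lcoact M (tens H V h v) = SH (H \<otimes>\<^sub>k M) (\<lambda>h1 h2. tens H M h1 (tens H V h2 v)) (cop H h)"
  by (simp add: lcoact_eq mem_M sweedler_tens multilin)

lemma rcoact_tens: "h \<in> vcarrier H \<Longrightarrow> v \<in> vcarrier V \<Longrightarrow>
    rcoact M (tens H V h v) = SH (M \<otimes>\<^sub>k H) (\<lambda>h1 h2.
      SV (M \<otimes>\<^sub>k H) (\<lambda>a b. tens M H (tens H V h1 a) (h2 \<star> b)) (\<delta> v)) (cop H h)"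
  by (simp add: rcoact_eq mem_M sweedler_tens multilin)

lemmas [multilin] =
  bilinear_map_mem[OF lact_bilinear]
  bilinear_map_compose_left[OF lact_bilinear] bilinear_map_compose_right[OF lact_bilinear]
  bilinear_map_mem[OF ract_bilinear]
  bilinear_map_compose_left[OF ract_bilinear] bilinear_map_compose_right[OF ract_bilinear]
  linear_map_mem[OF lcoact_lin] linear_map_compose[OF lcoact_lin]
  linear_map_mem[OF rcoact_lin] linear_map_compose[OF rcoact_lin]

lemmas pure = lact_tens ract_tens lcoact_tens rcoact_tens sweedler_tens sweedler_sweedler

lemmas push_lact = sweedler_push[OF bilinear_map_right[OF lact_bilinear] space_M space_M]
lemmas push_ract = sweedler_push[OF bilinear_map_left[OF ract_bilinear] space_M space_M]
lemmas push_lcoact = sweedler_push[OF lcoact_lin space_M is_space_tensor]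
lemmas push_rcoact = sweedler_push[OF rcoact_lin space_M is_space_tensor]

section \<open>Bimodule axioms\<close>

lemma ract_assoc:
  assumes "m \<in> vcarrier M" "g \<in> vcarrier H" "k \<in> vcarrier H"
  shows "ract M m (g \<star> k) = ract M (ract M m g) k"
proof (rule M_ext[OF _ _ space_M _ assms(1)])
  fix h v assume hv: "h \<in> vcarrier H" "v \<in> vcarrier V"
  have b: "bilinear_map H H M (\<lambda>g1 g2. tens H V (h \<star> g1) (v \<triangleleft> g2))"
    by (insert hv, (rule multilin | assumption)+)
  show "ract M (tens H V h v) (g \<star> k) = ract M (ract M (tens H V h v) g) k"
    using assms hv
    by (simp add: pure push_ract cop_mult_sweedler_H[OF space_M b] multilin H_alg(4) act_mult)
qed (insert assms, (rule multilin | assumption)+)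

lemma lact_ract:
  assumes "m \<in> vcarrier M" "g \<in> vcarrier H" "k \<in> vcarrier H"
  shows "ract M (lact M g m) k = lact M g (ract M m k)"
proof (rule M_ext[OF _ _ space_M _ assms(1)])
  fix h v assume hv: "h \<in> vcarrier H" "v \<in> vcarrier V"
  show "ract M (lact M g (tens H V h v)) k = lact M g (ract M (tens H V h v) k)"
    using assms hv by (simp add: pure push_lact multilin H_alg(4))
qed (insert assms, (rule multilin | assumption)+)

lemma bimodule: "is_bimodule H M"
  unfolding is_bimodule_def
proof (intro conjI ballI space_M lact_bilinear ract_bilinear ract_assoc lact_ract)
  fix m assume m: "m \<in> vcarrier M"
  show "lact M (bone H) m = m"
    by (rule M_ext[OF _ _ space_M _ m]) (rule multilin | assumption | simp add: lact_tens H_alg)+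
  have 1: "bilinear_map H H M (\<lambda>g1 g2. tens H V (h \<star> g1) (v \<triangleleft> g2))"
    if "h \<in> vcarrier H" "v \<in> vcarrier V" for h v
    by (insert that, (rule multilin | assumption)+)
  show "ract M m (bone H) = m"
    by (rule M_ext[OF _ _ space_M _ m])
      (rule multilin | assumption | simp add: ract_tens cop_one sweedler_tens 1 space_M H_coalg(1) H_alg act_one)+
  fix g h assume gh: "g \<in> vcarrier H" "h \<in> vcarrier H"
  show "lact M (g \<star> h) m = lact M g (lact M h m)"
    by (rule M_ext[OF _ _ space_M _ m])
      (insert gh, (rule multilin | assumption | simp add: lact_tens H_alg)+)
qed

section \<open>Bicomodule axioms and compatibility of the coactions with the actions\<close>

lemma lcoact_counit:
  assumes m: "m \<in> vcarrier M"
  shows "tensor_lift M (\<lambda>h n. vscale M (counit H h) n) (lcoact M m) = m"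
proof -
  note [multilin] = bilinear_map_compose_left[OF bilinear_map_scale[OF space_M, unfolded vscale_M]]
    bilinear_map_compose_right[OF bilinear_map_scale[OF space_M, unfolded vscale_M]]
    linear_map_mem[OF H_coalg(3)] H_coalg(3) is_space_scale[OF space_M, unfolded vscale_M]
  show ?thesis
    unfolding tensor_lift_sweedler[OF H_coalg(1) space_M linear_map_mem[OF lcoact_lin m]] vscale_M
  proof (rule M_ext[OF _ _ space_M _ m])
    fix h v assume hv: "h \<in> vcarrier H" "v \<in> vcarrier V"
    show "sweedler H M M (\<lambda>h n. free_scale (counit H h) n) (lcoact M (tens H V h v)) = tens H V h v"
      using hv cop_counit(1)[OF coalgebra_H hv(1) space_M, of "\<lambda>h. tens H V h v"]
      by (simp add: pure multilin)
  qed (insert m, (rule multilin | assumption)+)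
qed

lemma rcoact_counit:
  assumes m: "m \<in> vcarrier M"
  shows "tensor_lift M (\<lambda>n h. vscale M (counit H h) n) (rcoact M m) = m"
proof -
  note [multilin] = bilinear_map_compose_left[OF bilinear_map_scale[OF space_M, unfolded vscale_M]]
    bilinear_map_compose_right[OF bilinear_map_scale[OF space_M, unfolded vscale_M]]
    linear_map_mem[OF H_coalg(3)] H_coalg(3) is_space_scale[OF space_M, unfolded vscale_M]
  show ?thesis
    unfolding tensor_lift_sweedler[OF space_M H_coalg(1) linear_map_mem[OF rcoact_lin m]] vscale_M
  proof (rule M_ext[OF _ _ space_M _ m])
    interpret vector_space "free_scale :: 'k \<Rightarrow> ('h \<times> 'v \<Rightarrow>\<^sub>0 'k) \<Rightarrow> _"
      by (rule vector_space_free_scale)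
    fix h v assume hv: "h \<in> vcarrier H" "v \<in> vcarrier V"
    have s: "linear_map M M (free_scale c)" for c
      using bilinear_map_right[OF bilinear_map_scale[OF space_M] mem_ground] by simp
    \<comment> \<open>After \<epsilon>(h2 b) = \<epsilon>(h2)\<epsilon>(b), the counit law of
      \<delta> collapses the inner sum; the factor \<epsilon>(h2) is left for the counit law of
      \<open>H\<close>.\<close>
    have 1: "SV M (\<lambda>a b. free_scale (counit H h2 * counit H b) (tens H V h1 a)) (\<delta> v) =
      free_scale (counit H h2) (tens H V h1 v)" if "h1 \<in> vcarrier H" "h2 \<in> vcarrier H" for h1 h2
    proof -
      have "tens H V h1 (SV V (\<lambda>a b. vscale V (counit H b) a) (\<delta> v)) =
          SV M (\<lambda>a b. free_scale (counit H b) (tens H V h1 a)) (\<delta> v)"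
        using that by (simp add: sweedler_push[OF bilinear_map_right[OF tens_M] space_V space_M]
            is_space_scale[OF space_V] tens_bilinear)
      then show ?thesis
        using hv that sweedler_push[OF s space_M space_M, of V H "\<lambda>a b. free_scale (counit H b) (tens H V h1 a)" _ "\<delta> v"]
        by (simp add: \<delta>_counit is_space_scale[OF space_M, simplified] mem_M)
    qed
    show "sweedler M H M (\<lambda>n h. free_scale (counit H h) n) (rcoact M (tens H V h v)) = tens H V h v"
      using hv cop_counit(2)[OF coalgebra_H hv(1) space_M, of "\<lambda>h. tens H V h v"]
      by (simp add: pure multilin counit_mult 1)
  qed (insert m, (rule multilin | assumption)+)
qed

lemma lcoact_coassoc:
  assumes m: "m \<in> vcarrier M"
  shows "tensor_assoc H H M (tensor_map (H \<otimes>\<^sub>k H) M (cop H) id (lcoact M m)) =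
    tensor_map H (H \<otimes>\<^sub>k M) id (lcoact M) (lcoact M m)"
  unfolding tensor_assoc_map_sweedler[OF H_coalg(1) H_coalg(1) H_coalg(1) space_M H_coalg(2) linear_map_mem[OF lcoact_lin m]]
    tensor_map_id_sweedler[OF space_M H_coalg(1) H_coalg(1) space_M lcoact_lin linear_map_mem[OF lcoact_lin m]]
proof (rule M_ext[OF _ _ is_space_tensor _ m])
  let ?Z = "H \<otimes>\<^sub>k (H \<otimes>\<^sub>k M)"
  fix h v assume hv: "h \<in> vcarrier H" "v \<in> vcarrier V"
  have "SH ?Z (\<lambda>h1 h2. SH ?Z (\<lambda>a b. tens H (H \<otimes>\<^sub>k M) a (tens H M b (tens H V h2 v))) (cop H h1)) (cop H h) =
    SH ?Z (\<lambda>h1 h2. SH ?Z (\<lambda>a b. tens H (H \<otimes>\<^sub>k M) h1 (tens H M a (tens H V b v))) (cop H h2)) (cop H h)"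
    by (rule cop_coassoc[OF coalgebra_H hv(1) is_space_tensor]) (insert hv, (rule multilin | assumption)+)
  then show "sweedler H M ?Z (\<lambda>x d. SH ?Z (\<lambda>a b. tens H (H \<otimes>\<^sub>k M) a (tens H M b d)) (cop H x)) (lcoact M (tens H V h v)) =
    sweedler H M ?Z (\<lambda>a y. sweedler H M ?Z (\<lambda>b d. tens H (H \<otimes>\<^sub>k M) a (tens H M b d)) (lcoact M y)) (lcoact M (tens H V h v))"
    using hv by (simp add: pure multilin)
qed (insert m, (rule multilin | assumption)+)

lemma lcoact_lact:
  assumes m: "m \<in> vcarrier M" and g: "g \<in> vcarrier H"
  shows "lcoact M (lact M g m) = tensor_op H M (bmult H) (lact M) (cop H g) (lcoact M m)"
  unfolding tensor_op_sweedler[OF H_coalg(1) H_coalg(1) linear_map_mem[OF H_coalg(2) g] H_coalg(1) space_M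
      linear_map_mem[OF lcoact_lin m]]
proof (rule M_ext[OF _ _ is_space_tensor _ m])
  fix h v assume hv: "h \<in> vcarrier H" "v \<in> vcarrier V"
  have b: "bilinear_map H H (H \<otimes>\<^sub>k M) (\<lambda>x y. tens H M x (tens H V y v))"
    by (insert hv, (rule multilin | assumption)+)
  show "lcoact M (lact M g (tens H V h v)) = SH (H \<otimes>\<^sub>k M) (\<lambda>g1 g2.
      sweedler H M (H \<otimes>\<^sub>k M) (\<lambda>h' n. tens H M (g1 \<star> h') (lact M g2 n)) (lcoact M (tens H V h v))) (cop H g)"
    using hv g by (simp add: pure multilin cop_mult_sweedler_H[OF is_space_tensor b])
qed (insert g, (rule multilin | assumption)+)

text \<open>The coaction is codiagonal, so its coassociativity comes from that of \<delta> and that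
  of the coproduct of \<open>H\<close> in turn. The independent sums over \<open>v\<close> and
  \<open>h\<close> are exchanged before and after, to bring the relevant pair together.\<close>

lemma rcoact_coassoc:
  assumes m: "m \<in> vcarrier M"
  shows "tensor_assoc M H H (tensor_map (M \<otimes>\<^sub>k H) H (rcoact M) id (rcoact M m)) =
    tensor_map M (H \<otimes>\<^sub>k H) id (cop H) (rcoact M m)"
  unfolding tensor_assoc_map_sweedler[OF space_M space_M H_coalg(1) H_coalg(1) rcoact_lin linear_map_mem[OF rcoact_lin m]]
    tensor_map_id_sweedler[OF H_coalg(1) space_M H_coalg(1) H_coalg(1) H_coalg(2) linear_map_mem[OF rcoact_lin m]]
proof (rule M_ext[OF _ _ is_space_tensor _ m])
  let ?Z = "M \<otimes>\<^sub>k (H \<otimes>\<^sub>k H)"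
  let ?t = "\<lambda>m a b. tens M (H \<otimes>\<^sub>k H) m (tens H H a b)"
  fix h v assume hv: "h \<in> vcarrier H" "v \<in> vcarrier V"
  have b: "bilinear_map H H ?Z (\<lambda>c d. ?t m c d)" if "m \<in> vcarrier M" for m
    by (insert that, (rule multilin | assumption)+)
  have "SH ?Z (\<lambda>h1 h2. SV ?Z (\<lambda>a b. SH ?Z (\<lambda>k1 k2. SV ?Z
      (\<lambda>a0 a1. ?t (tens H V k1 a0) (k2 \<star> a1) (h2 \<star> b)) (\<delta> a)) (cop H h1)) (\<delta> v)) (cop H h) =
    SH ?Z (\<lambda>h1 h2. SH ?Z (\<lambda>k1 k2. SV ?Z (\<lambda>a b. SV ?Z
      (\<lambda>a0 a1. ?t (tens H V k1 a0) (k2 \<star> a1) (h2 \<star> b)) (\<delta> a)) (\<delta> v)) (cop H h1)) (cop H h)"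
    by (subst sweedler_swap[OF is_space_tensor, of _ _ _ _ _ _ _ "\<delta> v"]) (rule refl)
  also have "\<dots> = SH ?Z (\<lambda>h1 h2. SH ?Z (\<lambda>k1 k2. SV ?Z (\<lambda>a b. SH ?Z
      (\<lambda>b1 b2. ?t (tens H V k1 a) (k2 \<star> b1) (h2 \<star> b2)) (cop H b)) (\<delta> v)) (cop H h1)) (cop H h)"
    by (rule sweedler_cong[OF refl], rule sweedler_cong[OF refl], rule \<delta>_coassoc_sweedler[OF hv(2) is_space_tensor])
      (rule multilin | assumption)+
  also have "\<dots> = SH ?Z (\<lambda>h1 h2. SH ?Z (\<lambda>k1 k2. SV ?Z (\<lambda>a b. SH ?Z
      (\<lambda>b1 b2. ?t (tens H V h1 a) (k1 \<star> b1) (k2 \<star> b2)) (cop H b)) (\<delta> v)) (cop H h2)) (cop H h)"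
    by (rule cop_coassoc[OF coalgebra_H hv(1) is_space_tensor]) (insert hv, (rule multilin | assumption)+)
  also have "\<dots> = SH ?Z (\<lambda>h1 h2. SV ?Z (\<lambda>a b. SH ?Z (\<lambda>k1 k2. SH ?Z
      (\<lambda>b1 b2. ?t (tens H V h1 a) (k1 \<star> b1) (k2 \<star> b2)) (cop H b)) (cop H h2)) (\<delta> v)) (cop H h)"
    by (subst sweedler_swap[OF is_space_tensor, of _ _ _ _ _ _ _ "\<delta> v"]) (rule refl)
  finally show "sweedler M H ?Z (\<lambda>x d. sweedler M H ?Z (\<lambda>a b. ?t a b d) (rcoact M x)) (rcoact M (tens H V h v)) =
    sweedler M H ?Z (\<lambda>a y. SH ?Z (\<lambda>b d. ?t a b d) (cop H y)) (rcoact M (tens H V h v))"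
    using hv by (simp add: pure multilin cop_mult_sweedler_H[OF is_space_tensor b])
qed (insert m, (rule multilin | assumption)+)

text \<open>Normal form h1 \<otimes> ((h2 \<otimes> v0) \<otimes> h3 v1) of the joint coaction. Both
  the bicomodule axiom relating the two coactions and the formula prescribed for the joint coaction
  are compared with it.\<close>

lemma joint_coact_sweedler:
  assumes m: "m \<in> vcarrier M"
  shows "tensor_map H (M \<otimes>\<^sub>k H) id (rcoact M) (lcoact M m) =
    sweedler H V (H \<otimes>\<^sub>k (M \<otimes>\<^sub>k H)) (\<lambda>h v. SH (H \<otimes>\<^sub>k (M \<otimes>\<^sub>k H)) (\<lambda>h1 h2.
      SH (H \<otimes>\<^sub>k (M \<otimes>\<^sub>k H)) (\<lambda>k1 k2. SV (H \<otimes>\<^sub>k (M \<otimes>\<^sub>k H)) (\<lambda>a b.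
        tens H (M \<otimes>\<^sub>k H) h1 (tens M H (tens H V k1 a) (k2 \<star> b))) (\<delta> v)) (cop H h2)) (cop H h)) m"
  unfolding tensor_map_id_sweedler[OF space_M H_coalg(1) space_M H_coalg(1) rcoact_lin linear_map_mem[OF lcoact_lin m]]
proof (rule M_ext[OF _ _ is_space_tensor _ m])
  let ?Z = "H \<otimes>\<^sub>k (M \<otimes>\<^sub>k H)"
  fix h v assume hv: "h \<in> vcarrier H" "v \<in> vcarrier V"
  show "sweedler H M ?Z (\<lambda>a y. sweedler M H ?Z (\<lambda>b d. tens H (M \<otimes>\<^sub>k H) a (tens M H b d)) (rcoact M y)) (lcoact M (tens H V h v)) =
    sweedler H V ?Z (\<lambda>h v. SH ?Z (\<lambda>h1 h2.
      SH ?Z (\<lambda>k1 k2. SV ?Z (\<lambda>a b.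
        tens H (M \<otimes>\<^sub>k H) h1 (tens M H (tens H V k1 a) (k2 \<star> b))) (\<delta> v)) (cop H h2)) (cop H h)) (tens H V h v)"
    using hv by (simp add: pure multilin)
qed (insert m, (rule multilin | assumption)+)

text \<open>Coacting on the right first groups the legs of \<open>h\<close> as (12)3, the normal
  form groups them as 1(23). Once the sum over \<delta> is moved inward, coassociativity of
  \<open>H\<close> applies.\<close>

lemma lcoact_rcoact:
  assumes m: "m \<in> vcarrier M"
  shows "tensor_assoc H M H (tensor_map (H \<otimes>\<^sub>k M) H (lcoact M) id (rcoact M m)) =
    tensor_map H (M \<otimes>\<^sub>k H) id (rcoact M) (lcoact M m)"
  unfolding joint_coact_sweedler[OF m]
    tensor_assoc_map_sweedler[OF space_M H_coalg(1) space_M H_coalg(1) lcoact_lin linear_map_mem[OF rcoact_lin m]]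
proof (rule M_ext[OF _ _ is_space_tensor _ m])
  let ?Z = "H \<otimes>\<^sub>k (M \<otimes>\<^sub>k H)"
  let ?t = "\<lambda>h a b. tens H (M \<otimes>\<^sub>k H) h (tens M H a b)"
  fix h v assume hv: "h \<in> vcarrier H" "v \<in> vcarrier V"
  have "SH ?Z (\<lambda>h1 h2. SV ?Z (\<lambda>a b. SH ?Z
      (\<lambda>k1 k2. ?t k1 (tens H V k2 a) (h2 \<star> b)) (cop H h1)) (\<delta> v)) (cop H h) =
    SH ?Z (\<lambda>h1 h2. SH ?Z (\<lambda>k1 k2. SV ?Z
      (\<lambda>a b. ?t k1 (tens H V k2 a) (h2 \<star> b)) (\<delta> v)) (cop H h1)) (cop H h)"
    by (subst sweedler_swap[OF is_space_tensor, of _ _ _ _ _ _ _ "\<delta> v"]) (rule refl)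
  also have "\<dots> = SH ?Z (\<lambda>h1 h2. SH ?Z (\<lambda>k1 k2. SV ?Z
      (\<lambda>a b. ?t h1 (tens H V k1 a) (k2 \<star> b)) (\<delta> v)) (cop H h2)) (cop H h)"
    by (rule cop_coassoc[OF coalgebra_H hv(1) is_space_tensor]) (insert hv, (rule multilin | assumption)+)
  finally show "sweedler M H ?Z (\<lambda>x d. sweedler H M ?Z (\<lambda>a b. ?t a b d) (lcoact M x)) (rcoact M (tens H V h v)) =
    sweedler H V ?Z (\<lambda>h v. SH ?Z (\<lambda>h1 h2. SH ?Z (\<lambda>k1 k2. SV ?Z (\<lambda>a b.
        ?t h1 (tens H V k1 a) (k2 \<star> b)) (\<delta> v)) (cop H h2)) (cop H h)) (tens H V h v)"
    using hv by (simp add: pure multilin)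
qed (insert m, (rule multilin | assumption)+)

lemma bicomodule: "is_bicomodule H M"
  unfolding is_bicomodule_def
  by (intro conjI ballI space_M lcoact_lin rcoact_lin lcoact_counit rcoact_counit lcoact_coassoc
      rcoact_coassoc lcoact_rcoact)

text \<open>Both sides are h1 g1 \<otimes> (h2 g2 \<otimes> v \<triangleleft> g3); coassociativity
  supplies the rebracketing of the legs of \<open>g\<close>.\<close>

lemma lcoact_ract:
  assumes m: "m \<in> vcarrier M" and g: "g \<in> vcarrier H"
  shows "lcoact M (ract M m g) = tensor_op H M (bmult H) (ract M) (lcoact M m) (cop H g)"
  unfolding tensor_op_sweedler[OF H_coalg(1) space_M linear_map_mem[OF lcoact_lin m] H_coalg(1) H_coalg(1)
      linear_map_mem[OF H_coalg(2) g]]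
proof (rule M_ext[OF _ _ is_space_tensor _ m])
  let ?Z = "H \<otimes>\<^sub>k M"
  fix h v assume hv: "h \<in> vcarrier H" "v \<in> vcarrier V"
  have b: "bilinear_map H H ?Z (\<lambda>x y. tens H M x (tens H V y v))" if "v \<in> vcarrier V" for v
    by (insert that, (rule multilin | assumption)+)
  have "SH ?Z (\<lambda>g1 g2. SH ?Z (\<lambda>h1 h2. SH ?Z (\<lambda>k1 k2.
      tens H M (h1 \<star> k1) (tens H V (h2 \<star> k2) (v \<triangleleft> g2))) (cop H g1)) (cop H h)) (cop H g) =
    SH ?Z (\<lambda>h1 h2. SH ?Z (\<lambda>g1 g2. SH ?Z (\<lambda>k1 k2.
      tens H M (h1 \<star> k1) (tens H V (h2 \<star> k2) (v \<triangleleft> g2))) (cop H g1)) (cop H g)) (cop H h)"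
    by (subst sweedler_swap[OF is_space_tensor]) (rule refl)
  also have "\<dots> = SH ?Z (\<lambda>h1 h2. SH ?Z (\<lambda>g1 g2. SH ?Z (\<lambda>k1 k2.
      tens H M (h1 \<star> g1) (tens H V (h2 \<star> k1) (v \<triangleleft> k2))) (cop H g2)) (cop H g)) (cop H h)"
    by (rule sweedler_cong[OF refl], rule cop_coassoc[OF coalgebra_H g is_space_tensor])
      (insert hv, (rule multilin | assumption)+)
  finally have eq: "SH ?Z (\<lambda>g1 g2. SH ?Z (\<lambda>h1 h2. SH ?Z (\<lambda>k1 k2.
      tens H M (h1 \<star> k1) (tens H V (h2 \<star> k2) (v \<triangleleft> g2))) (cop H g1)) (cop H h)) (cop H g) = \<dots>" .
  have p: "tens H M x (SH M (\<lambda>k1 k2. tens H V (y \<star> k1) (v \<triangleleft> k2)) t) =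
      SH ?Z (\<lambda>k1 k2. tens H M x (tens H V (y \<star> k1) (v \<triangleleft> k2))) t"
    if "x \<in> vcarrier H" "y \<in> vcarrier H" for x y t
    using that hv by (simp add: sweedler_push[OF bilinear_map_right[OF bilinear_tens] space_M is_space_tensor] multilin)
  show "lcoact M (ract M (tens H V h v) g) = sweedler H M ?Z (\<lambda>h' n.
      SH ?Z (\<lambda>g1 g2. tens H M (h' \<star> g1) (ract M n g2)) (cop H g)) (lcoact M (tens H V h v))"
    using hv g eq by (simp add: pure push_lcoact multilin cop_mult_sweedler_H[OF is_space_tensor b] p)
qed (insert g, (rule multilin | assumption)+)

lemma rcoact_lact:
  assumes m: "m \<in> vcarrier M" and g: "g \<in> vcarrier H"
  shows "rcoact M (lact M g m) = tensor_op M H (lact M) (bmult H) (cop H g) (rcoact M m)"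
  unfolding tensor_op_sweedler[OF H_coalg(1) H_coalg(1) linear_map_mem[OF H_coalg(2) g] space_M H_coalg(1)
      linear_map_mem[OF rcoact_lin m]]
proof (rule M_ext[OF _ _ is_space_tensor _ m])
  let ?Z = "M \<otimes>\<^sub>k H"
  fix h v assume hv: "h \<in> vcarrier H" "v \<in> vcarrier V"
  have b: "bilinear_map H H ?Z (\<lambda>x y. SV ?Z (\<lambda>a b. tens M H (tens H V x a) (y \<star> b)) (\<delta> v))"
    by (insert hv, (rule multilin | assumption)+)
  show "rcoact M (lact M g (tens H V h v)) = SH ?Z (\<lambda>g1 g2.
      sweedler M H ?Z (\<lambda>n h'. tens M H (lact M g1 n) (g2 \<star> h')) (rcoact M (tens H V h v))) (cop H g)"
    using hv g by (simp add: pure multilin cop_mult_sweedler_H[OF is_space_tensor b] H_alg(4))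
qed (insert g, (rule multilin | assumption)+)

text \<open>The axiom in which \<delta> meets the action. With three legs of \<open>g\<close>, the
  left side is h1 g1 \<otimes> (v \<triangleleft> g3)0 \<otimes> h2 g2 (v \<triangleleft> g3)1. The
  Yetter-Drinfeld condition for the legs g2, g3 turns it into h1 g1 \<otimes> v0 \<triangleleft> g2
  \<otimes> h2 v1 g3, which is the right side.\<close>

lemma rcoact_ract:
  assumes m: "m \<in> vcarrier M" and g: "g \<in> vcarrier H"
  shows "rcoact M (ract M m g) = tensor_op M H (ract M) (bmult H) (rcoact M m) (cop H g)"
  unfolding tensor_op_sweedler[OF space_M H_coalg(1) linear_map_mem[OF rcoact_lin m] H_coalg(1) H_coalg(1)
      linear_map_mem[OF H_coalg(2) g]]
proof (rule M_ext[OF _ _ is_space_tensor _ m])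
  let ?Z = "M \<otimes>\<^sub>k H"
  fix h v assume hv: "h \<in> vcarrier H" "v \<in> vcarrier V"
  have b: "bilinear_map H H ?Z (\<lambda>x y. SV ?Z (\<lambda>a b. tens M H (tens H V x a) (y \<star> b)) (\<delta> v))"
    if "v \<in> vcarrier V" for v
    by (insert that, (rule multilin | assumption)+)
  have "SH ?Z (\<lambda>g1 g2. SH ?Z (\<lambda>h1 h2. SH ?Z (\<lambda>k1 k2. SV ?Z
      (\<lambda>a b. tens M H (tens H V (h1 \<star> k1) a) (h2 \<star> (k2 \<star> b))) (\<delta> (v \<triangleleft> g2))) (cop H g1)) (cop H h)) (cop H g) =
    SH ?Z (\<lambda>h1 h2. SH ?Z (\<lambda>g1 g2. SH ?Z (\<lambda>k1 k2. SV ?Z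
      (\<lambda>a b. tens M H (tens H V (h1 \<star> k1) a) (h2 \<star> (k2 \<star> b))) (\<delta> (v \<triangleleft> g2))) (cop H g1)) (cop H g)) (cop H h)"
    by (subst sweedler_swap[OF is_space_tensor]) (rule refl)
  also have "\<dots> = SH ?Z (\<lambda>h1 h2. SH ?Z (\<lambda>g1 g2. SH ?Z (\<lambda>k1 k2. SV ?Z
      (\<lambda>a b. tens M H (tens H V (h1 \<star> g1) a) (h2 \<star> (k1 \<star> b))) (\<delta> (v \<triangleleft> k2))) (cop H g2)) (cop H g)) (cop H h)"
    by (rule sweedler_cong[OF refl], rule cop_coassoc[OF coalgebra_H g is_space_tensor])
      (insert hv, (rule multilin | assumption)+)
  \<comment> \<open>After the rebracketing, \<open>k1\<close> and \<open>k2\<close> form the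
    coproduct of the single leg \<open>g2\<close>, as the Yetter-Drinfeld condition
    requires.\<close>
  also have "\<dots> = SH ?Z (\<lambda>h1 h2. SH ?Z (\<lambda>g1 g2. SH ?Z (\<lambda>k1 k2. SV ?Z
      (\<lambda>a b. tens M H (tens H V (h1 \<star> g1) (a \<triangleleft> k1)) (h2 \<star> (b \<star> k2))) (\<delta> v)) (cop H g2)) (cop H g)) (cop H h)"
    by (rule sweedler_cong[OF refl], rule sweedler_cong[OF refl], rule yetter_drinfeld_sweedler[OF hv(2) _ is_space_tensor])
      (rule multilin | assumption)+
  also have "\<dots> = SH ?Z (\<lambda>h1 h2. SH ?Z (\<lambda>g1 g2. SH ?Z (\<lambda>k1 k2. SV ?Z
      (\<lambda>a b. tens M H (tens H V (h1 \<star> k1) (a \<triangleleft> k2)) (h2 \<star> (b \<star> g2))) (\<delta> v)) (cop H g1)) (cop H g)) (cop H h)"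
    by (rule sweedler_cong[OF refl], rule cop_coassoc[OF coalgebra_H g is_space_tensor, symmetric])
      (insert hv, (rule multilin | assumption)+)
  \<comment> \<open>This exchange and the next carry the sum over \<delta> outside the sums over
    \<open>g\<close>, the order in which one coacts before acting.\<close>
  also have "\<dots> = SH ?Z (\<lambda>h1 h2. SH ?Z (\<lambda>g1 g2. SV ?Z (\<lambda>a b. SH ?Z
      (\<lambda>k1 k2. tens M H (tens H V (h1 \<star> k1) (a \<triangleleft> k2)) (h2 \<star> (b \<star> g2))) (cop H g1)) (\<delta> v)) (cop H g)) (cop H h)"
    by (rule sweedler_cong[OF refl], rule sweedler_cong[OF refl], rule sweedler_swap[OF is_space_tensor])
  also have "\<dots> = SH ?Z (\<lambda>h1 h2. SV ?Z (\<lambda>a b. SH ?Z (\<lambda>g1 g2. SH ?Z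
      (\<lambda>k1 k2. tens M H (tens H V (h1 \<star> k1) (a \<triangleleft> k2)) (h2 \<star> (b \<star> g2))) (cop H g1)) (cop H g)) (\<delta> v)) (cop H h)"
    by (rule sweedler_cong[OF refl], rule sweedler_swap[OF is_space_tensor])
  finally have eq: "SH ?Z (\<lambda>g1 g2. SH ?Z (\<lambda>h1 h2. SH ?Z (\<lambda>k1 k2. SV ?Z
      (\<lambda>a b. tens M H (tens H V (h1 \<star> k1) a) (h2 \<star> (k2 \<star> b))) (\<delta> (v \<triangleleft> g2))) (cop H g1)) (cop H h)) (cop H g) = \<dots>" .
  have p: "tens M H (SH M (\<lambda>k1 k2. tens H V (x \<star> k1) (a \<triangleleft> k2)) t) y =
      SH ?Z (\<lambda>k1 k2. tens M H (tens H V (x \<star> k1) (a \<triangleleft> k2)) y) t"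
    if "x \<in> vcarrier H" "y \<in> vcarrier H" "a \<in> vcarrier V" for x y t a
    using that by (simp add: sweedler_push[OF bilinear_map_left[OF bilinear_tens] space_M is_space_tensor] multilin)
  show "rcoact M (ract M (tens H V h v) g) = sweedler M H ?Z (\<lambda>n h'.
      SH ?Z (\<lambda>g1 g2. tens M H (ract M n g1) (h' \<star> g2)) (cop H g)) (rcoact M (tens H V h v))"
    using hv g eq by (simp add: pure push_rcoact multilin cop_mult_sweedler_H[OF is_space_tensor b] p H_alg(4))
qed (insert g, (rule multilin | assumption)+)

lemma tetramodule: "is_tetramodule H M"
  unfolding is_tetramodule_def
  by (intro conjI ballI bimodule bicomodule lcoact_lact lcoact_ract rcoact_lact rcoact_ract)

text \<open>In the prescribed formula \<open>h23\<close> is a general element of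
  \<open>H \<otimes> H\<close>. Expanding \<open>tensor_op\<close> linearly in it and evaluating at
  \<open>cop H h2\<close> leads to the normal form.\<close>

lemma joint_coact:
  assumes m: "m \<in> vcarrier M"
  shows "tensor_map H (M \<otimes>\<^sub>k H) id (rcoact M) (lcoact M m) =
    tensor_lift (H \<otimes>\<^sub>k (M \<otimes>\<^sub>k H)) (\<lambda>h v. tensor_lift (H \<otimes>\<^sub>k (M \<otimes>\<^sub>k H)) (\<lambda>h1 h23.
        tens H (M \<otimes>\<^sub>k H) h1 (tensor_op M H (tens H V) (bmult H) h23 (\<delta> v)))
      (tensor_map H (H \<otimes>\<^sub>k H) id (cop H) (cop H h))) m"
proof -
  let ?Z = "H \<otimes>\<^sub>k (M \<otimes>\<^sub>k H)"
  let ?t = "\<lambda>h23 v. SH (M \<otimes>\<^sub>k H) (\<lambda>k1 k2. SV (M \<otimes>\<^sub>k H)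
    (\<lambda>a b. tens M H (tens H V k1 a) (k2 \<star> b)) (\<delta> v)) h23"
  note c = linear_map_mem[OF H_coalg(2)]
  have 1: "tensor_map H (H \<otimes>\<^sub>k H) id (cop H) (cop H h) =
      SH (H \<otimes>\<^sub>k (H \<otimes>\<^sub>k H)) (\<lambda>a b. tens H (H \<otimes>\<^sub>k H) a (cop H b)) (cop H h)" if "h \<in> vcarrier H" for h
    using tensor_map_sweedler[OF H_coalg(1) H_coalg(1) c[OF that], of H "H \<otimes>\<^sub>k H" id "cop H"] by simp
  have 2: "tensor_map H (H \<otimes>\<^sub>k H) id (cop H) (cop H h) \<in> vcarrier (H \<otimes>\<^sub>k (H \<otimes>\<^sub>k H))" if "h \<in> vcarrier H" for h
    unfolding 1[OF that] by (rule multilin | assumption)+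
  have 3: "tensor_op M H (tens H V) (bmult H) h23 (\<delta> v) = ?t h23 v"
    if "h23 \<in> vcarrier (H \<otimes>\<^sub>k H)" "v \<in> vcarrier V" for h23 v
    by (rule tensor_op_sweedler[OF H_coalg(1) H_coalg(1) that(1) space_V H_coalg(1) linear_map_mem[OF \<delta>_lin that(2)]])
  have 4: "bilinear_map H (H \<otimes>\<^sub>k H) ?Z (\<lambda>h1 h23. tens H (M \<otimes>\<^sub>k H) h1 (?t h23 v))" for v
    by (rule multilin | assumption)+
  have 5: "tens H (M \<otimes>\<^sub>k H) h1 (?t h23 v) = SH ?Z (\<lambda>k1 k2. SV ?Z
      (\<lambda>a b. tens H (M \<otimes>\<^sub>k H) h1 (tens M H (tens H V k1 a) (k2 \<star> b))) (\<delta> v)) h23"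
    if "h1 \<in> vcarrier H" for h1 h23 v
    using that by (simp add: sweedler_push[OF bilinear_map_right[OF bilinear_tens] is_space_tensor is_space_tensor] multilin)
  have "tensor_lift ?Z (\<lambda>h1 h23. tens H (M \<otimes>\<^sub>k H) h1 (tensor_op M H (tens H V) (bmult H) h23 (\<delta> v)))
      (tensor_map H (H \<otimes>\<^sub>k H) id (cop H) (cop H h)) =
    SH ?Z (\<lambda>h1 h2. SH ?Z (\<lambda>k1 k2. SV ?Z (\<lambda>a b.
        tens H (M \<otimes>\<^sub>k H) h1 (tens M H (tens H V k1 a) (k2 \<star> b))) (\<delta> v)) (cop H h2)) (cop H h)"
    if hv: "h \<in> vcarrier H" "v \<in> vcarrier V" for h v
  proof -
    have "tensor_lift ?Z (\<lambda>h1 h23. tens H (M \<otimes>\<^sub>k H) h1 (tensor_op M H (tens H V) (bmult H) h23 (\<delta> v)))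
        (tensor_map H (H \<otimes>\<^sub>k H) id (cop H) (cop H h)) =
      sweedler H (H \<otimes>\<^sub>k H) ?Z (\<lambda>h1 h23. tens H (M \<otimes>\<^sub>k H) h1 (?t h23 v))
        (tensor_map H (H \<otimes>\<^sub>k H) id (cop H) (cop H h))"
      unfolding tensor_lift_sweedler[OF H_coalg(1) is_space_tensor 2[OF hv(1)]]
      by (rule sweedler_cong[OF refl]) (simp only: 3 hv)
    also have "\<dots> = SH ?Z (\<lambda>h1 h2. tens H (M \<otimes>\<^sub>k H) h1 (?t (cop H h2) v)) (cop H h)"
      unfolding 1[OF hv(1)] sweedler_sweedler[OF is_space_tensor vscale_tensor]
      by (rule sweedler_cong[OF refl]) (rule sweedler_tens[OF H_coalg(1) is_space_tensor is_space_tensor 4], assumption, rule c)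
    also have "\<dots> = SH ?Z (\<lambda>h1 h2. SH ?Z (\<lambda>k1 k2. SV ?Z (\<lambda>a b.
        tens H (M \<otimes>\<^sub>k H) h1 (tens M H (tens H V k1 a) (k2 \<star> b))) (\<delta> v)) (cop H h2)) (cop H h)"
      by (rule sweedler_cong[OF refl]) (rule 5)
    finally show ?thesis .
  qed
  then show ?thesis
    unfolding joint_coact_sweedler[OF m]
    using m by (simp add: M_simps tensor_lift_sweedler[OF H_coalg(1) space_V])
qed

end

text \<open>The conditions on \<theta> are those on \<open>f\<close> at the elements 1 \<otimes> v,
  which generate the left module \<open>H \<otimes> V\<close>: \<open>\<theta>_act\<close> is right
  linearity, because (1 \<otimes> v)g = g1 \<otimes> v \<triangleleft> g2, and
  \<open>\<theta>_cop\<close> is the coderivation rule, because the left coaction is trivial there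
  and the right one is \<delta>.\<close>

locale yetter_drinfeld_map = yetter_drinfeld H V act \<delta>
  for H :: "('k::field, 'h::ab_group_add, 'y) bialgebra_scheme"
    and V :: "('k, 'v::ab_group_add, 'z) space_scheme"
    and act (infixl "\<triangleleft>" 75) and \<delta> +
  fixes \<theta> :: "'v \<Rightarrow> 'h"
  assumes \<theta>_lin: "linear_map V H \<theta>"
    and \<theta>_act: "v \<in> vcarrier V \<Longrightarrow> g \<in> vcarrier H \<Longrightarrow>
      sweedler H H H (\<lambda>g1 g2. bmult H g1 (\<theta> (act v g2))) (cop H g) = bmult H (\<theta> v) g"
    and \<theta>_cop: "v \<in> vcarrier V \<Longrightarrow> cop H (\<theta> v) = tens H H (bone H) (\<theta> v) +
      sweedler V H (H \<otimes>\<^sub>k H) (\<lambda>a b. tens H H (\<theta> a) b) (\<delta> v)"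
begin

abbreviation "f \<equiv> tensor_lift H (\<lambda>s c. bmult H s (\<theta> c))"

lemmas [multilin] = linear_map_mem[OF \<theta>_lin] linear_map_compose[OF \<theta>_lin]

lemma f_lin: "linear_map M H f"
  and f_tens: "h \<in> vcarrier H \<Longrightarrow> v \<in> vcarrier V \<Longrightarrow> f (tens H V h v) = h \<star> \<theta> v"
proof -
  have eq: "f m = sweedler H V H (\<lambda>s c. s \<star> \<theta> c) m" if "m \<in> vcarrier M" for m
    using that by (simp add: M_simps tensor_lift_sweedler[OF H_coalg(1) space_V])
  show "linear_map M H f"
    by (rule linear_map_cong[OF space_M _ eq[symmetric]]) (rule multilin | assumption)+
  show "f (tens H V h v) = h \<star> \<theta> v" if "h \<in> vcarrier H" "v \<in> vcarrier V"
    using that by (simp add: eq sweedler_tens multilin)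
qed

lemmas [multilin] = linear_map_mem[OF f_lin] linear_map_compose[OF f_lin]

lemma bilinear_over: "is_bilinear_over H M f"
  unfolding is_bilinear_over_def
proof (intro conjI ballI)
  fix g m assume g: "g \<in> vcarrier H" and m: "m \<in> vcarrier M"
  show "f (lact M g m) = g \<star> f m"
    by (rule M_ext[OF _ _ H_coalg(1) _ m])
      (insert g, (rule multilin | assumption | simp add: lact_tens f_tens H_alg linear_map_mem[OF \<theta>_lin])+)
  show "f (ract M m g) = f m \<star> g"
  proof (rule M_ext[OF _ _ H_coalg(1) _ m])
    fix h v assume hv: "h \<in> vcarrier H" "v \<in> vcarrier V"
    have "SH H (\<lambda>g1 g2. h \<star> (g1 \<star> \<theta> (v \<triangleleft> g2))) (cop H g) =
        h \<star> SH H (\<lambda>g1 g2. g1 \<star> \<theta> (v \<triangleleft> g2)) (cop H g)"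
      using hv by (simp add: sweedler_push[OF bilinear_map_right[OF H_alg(2)] H_coalg(1) H_coalg(1)] multilin)
    then show "f (ract M (tens H V h v) g) = f (tens H V h v) \<star> g"
      using hv g by (simp add: ract_tens sweedler_push[OF f_lin space_M H_coalg(1)] f_tens multilin H_alg(4) \<theta>_act)
  qed (insert g, (rule multilin | assumption)+)
qed

text \<open>The coproduct of h \<theta>(v) is \<Delta>(h)\<Delta>(\<theta>(v)). Of the two summands
  of \<Delta>(\<theta>(v)), the first yields the term of the left coaction and the second that of
  the right coaction.\<close>

lemma coderivation: "is_coderivation H M f"
  unfolding is_coderivation_def
proof (intro conjI ballI f_lin)
  let ?Z = "H \<otimes>\<^sub>k H"
  fix m assume m: "m \<in> vcarrier M"
  note HH = is_algebraD[OF is_algebra_tensor[OF algebra_H algebra_H]]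
  note pure_op = tensor_op_tens[OF H_coalg(1) H_coalg(1) H_coalg(1) H_coalg(1) H_coalg(1) H_coalg(1) H_alg(2) H_alg(2)]
  show "cop H (f m) = tensor_map H H id f (lcoact M m) + tensor_map H H f id (rcoact M m)"
    unfolding tensor_map_sweedler[OF H_coalg(1) space_M linear_map_mem[OF lcoact_lin m]]
      tensor_map_sweedler[OF space_M H_coalg(1) linear_map_mem[OF rcoact_lin m]] id_apply
  proof (rule M_ext[OF _ _ is_space_tensor _ m])
    fix h v assume hv: "h \<in> vcarrier H" "v \<in> vcarrier V"
    have b: "bilinear_map H H ?Z (\<lambda>h1 h2. tens H H h1 (h2 \<star> \<theta> v))"
      by (insert hv, (rule multilin | assumption)+)
    \<comment> \<open>By \<open>sweedler_eta\<close>, \<open>cop H h\<close> is a Sweedler sum of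
      pure tensors, on which multiplication by 1 \<otimes> \<theta>(v) is componentwise.\<close>
    have 1: "tensor_op H H (bmult H) (bmult H) (cop H h) (tens H H (bone H) (\<theta> v)) =
      SH ?Z (\<lambda>h1 h2. tens H H h1 (h2 \<star> \<theta> v)) (cop H h)"
      using sweedler_push[OF bilinear_map_left[OF HH(2), of "tens H H (bone H) (\<theta> v)"] HH(1) HH(1),
          where t = "cop H h" and F = "tens H H" and V = H and W = H]
      by (simp add: hv multilin sweedler_eta pure_op H_alg(6))
    have 2: "tensor_op H H (bmult H) (bmult H) (cop H h) (SV ?Z (\<lambda>a b. tens H H (\<theta> a) b) (\<delta> v)) =
      SH ?Z (\<lambda>h1 h2. SV ?Z (\<lambda>a b. tens H H (h1 \<star> \<theta> a) (h2 \<star> b)) (\<delta> v)) (cop H h)"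
      using bilinear_sweedler[OF HH(2) HH(1) HH(1) HH(1), where f = "tens H H" and V = H and W = H and t = "cop H h"
          and V' = V and W' = H and g = "\<lambda>a b. tens H H (\<theta> a) b" and t' = "\<delta> v"]
      by (simp add: hv multilin sweedler_eta pure_op)
    have "cop H (f (tens H V h v)) = tensor_op H H (bmult H) (bmult H) (cop H h) (cop H (\<theta> v))"
      using hv by (simp add: f_tens cop_mult_H multilin)
    also have "\<dots> = SH ?Z (\<lambda>h1 h2. tens H H h1 (h2 \<star> \<theta> v)) (cop H h) +
        SH ?Z (\<lambda>h1 h2. SV ?Z (\<lambda>a b. tens H H (h1 \<star> \<theta> a) (h2 \<star> b)) (\<delta> v)) (cop H h)"
      unfolding \<theta>_cop[OF hv(2)]
      by (subst linear_map_add[OF bilinear_map_right[OF HH(2)]]) (simp_all add: hv multilin 1 2)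
    also have "SH ?Z (\<lambda>h1 h2. tens H H h1 (h2 \<star> \<theta> v)) (cop H h) =
        sweedler H M ?Z (\<lambda>h n. tens H H h (f n)) (lcoact M (tens H V h v))"
      using hv by (simp add: pure multilin f_tens)
    also have "SH ?Z (\<lambda>h1 h2. SV ?Z (\<lambda>a b. tens H H (h1 \<star> \<theta> a) (h2 \<star> b)) (\<delta> v)) (cop H h) =
        sweedler M H ?Z (\<lambda>n h. tens H H (f n) h) (rcoact M (tens H V h v))"
      using hv by (simp add: pure multilin f_tens)
    finally show "cop H (f (tens H V h v)) = sweedler H M ?Z (\<lambda>h n. tens H H h (f n)) (lcoact M (tens H V h v)) +
        sweedler M H ?Z (\<lambda>n h. tens H H (f n) h) (rcoact M (tens H V h v))" .
  qed (rule multilin linear_map_plus | assumption)+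
qed

lemma LM_bialgebra: "is_LM_bialgebra H M f"
  unfolding is_LM_bialgebra_def using bialgebra tetramodule bilinear_over coderivation by blast

end

section \<open>The action of the enveloping algebra\<close>

context cocommutative_rack_bialgebra
begin

abbreviation tact (infixl "\<cdot>" 75) where "y \<cdot> t \<equiv> T_act C y t"
abbreviation "\<delta> \<equiv> ker_coact C"

section \<open>The action of \<open>T\<close> on \<open>C\<close> and its descent to
  \<open>U\<close>\<close>

lemma foldl_lin:
  assumes "xs \<in> lists (vcarrier V)"
  shows "linear_map C C (\<lambda>y. foldl (rack C) y xs)"
  using assms
proof (induction xs)
  case (Cons x xs)
  then have "x \<in> vcarrier C" by (simp add: V_mem)
  then show ?case
    using linear_map_compose[OF Cons.IH bilinear_map_left[OF rack_bilinear]] by simp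
qed (simp add: linear_map_ident)

lemma foldl_word_linear:
  assumes "y \<in> vcarrier C"
  shows "word_linear V C (foldl (rack C) y)"
  unfolding word_linear_def
proof (intro conjI ballI)
  fix xs ys assume xs: "xs \<in> lists (vcarrier V)" and ys: "ys \<in> lists (vcarrier V)"
  show "foldl (rack C) y xs \<in> vcarrier C"
    by (rule linear_map_mem[OF foldl_lin[OF xs] assms])
  then show "linear_map V C (\<lambda>v. foldl (rack C) y (xs @ [v] @ ys))"
    using linear_map_compose[OF foldl_lin[OF ys] linear_map_compose[OF bilinear_map_right[OF rack_bilinear] V_C_lin]]
    by simp
qed

lemma T_act_word: "y \<in> vcarrier C \<Longrightarrow> y \<cdot> word V xs = foldl (rack C) y xs"
  unfolding T_act_def by (rule lin_ext_word[OF space_C foldl_word_linear])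

lemma T_act_bilinear: "bilinear_map C T C (T_act C)"
proof (rule bilinear_mapI)
  show "linear_map T C (T_act C y)" if "y \<in> vcarrier C" for y
    unfolding T_act_def[abs_def]
    by (rule lin_ext_linear_map[OF space_V space_C]) (rule linear_map_mem[OF foldl_lin that])
  fix t assume t: "t \<in> vcarrier T"
  interpret vector_space "vscale C" using space_C by (rule is_space_vector_space)
  note k = subsetD[OF tensor_algebra_keys[OF space_V t]]
  show "linear_map C C (\<lambda>y. y \<cdot> t)"
  proof (rule linear_mapI)
    show "y \<cdot> t \<in> vcarrier C" if "y \<in> vcarrier C" for y
      unfolding T_act_def by (rule lin_ext_mem[OF space_C]) (rule linear_map_mem[OF foldl_lin[OF k] that])
    show "(x + y) \<cdot> t = x \<cdot> t + y \<cdot> t" if "x \<in> vcarrier C" "y \<in> vcarrier C" for x y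
      using linear_map_add[OF foldl_lin[OF k] that]
      by (simp add: T_act_def lin_ext_def sum.distrib scale_right_distrib)
    show "vscale C a x \<cdot> t = vscale C a (x \<cdot> t)" if "x \<in> vcarrier C" for a x
      using linear_map_scale[OF foldl_lin[OF k] that]
      by (simp add: T_act_def lin_ext_def scale_sum_right mult.commute)
  qed
qed

lemma T_act_mult:
  assumes y: "y \<in> vcarrier C" and s: "s \<in> vcarrier T" and t: "t \<in> vcarrier T"
  shows "y \<cdot> mT s t = (y \<cdot> s) \<cdot> t"
proof -
  note L = linear_map_compose[OF bilinear_map_right[OF T_act_bilinear y]]
    bilinear_map_compose_left[OF T_act_bilinear] bilinear_map_compose_right[OF T_act_bilinear]
    bilinear_map_mem[OF T_act_bilinear]
    bilinear_map_compose_left[OF alg_T(2)] bilinear_map_compose_right[OF alg_T(2)] linear_map_ident word_mem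
  show ?thesis
  proof (rule tensor_algebra_ext[OF _ _ space_V space_C _ s])
    fix xs assume xs: "xs \<in> lists (vcarrier V)"
    show "y \<cdot> mT (word V xs) t = (y \<cdot> word V xs) \<cdot> t"
    proof (rule tensor_algebra_ext[OF _ _ space_V space_C _ t])
      show "y \<cdot> mT (word V xs) (word V ys) = (y \<cdot> word V xs) \<cdot> word V ys" if "ys \<in> lists (vcarrier V)" for ys
        using xs that y by (simp add: word_mult_word[OF space_V] T_act_word linear_map_mem[OF foldl_lin])
    qed (insert xs y, (rule L | assumption)+)
  qed (insert y t, (rule L | assumption)+)
qed

lemma T_act_incl:
  assumes y: "y \<in> vcarrier C" and x: "x \<in> vcarrier C"
  shows "y \<cdot> i x = y \<lhd> x"
  by (rule C_ext[OF linear_map_compose[OF bilinear_map_right[OF T_act_bilinear y] incl_lin]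
        bilinear_map_right[OF rack_bilinear y] space_C _ _ x])
    (simp_all add: incl_one incl_V T_act_word y rack_one)

text \<open>The annihilator of the module \<open>C\<close> is a two-sided ideal. It contains the
  relators by self-distributivity: summed over the coproduct of z, (y \<lhd> z1) \<lhd> (x \<lhd>
  z2) is (y \<lhd> x) \<lhd> z.\<close>

lemma T_act_U_ideal:
  assumes y: "y \<in> vcarrier C" and t: "t \<in> J"
  shows "y \<cdot> t = 0"
proof -
  \<comment> \<open>Quantified over all \<open>y\<close>, since multiplication by \<open>a\<close>
    on the left replaces \<open>y\<close> by \<open>y \<cdot> a\<close>.\<close>
  let ?I = "{t \<in> vcarrier T. \<forall>y\<in>vcarrier C. y \<cdot> t = 0}"
  note r = bilinear_map_right[OF T_act_bilinear] and mem = bilinear_map_mem[OF T_act_bilinear]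
    linear_map_mem[OF incl_lin] bilinear_map_mem[OF rack_bilinear] alg_T(7)
  have zero: "0 \<cdot> t = 0" if "t \<in> vcarrier T" for t
    by (rule linear_map_zero[OF bilinear_map_left[OF T_act_bilinear that] space_C space_C])
  have "J \<subseteq> ?I"
  proof (rule U_ideal_least)
    show "module.subspace free_scale ?I"
      using is_space_closed(1,2,3)[OF space_T] linear_map_zero[OF r space_T space_C]
        linear_map_add[OF r] linear_map_scale[OF r] scale_zero_right_space[OF space_C]
      by (auto simp: module.subspace_def[OF module_free_scale])
    fix x z assume x: "x \<in> vcarrier C" and z: "z \<in> vcarrier C"
    have "y \<cdot> relator x z = 0" if y: "y \<in> vcarrier C" for y
    proof -
      have "y \<cdot> SC T (\<lambda>z1 z2. mT (i z1) (i (x \<lhd> z2))) (cop C z) = (y \<lhd> x) \<lhd> z"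
        using x y z by (simp add: sweedler_push[OF r[OF y] space_T space_C] mem T_act_mult T_act_incl self_distributive)
      then show ?thesis
        unfolding relator_def using x y z
        by (subst linear_map_diff[OF r[OF y] space_T])
          (simp_all add: sweedler_mem[OF space_T] mem T_act_mult T_act_incl)
    qed
    then show "relator x z \<in> ?I" using relator_mem[OF x z] by simp
  qed (auto simp: alg_T T_act_mult mem zero)
  then show ?thesis using t y by auto
qed

lemma T_act_p:
  assumes "y \<in> vcarrier C" "t \<in> vcarrier T"
  shows "y \<cdot> p t = y \<cdot> t"
  using linear_map_diff[OF bilinear_map_right[OF T_act_bilinear assms(1)] space_T U_T[OF p_mem[OF assms(2)]] assms(2)]
    T_act_U_ideal[OF assms(1) p_diff_mem[OF assms(2)]] by simp

lemma act_bilinear: "bilinear_map C U C (T_act C)"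
  using T_act_bilinear U_T by (auto simp: bilinear_map_def linear_map_def)

lemma act_one: "y \<in> vcarrier C \<Longrightarrow> y \<cdot> eU = y"
  by (simp add: U_ops T_act_p alg_T T_act_word)

lemma act_mult: "y \<in> vcarrier C \<Longrightarrow> g \<in> vcarrier U \<Longrightarrow> h \<in> vcarrier U \<Longrightarrow> y \<cdot> mU g h = (y \<cdot> g) \<cdot> h"
  by (simp add: U_ops T_act_p alg_T U_T T_act_mult)

lemma act_q: "y \<in> vcarrier C \<Longrightarrow> x \<in> vcarrier C \<Longrightarrow> y \<cdot> q x = y \<lhd> x"
  by (simp add: q_eq T_act_p linear_map_mem[OF incl_lin] T_act_incl)

lemma V_rack: "v \<in> vcarrier V \<Longrightarrow> x \<in> vcarrier C \<Longrightarrow> v \<lhd> x \<in> vcarrier V"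
  by (simp add: V_mem bilinear_map_mem[OF rack_bilinear] counit_rack)

lemma V_C: "v \<in> vcarrier V \<Longrightarrow> v \<in> vcarrier C"
  by (simp add: V_mem)

text \<open>Generators preserve the kernel because \<epsilon>(v \<lhd> x) =
  \<epsilon>(v)\<epsilon>(x). The vector is generalised, as the induction step passes to v \<lhd>
  x.\<close>

lemma act_V:
  assumes "g \<in> vcarrier U" "v \<in> vcarrier V"
  shows "v \<cdot> g \<in> vcarrier V"
  using assms
proof (induction arbitrary: v rule: U_induct)
  case (gen x u)
  then show ?case by (simp add: act_mult act_q V_C linear_map_mem[OF q_lin] V_rack)
next
  case (add g h)
  then show ?case
    using linear_map_add[OF bilinear_map_right[OF act_bilinear V_C]] by (simp add: is_space_add[OF space_V])
next
  case (scale a g)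
  then show ?case
    using linear_map_scale[OF bilinear_map_right[OF act_bilinear V_C], of v g a] is_space_scale[OF space_V, of "v \<cdot> g" a] by simp
qed (simp add: act_one V_C)

lemma act_V_bilinear: "bilinear_map V U V (T_act C)"
  using act_bilinear act_V by (auto simp: bilinear_map_def linear_map_def V_C)

section \<open>The coaction on the kernel of the counit\<close>

lemmas [multilin] = linear_map_mem[OF aug_lin] linear_map_compose[OF aug_lin]
  V_rack bilinear_map_mem[OF act_bilinear] act_V
  bilinear_map_compose_left[OF act_V_bilinear] bilinear_map_compose_right[OF act_V_bilinear]
  bilinear_map_compose_left[OF act_bilinear] bilinear_map_compose_right[OF act_bilinear]
  linear_map_mem[OF cop_U_lin] linear_map_compose[OF cop_U_lin] V_C_lin

text \<open>Since 1 \<lhd> x = \<epsilon>(x)1, acting by \<open>x\<close> respects the splitting of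
  \<open>C\<close> into scalars and kernel, so it commutes with the projection to the
  kernel.\<close>

lemma aug_rack: "v \<in> vcarrier C \<Longrightarrow> x \<in> vcarrier C \<Longrightarrow> aug (v \<lhd> x) = aug v \<lhd> x"
  using linear_map_diff[OF bilinear_map_left[OF rack_bilinear, of x] space_C, of v "vscale C (counit C v) (rone C)"]
    linear_map_scale[OF bilinear_map_left[OF rack_bilinear, of x] one_C(1), of "counit C v"]
    vector_space.vector_space_assms(3)[OF is_space_vector_space[OF space_C]]
  by (simp add: is_space_scale[OF space_C] one_C one_rack counit_rack)

lemma ker_coact_eq:
  "x \<in> vcarrier C \<Longrightarrow> \<delta> x = SC (V \<otimes>\<^sub>k U) (\<lambda>a b. tens V U (aug a) (q b)) (cop C x)"
  unfolding ker_coact_def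
  by (rule tensor_map_sweedler[OF space_C space_C linear_map_mem[OF cop_lin]])

text \<open>The formula makes sense on all of \<open>C\<close>. This larger domain is used because
  the coproduct of an element of the kernel has legs outside the kernel.\<close>

lemma ker_coact_lin: "linear_map C (V \<otimes>\<^sub>k U) \<delta>"
  by (rule linear_map_cong[OF space_C _ ker_coact_eq[symmetric]]) (rule multilin | assumption)+

lemma ker_coact_lin_V: "linear_map V (V \<otimes>\<^sub>k U) \<delta>"
  by (rule linear_map_compose[OF ker_coact_lin V_C_lin])

lemmas [multilin] = linear_map_mem[OF ker_coact_lin_V] linear_map_compose[OF ker_coact_lin_V]

lemma ker_coact_sweedler:
  assumes "is_space Z" "bilinear_map V U Z F" "x \<in> vcarrier C"
  shows "SV Z F (\<delta> x) = SC Z (\<lambda>a b. F (aug a) (q b)) (cop C x)"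
  by (simp add: ker_coact_eq[OF assms(3)] sweedler_sweedler[OF assms(1)] linear_map_mem[OF q_lin]
      linear_map_mem[OF aug_lin] sweedler_tens[OF space_V space_U assms(1,2)])

lemma ker_coact_one: "\<delta> (rone C) = 0"
proof -
  have "bilinear_map C C (V \<otimes>\<^sub>k U) (\<lambda>a b. tens V U (aug a) (q b))"
    by (rule multilin | assumption)+
  then have "\<delta> (rone C) = tens V U (aug (rone C)) (q (rone C))"
    by (simp add: ker_coact_eq one_C(1,2) sweedler_tens[OF space_C space_C is_space_tensor])
  also have "\<dots> = 0"
    unfolding aug_one using linear_map_mem[OF q_lin one_C(1)]
    by (intro linear_map_zero[OF bilinear_map_left[OF bilinear_tens] space_V is_space_tensor])
  finally show ?thesis .
qed

text \<open>The coaction vanishes at 1, so correcting its argument by a multiple of 1 has no effect.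
  In the iterated coaction this removes the correction of the inner argument and leaves
  coassociativity of \<open>C\<close>.\<close>

lemma ker_coact_aug: "x \<in> vcarrier C \<Longrightarrow> \<delta> (aug x) = \<delta> x"
  using linear_map_diff[OF ker_coact_lin space_C, of x "vscale C (counit C x) (rone C)"]
    linear_map_scale[OF ker_coact_lin one_C(1), of "counit C x"]
  by (simp add: is_space_scale[OF space_C] one_C(1) ker_coact_one
      vector_space_free_scale[THEN module_iff_vector_space[THEN iffD2], THEN module.scale_zero_right])

lemma ker_coact_counit:
  assumes v: "v \<in> vcarrier V"
  shows "SV V (\<lambda>a b. vscale V (counit U b) a) (\<delta> v) = v"
proof -
  note s = bilinear_map_compose_left[OF bilinear_map_scale[OF space_V]]
    bilinear_map_compose_right[OF bilinear_map_scale[OF space_V]]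
    is_algebra_mapD(1,4)[OF counit_U_map]
  have b: "bilinear_map V U V (\<lambda>a b. vscale V (counit U b) a)"
    by (rule multilin s | assumption)+
  show ?thesis
    unfolding ker_coact_sweedler[OF space_V b V_C[OF v]]
    using cop_counit(2)[OF coalg V_C[OF v] space_V aug_lin] by (simp add: counit_q aug_V[OF v])
qed

lemma ker_coact_coassoc:
  assumes v: "v \<in> vcarrier V"
  shows "tensor_assoc V U U (tensor_map (V \<otimes>\<^sub>k U) U \<delta> id (\<delta> v)) = tensor_map V UU id (cop U) (\<delta> v)"
proof -
  let ?Z = "V \<otimes>\<^sub>k UU"
  let ?t = "\<lambda>a b d. tens V UU a (tens U U b d)"
  note m = linear_map_mem[OF ker_coact_lin_V v]
  have b1: "bilinear_map V U ?Z (\<lambda>x d. SV ?Z (\<lambda>a b. ?t a b d) (\<delta> x))"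
    by (rule multilin | assumption)+
  have b2: "bilinear_map V U ?Z (\<lambda>a y. SU ?Z (\<lambda>b d. ?t a b d) (cop U y))"
    by (rule multilin | assumption)+
  have b3: "bilinear_map V U ?Z (\<lambda>a b. ?t a b d)" if "d \<in> vcarrier U" for d
    by (insert that, (rule multilin | assumption)+)
  have b4: "bilinear_map U U ?Z (\<lambda>b d. ?t a b d)" if "a \<in> vcarrier V" for a
    by (insert that, (rule multilin | assumption)+)
  have "SC ?Z (\<lambda>x d. SC ?Z (\<lambda>a b. ?t (aug a) (q b) (q d)) (cop C x)) (cop C v) =
    SC ?Z (\<lambda>a y. SC ?Z (\<lambda>b d. ?t (aug a) (q b) (q d)) (cop C y)) (cop C v)"
    by (rule cop_coassoc[OF coalg V_C[OF v] is_space_tensor]) (rule multilin | assumption)+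
  then show ?thesis
    unfolding tensor_assoc_map_sweedler[OF space_V space_V space_U space_U ker_coact_lin_V m]
      tensor_map_id_sweedler[OF space_U space_V space_U space_U cop_U_lin m]
    by (simp add: ker_coact_sweedler[OF is_space_tensor] b1 b2 b3 b4 V_C[OF v] ker_coact_aug
        cop_q_sweedler[OF is_space_tensor] linear_map_mem[OF q_lin] linear_map_mem[OF aug_lin])
qed

text \<open>Bracketed to the left, the first two of three legs form a coproduct of their own, to
  which cocommutativity applies.\<close>

lemma cop_swap_left:
  assumes x: "x \<in> vcarrier C" and Z: "is_space Z"
    and G: "\<And>b d. b \<in> vcarrier C \<Longrightarrow> d \<in> vcarrier C \<Longrightarrow> linear_map C Z (\<lambda>a. G a b d)"
      "\<And>a d. a \<in> vcarrier C \<Longrightarrow> d \<in> vcarrier C \<Longrightarrow> linear_map C Z (\<lambda>b. G a b d)"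
      "\<And>a b. a \<in> vcarrier C \<Longrightarrow> b \<in> vcarrier C \<Longrightarrow> linear_map C Z (\<lambda>d. G a b d)"
  shows "SC Z (\<lambda>a b. SC Z (\<lambda>c d. G a c d) (cop C b)) (cop C x) =
    SC Z (\<lambda>a b. SC Z (\<lambda>c d. G c a d) (cop C b)) (cop C x)"
proof -
  have "SC Z (\<lambda>a b. SC Z (\<lambda>c d. G a c d) (cop C b)) (cop C x) =
      SC Z (\<lambda>a b. SC Z (\<lambda>c d. G c d b) (cop C a)) (cop C x)"
    by (rule cop_coassoc[OF coalg x Z, symmetric]) (rule G; assumption)+
  also have "\<dots> = SC Z (\<lambda>a b. SC Z (\<lambda>c d. G d c b) (cop C a)) (cop C x)"
    by (rule sweedler_cong[OF refl], rule cop_cocommutative[OF coalg cocommutative _ Z])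
      (rule bilinear_mapI G | assumption)+
  also have "\<dots> = SC Z (\<lambda>a b. SC Z (\<lambda>c d. G c a d) (cop C b)) (cop C x)"
    by (rule cop_coassoc[OF coalg x Z]) (rule G; assumption)+
  finally show ?thesis .
qed

text \<open>With y1, y2 the coproduct of x2, the left side has aug v1 \<lhd> y1 in the first slot
  and q(x1) q(v2 \<lhd> y2) in the second. Cocommutativity exchanges x1 with y1, after which the sum
  of q(y1) q(v2 \<lhd> y2) is q(v2) q(x2) by the defining relation.\<close>

lemma yetter_drinfeld_q:
  assumes v: "v \<in> vcarrier V" and x: "x \<in> vcarrier C" and Z: "is_space Z" and F: "bilinear_map V U Z F"
  shows "SC Z (\<lambda>x1 x2. SV Z (\<lambda>a b. F a (mU (q x1) b)) (\<delta> (v \<lhd> x2))) (cop C x) =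
    SC Z (\<lambda>x1 x2. SV Z (\<lambda>a b. F (a \<lhd> x1) (mU b (q x2))) (\<delta> v)) (cop C x)"
proof -
  have rackV: "bilinear_map V C V (rack C)"
    using rack_bilinear V_rack by (simp add: bilinear_map_def linear_map_def V_C)
  note [multilin] = Z bilinear_map_mem[OF F] bilinear_map_compose_left[OF F] bilinear_map_compose_right[OF F]
    bilinear_map_compose_left[OF rackV] bilinear_map_compose_right[OF rackV]
  note mem = linear_map_mem[OF q_lin] linear_map_mem[OF aug_lin] bilinear_map_mem[OF rack_bilinear] V_C[OF v]
  have b1: "bilinear_map V U Z (\<lambda>a b. F a (mU (q x1) b))" if "x1 \<in> vcarrier C" for x1
    by (insert that, (rule multilin | assumption)+)
  have b2: "bilinear_map V U Z (\<lambda>a b. F (a \<lhd> x1) (mU b (q x2)))"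
    if "x1 \<in> vcarrier C" "x2 \<in> vcarrier C" for x1 x2
    by (insert that, (rule multilin | assumption)+)
  have b3: "bilinear_map C C Z (\<lambda>a b. F (aug a) (mU (q x1) (q b)))" if "x1 \<in> vcarrier C" for x1
    by (insert that, (rule multilin | assumption)+)
  have "SC Z (\<lambda>x1 x2. SV Z (\<lambda>a b. F a (mU (q x1) b)) (\<delta> (v \<lhd> x2))) (cop C x) =
    SC Z (\<lambda>x1 x2. SC Z (\<lambda>v1 v2. SC Z (\<lambda>y1 y2.
      F (aug v1 \<lhd> y1) (mU (q x1) (q (v2 \<lhd> y2)))) (cop C x2)) (cop C v)) (cop C x)"
    by (simp add: ker_coact_sweedler[OF Z b1] mem cop_rack_sweedler[OF Z b3] aug_rack)
  also have "\<dots> = SC Z (\<lambda>v1 v2. SC Z (\<lambda>x1 x2. SC Z (\<lambda>y1 y2.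
      F (aug v1 \<lhd> y1) (mU (q x1) (q (v2 \<lhd> y2)))) (cop C x2)) (cop C x)) (cop C v)"
    by (rule sweedler_swap[OF Z])
  also have "\<dots> = SC Z (\<lambda>v1 v2. SC Z (\<lambda>x1 x2. SC Z (\<lambda>y1 y2.
      F (aug v1 \<lhd> x1) (mU (q y1) (q (v2 \<lhd> y2)))) (cop C x2)) (cop C x)) (cop C v)"
    by (rule sweedler_cong[OF refl], rule cop_swap_left[OF x Z]) (rule multilin | assumption)+
  also have "\<dots> = SC Z (\<lambda>v1 v2. SC Z (\<lambda>x1 x2.
      F (aug v1 \<lhd> x1) (mU (q v2) (q x2))) (cop C x)) (cop C v)"
  proof (rule sweedler_cong[OF refl], rule sweedler_cong[OF refl])
    fix v1 v2 x1 x2 assume a: "v1 \<in> vcarrier C" "v2 \<in> vcarrier C" "x1 \<in> vcarrier C" "x2 \<in> vcarrier C"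
    have w: "aug v1 \<lhd> x1 \<in> vcarrier V" using a by (simp add: V_rack mem)
    show "SC Z (\<lambda>y1 y2. F (aug v1 \<lhd> x1) (mU (q y1) (q (v2 \<lhd> y2)))) (cop C x2) =
        F (aug v1 \<lhd> x1) (mU (q v2) (q x2))"
      unfolding U_relation[OF a(2,4), symmetric] using a
      by (subst sweedler_push[OF bilinear_map_right[OF F w] space_U Z]) (simp_all add: mem alg_U(7))
  qed
  also have "\<dots> = SC Z (\<lambda>x1 x2. SC Z (\<lambda>v1 v2.
      F (aug v1 \<lhd> x1) (mU (q v2) (q x2))) (cop C v)) (cop C x)"
    by (rule sweedler_swap[OF Z])
  also have "\<dots> = SC Z (\<lambda>x1 x2. SV Z (\<lambda>a b. F (a \<lhd> x1) (mU b (q x2))) (\<delta> v)) (cop C x)"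
    by (simp add: ker_coact_sweedler[OF Z b2] mem)
  finally show ?thesis .
qed

text \<open>Multiplicativity in \<open>g\<close>, organised as an induction for all \<open>v\<close>
  at once: for q(x) u the hypothesis on u is applied to v \<lhd> x2, and what remains is the case of
  the generator q(x).\<close>

lemma yetter_drinfeld_U:
  assumes g: "g \<in> vcarrier U" and v: "v \<in> vcarrier V"
  shows "SU (V \<otimes>\<^sub>k U) (\<lambda>g1 g2. SV (V \<otimes>\<^sub>k U)
      (\<lambda>a b. tens V U a (mU g1 b)) (\<delta> (v \<cdot> g2))) (cop U g) =
    SU (V \<otimes>\<^sub>k U) (\<lambda>g1 g2. SV (V \<otimes>\<^sub>k U)
      (\<lambda>a b. tens V U (a \<cdot> g1) (mU b g2)) (\<delta> v)) (cop U g)"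
  using g v
proof (induction arbitrary: v rule: U_induct)
  case one
  let ?Z = "V \<otimes>\<^sub>k U"
  note v = one.prems
  have b1: "bilinear_map U U ?Z (\<lambda>g1 g2. SV ?Z (\<lambda>a b. tens V U a (mU g1 b)) (\<delta> (v \<cdot> g2)))"
    by (insert v V_C[OF v], (rule multilin | assumption)+)
  have b2: "bilinear_map U U ?Z (\<lambda>g1 g2. SV ?Z (\<lambda>a b. tens V U (a \<cdot> g1) (mU b g2)) (\<delta> v))"
    by (insert v V_C[OF v], (rule multilin | assumption)+)
  show ?case
    using v by (simp add: is_algebra_mapD(2)[OF cop_U_map] sweedler_tens[OF space_U space_U is_space_tensor b1]
        sweedler_tens[OF space_U space_U is_space_tensor b2] alg_U act_one V_C)
next
  case (gen x u)
  let ?Z = "V \<otimes>\<^sub>k U"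
  note v = gen.prems and u = gen.hyps(2) and x = V_C[OF gen.hyps(1)]
  note mem = linear_map_mem[OF q_lin] alg_U(7) V_C V_rack act_V
  have b1: "bilinear_map U U ?Z (\<lambda>g1 g2. SV ?Z (\<lambda>a b. tens V U a (mU g1 b)) (\<delta> (v \<cdot> g2)))"
    by (insert v V_C[OF v], (rule multilin | assumption)+)
  have b2: "bilinear_map U U ?Z (\<lambda>g1 g2. SV ?Z (\<lambda>a b. tens V U (a \<cdot> g1) (mU b g2)) (\<delta> v))"
    by (insert v V_C[OF v], (rule multilin | assumption)+)
  have b3: "bilinear_map V U ?Z (\<lambda>a c. tens V U a (mU (q x1) c))" if "x1 \<in> vcarrier C" for x1
    by (insert that, (rule multilin | assumption)+)
  have b4: "bilinear_map V U ?Z (\<lambda>a c. tens V U (a \<cdot> u1) (mU c u2))" if "u1 \<in> vcarrier U" "u2 \<in> vcarrier U" for u1 u2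
    by (insert that, (rule multilin | assumption)+)
  have b5: "bilinear_map U U ?Z (\<lambda>k1 k2. SU ?Z (\<lambda>u1 u2. SV ?Z (\<lambda>a b.
      tens V U a (mU (mU k1 u1) b)) (\<delta> (v \<cdot> mU k2 u2))) (cop U u))"
    by (insert v u V_C[OF v], (rule multilin | assumption)+)
  have b6: "bilinear_map U U ?Z (\<lambda>k1 k2. SU ?Z (\<lambda>u1 u2. SV ?Z (\<lambda>a b.
      tens V U (a \<cdot> mU k1 u1) (mU b (mU k2 u2))) (\<delta> v)) (cop U u))"
    by (insert v u V_C[OF v], (rule multilin | assumption)+)
  \<comment> \<open>The induction hypothesis with its second tensor factor multiplied by q(x1) on
    the left; the linear map doing this is applied to both sides.\<close>
  have IH: "SU ?Z (\<lambda>u1 u2. SV ?Z (\<lambda>a b. tens V U a (mU (q x1) (mU u1 b))) (\<delta> (w \<cdot> u2))) (cop U u) =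
      SU ?Z (\<lambda>u1 u2. SV ?Z (\<lambda>a b. tens V U (a \<cdot> u1) (mU (q x1) (mU b u2))) (\<delta> w)) (cop U u)"
    if "x1 \<in> vcarrier C" "w \<in> vcarrier V" for x1 w
    using arg_cong[OF gen.IH[OF that(2)], of "SV ?Z (\<lambda>a c. tens V U a (mU (q x1) c))"]
    by (simp add: sweedler_sweedler[OF is_space_tensor] sweedler_tens[OF space_V space_U is_space_tensor b3[OF that(1)]]
        mem)
  have cm: "SU ?Z F (cop U (mU (q x) u)) = SU ?Z (\<lambda>k1 k2. SU ?Z
      (\<lambda>u1 u2. F (mU k1 u1) (mU k2 u2)) (cop U u)) (cop U (q x))" if "bilinear_map U U ?Z F" for F
    using x u by (intro cop_mult_sweedler[OF coalgebra_U coalgebra_U space_U is_space_tensor alg_U(2)])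
      (simp_all add: mem is_algebra_mapD(3)[OF cop_U_map] that)
  have "SU ?Z (\<lambda>g1 g2. SV ?Z (\<lambda>a b. tens V U a (mU g1 b)) (\<delta> (v \<cdot> g2))) (cop U (mU (q x) u)) =
    SC ?Z (\<lambda>x1 x2. SU ?Z (\<lambda>u1 u2. SV ?Z (\<lambda>a b.
      tens V U a (mU (q x1) (mU u1 b))) (\<delta> ((v \<lhd> x2) \<cdot> u2))) (cop U u)) (cop C x)"
    unfolding cm[OF b1] cop_q_sweedler[OF is_space_tensor b5 x] using v by (simp add: alg_U(4) act_mult act_q mem)
  also have "\<dots> = SC ?Z (\<lambda>x1 x2. SU ?Z (\<lambda>u1 u2. SV ?Z (\<lambda>a b.
      tens V U (a \<cdot> u1) (mU (mU (q x1) b) u2)) (\<delta> (v \<lhd> x2))) (cop U u)) (cop C x)"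
    using v by (simp add: IH mem alg_U(4))
  \<comment> \<open>With the sums exchanged, \<open>u1\<close> and \<open>u2\<close> are fixed, and
    the generator case applies to the bilinear map sending \<open>a\<close> and \<open>c\<close> to
    \<open>tens V U (a \<cdot> u1) (mU c u2)\<close>.\<close>
  also have "\<dots> = SU ?Z (\<lambda>u1 u2. SC ?Z (\<lambda>x1 x2. SV ?Z (\<lambda>a b.
      tens V U (a \<cdot> u1) (mU (mU (q x1) b) u2)) (\<delta> (v \<lhd> x2))) (cop C x)) (cop U u)"
    by (rule sweedler_swap[OF is_space_tensor])
  also have "\<dots> = SU ?Z (\<lambda>u1 u2. SC ?Z (\<lambda>x1 x2. SV ?Z (\<lambda>a b.
      tens V U ((a \<lhd> x1) \<cdot> u1) (mU (mU b (q x2)) u2)) (\<delta> v)) (cop C x)) (cop U u)"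
    by (rule sweedler_cong[OF refl]) (rule yetter_drinfeld_q[OF v x is_space_tensor b4])
  also have "\<dots> = SC ?Z (\<lambda>x1 x2. SU ?Z (\<lambda>u1 u2. SV ?Z (\<lambda>a b.
      tens V U ((a \<lhd> x1) \<cdot> u1) (mU (mU b (q x2)) u2)) (\<delta> v)) (cop U u)) (cop C x)"
    by (rule sweedler_swap[OF is_space_tensor])
  also have "\<dots> = SU ?Z (\<lambda>g1 g2. SV ?Z (\<lambda>a b. tens V U (a \<cdot> g1) (mU b g2)) (\<delta> v)) (cop U (mU (q x) u))"
    unfolding cm[OF b2] cop_q_sweedler[OF is_space_tensor b6 x] using v by (simp add: alg_U(4) act_mult act_q mem)
  finally show ?case .
next
  case (add g h)
  then show ?case by (simp add: linear_map_add[OF cop_U_lin] sweedler_total_linear[OF is_space_tensor])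
next
  case (scale a g)
  then show ?case
    using linear_map_scale[OF cop_U_lin, of g a] by (simp add: sweedler_total_linear[OF is_space_tensor])
qed

text \<open>For g = q(y) this is the defining relation. For q(x) u, the hypothesis on u at v \<lhd>
  x2 leaves the sum of q(x1) q(v \<lhd> x2) u, which the relation for v and x turns into q(v) q(x)
  u.\<close>

lemma U_relation_act:
  assumes g: "g \<in> vcarrier U" and v: "v \<in> vcarrier V"
  shows "SU U (\<lambda>g1 g2. mU g1 (q (v \<cdot> g2))) (cop U g) = mU (q v) g"
  using g v
proof (induction arbitrary: v rule: U_induct)
  case one
  note v = one.prems
  have b: "bilinear_map U U U (\<lambda>g1 g2. mU g1 (q (v \<cdot> g2)))"
    by (insert v V_C[OF v], (rule multilin | assumption)+)
  show ?case
    using v by (simp add: is_algebra_mapD(2)[OF cop_U_map] sweedler_tens[OF space_U space_U space_U b] alg_U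
        act_one V_C linear_map_mem[OF q_lin])
next
  case (gen x u)
  note v = gen.prems and u = gen.hyps(2) and x = V_C[OF gen.hyps(1)]
  note mem = linear_map_mem[OF q_lin] alg_U(7) V_C V_rack act_V bilinear_map_mem[OF rack_bilinear]
  have b1: "bilinear_map U U U (\<lambda>g1 g2. mU g1 (q (v \<cdot> g2)))"
    by (insert v V_C[OF v], (rule multilin | assumption)+)
  have b2: "bilinear_map U U U (\<lambda>k1 k2. SU U (\<lambda>u1 u2. mU (mU k1 u1) (q (v \<cdot> mU k2 u2))) (cop U u))"
    by (insert v u V_C[OF v], (rule multilin | assumption)+)
  have p: "SU U (\<lambda>u1 u2. mU (q x1) (mU u1 (q (w \<cdot> u2)))) (cop U u) = mU (q x1) (mU (q w) u)"
    if "x1 \<in> vcarrier C" "w \<in> vcarrier V" for x1 w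
    unfolding gen.IH[OF that(2), symmetric] using that
    by (subst sweedler_push[OF bilinear_map_right[OF alg_U(2)] space_U space_U]) (simp_all add: mem)
  have "SU U (\<lambda>g1 g2. mU g1 (q (v \<cdot> g2))) (cop U (mU (q x) u)) =
    SU U (\<lambda>k1 k2. SU U (\<lambda>u1 u2. mU (mU k1 u1) (q (v \<cdot> mU k2 u2))) (cop U u)) (cop U (q x))"
    using x u by (intro cop_mult_sweedler[OF coalgebra_U coalgebra_U space_U space_U alg_U(2)])
      (simp_all add: mem is_algebra_mapD(3)[OF cop_U_map] b1)
  also have "\<dots> = SC U (\<lambda>x1 x2. SU U (\<lambda>u1 u2. mU (q x1) (mU u1 (q ((v \<lhd> x2) \<cdot> u2)))) (cop U u)) (cop C x)"
    unfolding cop_q_sweedler[OF space_U b2 x] using v by (simp add: alg_U(4) act_mult act_q mem)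
  also have "\<dots> = SC U (\<lambda>x1 x2. mU (mU (q x1) (q (v \<lhd> x2))) u) (cop C x)"
    using v u by (simp add: p mem alg_U(4))
  also have "\<dots> = mU (SC U (\<lambda>x1 x2. mU (q x1) (q (v \<lhd> x2))) (cop C x)) u"
    using v u by (subst sweedler_push[OF bilinear_map_left[OF alg_U(2)] space_U space_U]) (simp_all add: mem)
  also have "\<dots> = mU (q v) (mU (q x) u)"
    using v u x by (simp add: U_relation mem alg_U(4))
  finally show ?case .
next
  case (add g h)
  then show ?case
    by (simp add: linear_map_add[OF cop_U_lin] sweedler_total_linear[OF space_U]
        linear_map_add[OF bilinear_map_right[OF alg_U(2)]] linear_map_mem[OF q_lin] V_C)
next
  case (scale a g)
  then show ?case
    using linear_map_scale[OF cop_U_lin, of g a] linear_map_scale[OF bilinear_map_right[OF alg_U(2)], of "q v" g a]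
    by (simp add: sweedler_total_linear[OF space_U] linear_map_mem[OF q_lin] V_C)
qed

text \<open>The coproduct of q(v) is q(v1) \<otimes> q(v2). Replacing v1 by its projection to the
  kernel subtracts \<epsilon>(v1) 1 \<otimes> q(v2), which sums to 1 \<otimes> q(v).\<close>

lemma cop_q_coderivation:
  assumes v: "v \<in> vcarrier V"
  shows "cop U (q v) = tens U U eU (q v) + SV UU (\<lambda>a b. tens U U (q a) b) (\<delta> v)"
proof -
  let ?Z = "UU"
  note x = V_C[OF v] and mem = linear_map_mem[OF q_lin]
  have b: "bilinear_map V U ?Z (\<lambda>a b. tens U U (q a) b)"
    by (rule multilin | assumption | rule V_C)+
  have qa: "q (aug a) = q a - vscale U (counit C a) eU" if "a \<in> vcarrier C" for a
    using that linear_map_diff[OF q_lin space_C, of a "vscale C (counit C a) (rone C)"]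
      linear_map_scale[OF q_lin one_C(1), of "counit C a"]
    by (simp add: is_space_scale[OF space_C] one_C(1) q_one)
  have t: "tens U U (q (aug a)) (q b) = tens U U (q a) (q b) - vscale ?Z (counit C a) (tens U U eU (q b))"
    if "a \<in> vcarrier C" "b \<in> vcarrier C" for a b
    using that linear_map_diff[OF bilinear_map_left[OF bilinear_tens[of U U]] space_U, of "q b" "q a" "vscale U (counit C a) eU"]
      linear_map_scale[OF bilinear_map_left[OF bilinear_tens[of U U]] alg_U(3), of "q b" "counit C a"]
    by (simp add: qa mem alg_U is_space_scale[OF space_U, unfolded vscale_U])
  have "linear_map C ?Z (\<lambda>b. tens U U eU (q b))"
    by (rule multilin | assumption)+
  from cop_counit(1)[OF coalg x is_space_tensor this]
  have "SV ?Z (\<lambda>a b. tens U U (q a) b) (\<delta> v) = cop U (q v) - tens U U eU (q v)"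
    by (simp add: ker_coact_sweedler[OF is_space_tensor b x] t sweedler_diff[OF is_space_tensor] cop_q[OF x]
        del: vscale_tensor)
  then show ?thesis by simp
qed

sublocale YD: yetter_drinfeld_map U V "T_act C" \<delta> q
proof
  show "is_bialgebra U" by (rule bialgebra_U)
  show "linear_map V U q" by (rule linear_map_compose[OF q_lin V_C_lin])
qed (simp_all add: space_V act_V_bilinear act_one act_mult V_C ker_coact_lin_V ker_coact_counit[unfolded V_simps]
    ker_coact_coassoc yetter_drinfeld_U U_relation_act cop_q_coderivation)

end

theorem theorem2:
  fixes C :: "('k::field, 'c::ab_group_add) rack_bialgebra"
  assumes "is_rack_bialgebra C" and "cocommutative C"
  shows "is_LM_bialgebra (U_bialg C) (U_tetra C) (U_map C) \<and>
    (\<forall>m\<in>vcarrier (U_tetra C).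
       tensor_map (U_bialg C) (U_tetra C \<otimes>\<^sub>k U_bialg C) id (rcoact (U_tetra C))
         (lcoact (U_tetra C) m) = joint_coact C m)"
proof -
  interpret cocommutative_rack_bialgebra C using assms by unfold_locales
  \<comment> \<open>Both records unfold to the same operations, as \<open>U_act\<close> is
    \<open>T_act\<close> on representatives.\<close>
  have M: "U_tetra C = yd_tetramodule U V (T_act C) (ker_coact C)"
    by (simp add: U_tetra_def yd_tetramodule_def U_act_def[abs_def] Let_def)
  have f: "U_map C = tensor_lift U (\<lambda>s c. mU s (q c))"
    by (simp add: U_map_def)
  \<comment> \<open>The second conjunct confirms that the separately defined left and right
    coactions combine to the prescribed joint one.\<close>
  show ?thesis
    unfolding joint_coact_def Let_def unfolding M f
    using YD.LM_bialgebra YD.joint_coact by blast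
qed

end
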